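(* Assume that siblings in $\mathscr A$ have comparable measure, i.e. there is a constant $c_0>0$ such that $|A'|\ge c_0|A''|$ for all $A\in\mathscr A$. Then there are constants $\lambda_0>0$ and $c>0$ such that for each $\ell$-sparse smartingale $(f_n)_{n\ge0}$ with respect to Lebesgue measure $\mathbb P$ and each $\lambda\in(0,\lambda_0]$ there exists a (Borel) probability measure $\tilde{\mathbb P}$ on $\Omega$ such that $(\tilde f_n)$ is a smartingale with respect to $\tilde{\mathbb P}$, and such that for each pair of atoms $B\subset A$ in $\mathscr A$, $$\Big(\frac{|B|}{|A|}\Big)^{1+c\lambda}\le\frac{\tilde{\mathbb P}(B)}{\tilde{\mathbb P}(A)}\le\Big(\frac{|B|}{|A|}\Big)^{1-c\lambda}.$$ Here $\tilde f_0=f_0$ and $\tilde f_n-\tilde f_{n-1}=\Delta f_n-\lambda p_n$ for $n\ge1$, where $p_n\in S_n$ are given non-negative functions with $\kappa^{-1}\,\mathbb E_n|\Delta f_n|\le\mathbb E_np_n\le\kappa\,\mathbb E_n|\Delta f_n|$ pointwise on $\Omega$ for some fixed constant $\kappa\ge1$. The constants $\lambda_0,c$ depend only on the data ($\Omega$, $S$, $\mathscr A$) and $\kappa$.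
   Context: Setting. $\Omega\subset\mathbb R^d$ is a convex compact set and $\mathbb P=|\cdot|$ is $d$-dimensional Lebesgue measure on $\Omega$, normalized so that $|\Omega|=1$. $(\mathscr F_n)_{n\ge 0}$ is a filtration with $\mathscr F_0=\{\emptyset,\Omega\}$ such that for each $n\ge 1$, $\mathscr F_n$ is generated by subdividing each atom $A$ of $\mathscr F_{n-1}$ into two atoms $A',A''$ of $\mathscr F_n$ (the siblings) with $|A''|\ge|A'|>0$. $\mathscr A_n$ is the set of atoms of $\mathscr F_n$ and $\mathscr A=\bigcup_n\mathscr A_n$. Every atom is convex, $\max_{A\in\mathscr A_n}\operatorname{diam}A\to0$ as $n\to\infty$, and there is a constant $c_4>0$ with $w(A)\ge c_4\operatorname{diam}A$ for all $A\in\mathscr A$, where $w(A)$ is the minimal distance between two parallel supporting hyperplanes of $A$. $\mathbb E_n$ is conditional expectation with respect to $\mathscr F_n$ and Lebesgue measure. $S$ is a finite-dimensional vector space of real polynomials on $\Omega$ with $\dim S>1$, containing the constant function $1$; $S^2=\operatorname{span}\{g_1g_2:g_1,g_2\in S\}$. $S_n$ is the space of functions $f:\Omega\to\mathbb R$ such that for each $A\in\mathscr A_n$ there is $g\in S$ with $f=g$ on $A$. For a probability measure $\mu$ on $\Omega$, a sequence $(f_n)_{n\ge0}$ of integrable functions is a smartingale with respect to $\mu$ if $P^\mu_{n-1}f_n=f_{n-1}$ for all $n\ge1$, where $P^\mu_n$ is the orthogonal projection onto $S_n$ in $L^2(\mu)$ (extended to $L^1(\mu)$); for functions $f_n\in S_n$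 this means $\int_A(f_n-f_{n-1})q\,d\mu=0$ for all $n\ge1$, $A\in\mathscr A_{n-1}$, $q\in S$. Put $\Delta f_n=f_n-f_{n-1}$ for $n\ge1$. Sparsity. A smartingale is $\nu$-sparse if $\Delta f_n\ne0$ and $\Delta f_m\neq 0$ imply $n=m$ or $|n-m|\ge\nu+1$. The integer $\ell$. Since siblings have comparable measure there exists an integer $\ell_0\ge0$ such that for every $k\ge\ell_0$ there is $c'>0$ with $\sum_{B\in\mathscr A_{j+k},B\subseteq A}|\int_Bu\,d\mathbb P|\ge c'\int_A|u|\,d\mathbb P$ for all $j\ge0$, $A\in\mathscr A_j$, $u\in S^2$. Such an $\ell_0$ is fixed, and $\ell$ is the smallest integer with $\ell\ge\ell_0$ and $2^{\ell+1}\ge\dim S+\dim S^2$. *)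

theory Defs
  imports "HOL-Probability.Probability" "HOL-Library.Function_Algebras"
begin

section \<open>Spaces of functions\<close>

text \<open>Pointwise scalar multiplication makes \<open>'a \<Rightarrow> real\<close> a real vector space, so that the
  library's \<open>subspace\<close>, \<open>span\<close> and \<open>dim\<close> apply to sets of functions.\<close>

instantiation "fun" :: (type, real_vector) real_vector
begin

definition scaleR_fun :: "real \<Rightarrow> ('a \<Rightarrow> 'b) \<Rightarrow> 'a \<Rightarrow> 'b" where
  "scaleR_fun c f = (\<lambda>x. c *\<^sub>R f x)"

instance
  by standard (simp_all add: scaleR_fun_def fun_eq_iff scaleR_add_right scaleR_add_left)

end

definition square_space :: "('a \<Rightarrow> real) set \<Rightarrow> ('a \<Rightarrow> real) set" where
  "square_space S = span {\<lambda>x. g1 x * g2 x | g1 g2. g1 \<in> S \<and> g2 \<in> S}"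

section \<open>Width of a set\<close>

text \<open>Sets need not be closed (the atoms of a filtration cannot all be), so a supporting hyperplane
  is required to touch the closure.\<close>

definition supporting_hyperplane :: "'a::euclidean_space set \<Rightarrow> 'a \<Rightarrow> real \<Rightarrow> bool" where
  "supporting_hyperplane A u b \<longleftrightarrow>
     u \<noteq> 0 \<and> ((\<forall>x\<in>A. u \<bullet> x \<le> b) \<or> (\<forall>x\<in>A. b \<le> u \<bullet> x)) \<and> (\<exists>x\<in>closure A. u \<bullet> x = b)"

definition width :: "'a::euclidean_space set \<Rightarrow> real" where
  "width A = Inf {setdist {x. u \<bullet> x = a} {x. u \<bullet> x = b} | u a b.
     a \<noteq> b \<and> supporting_hyperplane A u a \<and> supporting_hyperplane A u b}"

section \<open>Binary filtrations\<close>

definition normalized_lebesgue :: "'a::euclidean_space set \<Rightarrow> 'a measure" where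
  "normalized_lebesgue \<Omega> = uniform_measure (restrict_space lborel \<Omega>) \<Omega>"

definition vol :: "'a::euclidean_space set \<Rightarrow> 'a set \<Rightarrow> real" where
  "vol \<Omega> A = measure (normalized_lebesgue \<Omega>) A"

definition atoms :: "'a measure \<Rightarrow> 'a set set" where
  "atoms M = {A \<in> sets M. A \<noteq> {} \<and> (\<forall>B\<in>sets M. B \<subseteq> A \<longrightarrow> B = {} \<or> B = A)}"

text \<open>\<open>siblings \<Omega> F n A A' A''\<close>: the atom \<open>A\<close> of \<open>F n\<close> is split into the atoms
  \<open>A'\<close> and \<open>A''\<close> of \<open>F (Suc n)\<close>, where \<open>A''\<close> is the one of larger measure.\<close>

definition siblings ::
  "'a::euclidean_space set \<Rightarrow> (nat \<Rightarrow> 'a measure) \<Rightarrow> nat \<Rightarrow> 'a set \<Rightarrow> 'a set \<Rightarrow> 'a set \<Rightarrow> bool" where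
  "siblings \<Omega> F n A A' A'' \<longleftrightarrow>
     A \<in> atoms (F n) \<and> A' \<in> atoms (F (Suc n)) \<and> A'' \<in> atoms (F (Suc n)) \<and>
     A' \<union> A'' = A \<and> A' \<inter> A'' = {} \<and> vol \<Omega> A'' \<ge> vol \<Omega> A' \<and> vol \<Omega> A' > 0"

text \<open>The elements of the filtration are measures only because the library's \<open>filtration\<close>
  and \<open>real_cond_exp\<close> encode sigma-algebras that way; their measure component is irrelevant.\<close>

definition binary_filtration ::
  "'a::euclidean_space set \<Rightarrow> (nat \<Rightarrow> 'a measure) \<Rightarrow> bool" where
  "binary_filtration \<Omega> F \<longleftrightarrow>
     filtration \<Omega> F \<and>
     (\<forall>n. subalgebra (normalized_lebesgue \<Omega>) (F n)) \<and>
     sets (F 0) = {{}, \<Omega>} \<and>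
     (\<forall>n. sets (F (Suc n)) = sigma_sets \<Omega> (atoms (F (Suc n)))) \<and>
     (\<forall>n. \<forall>A\<in>atoms (F n). \<exists>A' A''. siblings \<Omega> F n A A' A'')"

definition comparable_siblings ::
  "'a::euclidean_space set \<Rightarrow> (nat \<Rightarrow> 'a measure) \<Rightarrow> real \<Rightarrow> bool" where
  "comparable_siblings \<Omega> F c\<^sub>0 \<longleftrightarrow>
     (\<forall>n A A' A''. siblings \<Omega> F n A A' A'' \<longrightarrow> vol \<Omega> A' \<ge> c\<^sub>0 * vol \<Omega> A'')"

section \<open>Smartingales\<close>

definition piecewise_space ::
  "('a \<Rightarrow> real) set \<Rightarrow> 'a measure \<Rightarrow> ('a \<Rightarrow> real) set" where
  "piecewise_space S M = {f. \<forall>A\<in>atoms M. \<exists>g\<in>S. \<forall>x\<in>A. f x = g x}"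

text \<open>\<open>is_projection \<mu> V f h\<close>: \<open>h\<close> is the orthogonal projection of \<open>f\<close> onto \<open>V\<close> in \<open>L\<^sup>2(\<mu>)\<close>.
  If the members of \<open>V\<close> are bounded on the space of \<open>\<mu>\<close>, this makes sense for all \<open>f \<in> L\<^sup>1(\<mu>)\<close>.
  The function \<open>h\<close> is an actual element of \<open>V\<close>, not an equivalence class modulo \<open>\<mu>\<close>-null sets:
  the same functions are considered with respect to measures that may be mutually singular.\<close>

definition is_projection ::
  "'a measure \<Rightarrow> ('a \<Rightarrow> real) set \<Rightarrow> ('a \<Rightarrow> real) \<Rightarrow> ('a \<Rightarrow> real) \<Rightarrow> bool" where
  "is_projection \<mu> V f h \<longleftrightarrow> h \<in> V \<and> (\<forall>v\<in>V. (\<integral>x. (f x - h x) * v x \<partial>\<mu>) = 0)"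

definition smartingale ::
  "('a \<Rightarrow> real) set \<Rightarrow> (nat \<Rightarrow> 'a measure) \<Rightarrow> 'a measure \<Rightarrow> (nat \<Rightarrow> 'a \<Rightarrow> real) \<Rightarrow> bool" where
  "smartingale S F \<mu> f \<longleftrightarrow>
     (\<forall>n. integrable \<mu> (f n)) \<and>
     (\<forall>n\<ge>1. is_projection \<mu> (piecewise_space S (F (n - 1))) (f n) (f (n - 1)))"

definition increment :: "(nat \<Rightarrow> 'a \<Rightarrow> real) \<Rightarrow> nat \<Rightarrow> 'a \<Rightarrow> real" where
  "increment f n = (\<lambda>x. f n x - f (n - 1) x)"

definition nu_sparse :: "'a set \<Rightarrow> nat \<Rightarrow> (nat \<Rightarrow> 'a \<Rightarrow> real) \<Rightarrow> bool" where
  "nu_sparse \<Omega> \<nu> f \<longleftrightarrow>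
     (\<forall>n\<ge>1. \<forall>m\<ge>1. (\<exists>x\<in>\<Omega>. increment f n x \<noteq> 0) \<and> (\<exists>x\<in>\<Omega>. increment f m x \<noteq> 0) \<longrightarrow>
        n = m \<or> \<bar>int n - int m\<bar> \<ge> int \<nu> + 1)"

primrec perturbed ::
  "(nat \<Rightarrow> 'a \<Rightarrow> real) \<Rightarrow> (nat \<Rightarrow> 'a \<Rightarrow> real) \<Rightarrow> real \<Rightarrow> nat \<Rightarrow> 'a \<Rightarrow> real" where
  "perturbed f p lam 0 = f 0"
| "perturbed f p lam (Suc n) =
     (\<lambda>x. perturbed f p lam n x + (increment f (Suc n) x - lam * p (Suc n) x))"

section \<open>The sparsity parameter\<close>

definition norm_recovery ::
  "'a::euclidean_space set \<Rightarrow> (nat \<Rightarrow> 'a measure) \<Rightarrow> ('a \<Rightarrow> real) set \<Rightarrow> nat \<Rightarrow> bool" where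
  "norm_recovery \<Omega> F S k \<longleftrightarrow>
     (\<exists>c'>0. \<forall>j. \<forall>A\<in>atoms (F j). \<forall>u\<in>square_space S.
        (\<Sum>B\<in>{B \<in> atoms (F (j + k)). B \<subseteq> A}. \<bar>LINT x:B|normalized_lebesgue \<Omega>. u x\<bar>)
          \<ge> c' * (LINT x:A|normalized_lebesgue \<Omega>. \<bar>u x\<bar>))"

definition ell :: "('a \<Rightarrow> real) set \<Rightarrow> nat \<Rightarrow> nat" where
  "ell S l\<^sub>0 = (LEAST l. l\<^sub>0 \<le> l \<and> dim S + dim (square_space S) \<le> 2 ^ (l + 1))"

end

theory Submission
  imports Defs "HOL-Computational_Algebra.Polynomial"
begin

text \<open>
  Where \<open>\<Delta>f\<^sub>n \<noteq> 0\<close>, multiply Lebesgue measure by a density \<open>1 + \<phi>\<^sub>n\<close> with \<open>\<bar>\<phi>\<^sub>n\<bar> = O(\<lambda>)\<close>, constant on the atoms of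
  \<open>F (n + \<ell>)\<close>, such that on every atom \<open>A\<close> of \<open>F (n - 1)\<close> the integrals over \<open>A\<close> of the elements of \<open>S\<^sup>2\<close> do not
  change while \<open>\<Delta>f\<^sub>n - \<lambda> p\<^sub>n\<close> becomes orthogonal to \<open>S\<close>. By sparsity, the earlier densities are constant on \<open>A\<close>, so the
  corrections do not interact, and the weak limit \<open>\<mu>\<close> of the measures with densities \<open>\<Prod>(1 + \<phi>\<^sub>n)\<close> gives each \<open>u \<in> S\<^sup>2\<close> the same
  integral over an atom as the partial products do.

  The values of \<open>\<phi>\<^sub>n\<close> on \<open>A\<close> exist by a finite-dimensional Hahn--Banach theorem as soon as
  \<open>\<bar>\<integral>\<^sub>A p\<^sub>n q\<bar> \<le> K \<Sum>\<^sub>B \<bar>\<integral>\<^sub>B u + (\<Delta>f\<^sub>n - \<lambda> p\<^sub>n) q\<bar>\<close> for all \<open>u \<in> S\<^sup>2\<close>, \<open>q \<in> S\<close>, the sum being over the atoms \<open>B \<subseteq> A\<close>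
  of \<open>F (n + \<ell>)\<close>. By the choice of \<open>\<ell>\<^sub>0\<close> the sum dominates \<open>\<integral>\<^sub>A \<bar>u + (\<Delta>f\<^sub>n - \<lambda> p\<^sub>n) q\<bar>\<close>, and a Remez inequality on
  convex sets compares the polynomials on \<open>A\<close> with those on its two children.

  The fatness of the atoms enters only in the construction of \<open>\<mu>\<close>: every atom has a descendant of bounded depth whose closure
  it contains, so that \<open>\<mu>\<close> does not charge the boundaries of atoms.
\<close>

section \<open>Polynomials on convex sets\<close>

text \<open>The danger in the estimate is that \<open>u\<close> cancels the increment: if
  \<open>\<Delta>f\<^sub>n\<close> were a single element of \<open>S\<close> on all of
  \<open>A\<close>, then \<open>- \<Delta>f\<^sub>n q\<close> would be an admissible
  \<open>u\<close>. Orthogonality to \<open>S\<close> excludes this quantitatively, because it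
  forces a jump between the two polynomials on the children of \<open>A\<close>. The term
  \<open>\<lambda> p\<^sub>n q\<close> is only a perturbation: since
  \<open>p\<^sub>n \<ge> 0\<close>, its integral is at most \<open>\<lambda>\<close> times the
  supremum of \<open>\<bar>q\<bar>\<close> times the integral of \<open>p\<^sub>n\<close>, and for
  small \<open>\<lambda>\<close> it is absorbed.

  Integrals of \<open>S\<^sup>2\<close> must be preserved because
  \<open>(\<Delta>f\<^sub>n - \<lambda> p\<^sub>n) q\<close> lies in \<open>S\<^sup>2\<close> on
  each atom of \<open>F n\<close>; the orthogonality gained at step \<open>n\<close> then survives
  all later factors.

  The exponents \<open>1 \<plusminus> c\<lambda>\<close> arise since sparsity leaves at most one
  factor nonconstant on an atom, so one generation distorts mass ratios by at most
  \<open>exp (O(\<lambda>))\<close>. A child has at most a fixed fraction of its parent's volume, so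
  this distortion is bounded by a power \<open>O(\<lambda>)\<close> of the volume ratio, and such
  powers multiply along a chain of atoms.\<close>

lemma lagrange_evaluation:
  fixes I :: "real set"
  assumes "finite I"
  shows "\<exists>L. \<forall>p. degree p < card I \<longrightarrow> poly p a = (\<Sum>r\<in>I. L r * poly p r)"
proof (intro exI allI impI)
  define b where "b r = (\<Prod>s\<in>I - {r}. smult (1 / (r - s)) [:- s, 1:])" for r
  fix p :: "real poly" assume deg: "degree p < card I"
  define q where "q = (\<Sum>r\<in>I. smult (poly p r) (b r))"
  have dx: "poly (b r) x = (if x = r then 1 else 0)" if "r \<in> I" "x \<in> I" for r x
  proof (cases "x = r")
    case True
    then show ?thesis by (auto simp: b_def poly_prod intro!: prod.neutral) (metis diff_divide_distrib divide_self_if eq_iff_diff_eq_0)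
  next
    case False
    then show ?thesis using that assms by (auto simp: b_def poly_prod intro!: prod_zero bexI[of _ x])
  qed
  have "degree (b r) \<le> card I - 1" if "r \<in> I" for r
  proof -
    have "degree (b r) \<le> (\<Sum>s\<in>I - {r}. degree (smult (1 / (r - s)) [:- s, 1:]))"
      unfolding b_def using degree_prod_sum_le[of "I - {r}" "\<lambda>s. smult (1 / (r - s)) [:- s, 1:]"] assms by (simp add: o_def)
    also have "\<dots> \<le> (\<Sum>s\<in>I - {r}. 1)" by (intro sum_mono) auto
    finally show ?thesis using that assms by simp
  qed
  then have "degree q \<le> card I - 1" unfolding q_def
    by (intro degree_sum_le) (use assms degree_smult_le order_trans in blast)+
  then have degq: "degree q < card I" using deg by linarith
  have "poly q x = poly p x" if "x \<in> I" for x
    using that assms by (simp add: q_def poly_sum dx if_distrib cong: if_cong)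
  then have "p = q"
    by (intro poly_eqI_degree[of I]) (use deg degq in auto)
  then show "poly p a = (\<Sum>r\<in>I. poly (b r) a * poly p r)"
    by (metis (no_types, lifting) q_def poly_sum poly_smult mult.commute sum.cong)
qed

text \<open>The degree along lines is all that interpolation on a ray sees. It needs no coordinates
  and is subadditive under products.\<close>

definition line_degree_le :: "nat \<Rightarrow> ('a::real_vector \<Rightarrow> real) \<Rightarrow> bool" where
  "line_degree_le D v \<longleftrightarrow> (\<forall>x y. \<exists>p. degree p \<le> D \<and> (\<forall>r. v (x + r *\<^sub>R y) = poly p r))"

lemma line_degree_le_add:
  assumes "line_degree_le D u" "line_degree_le D v"
  shows "line_degree_le D (\<lambda>x. u x + v x)"
  unfolding line_degree_le_def
proof (intro allI)
  fix x y
  obtain p q where "degree p \<le> D" "\<forall>r. u (x + r *\<^sub>R y) = poly p r" "degree q \<le> D" "\<forall>r. v (x + r *\<^sub>R y) = poly q r"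
    using assms unfolding line_degree_le_def by metis
  then show "\<exists>p. degree p \<le> D \<and> (\<forall>r. u (x + r *\<^sub>R y) + v (x + r *\<^sub>R y) = poly p r)"
    by (intro exI[of _ "p + q"]) (auto intro: degree_add_le)
qed

lemma line_degree_le_mult:
  assumes "line_degree_le D u" "line_degree_le E v"
  shows "line_degree_le (D + E) (\<lambda>x. u x * v x)"
  unfolding line_degree_le_def
proof (intro allI)
  fix x y
  obtain p q where "degree p \<le> D" "\<forall>r. u (x + r *\<^sub>R y) = poly p r" "degree q \<le> E" "\<forall>r. v (x + r *\<^sub>R y) = poly q r"
    using assms unfolding line_degree_le_def by metis
  then show "\<exists>p. degree p \<le> D + E \<and> (\<forall>r. u (x + r *\<^sub>R y) * v (x + r *\<^sub>R y) = poly p r)"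
    by (intro exI[of _ "p * q"]) (auto intro: order_trans[OF degree_mult_le])
qed

lemma line_degree_le_const: "line_degree_le D (\<lambda>x. c)"
  unfolding line_degree_le_def by (intro allI exI[of _ "[:c:]"]) auto

lemma line_degree_le_mono: "line_degree_le D v \<Longrightarrow> D \<le> E \<Longrightarrow> line_degree_le E v"
  unfolding line_degree_le_def by (meson order_trans)

lemma line_degree_le_cmult: "line_degree_le D v \<Longrightarrow> line_degree_le D (\<lambda>x. c * v x)"
  using line_degree_le_mult[OF line_degree_le_const[of 0 c], of D v] by simp

lemma line_degree_le_linear:
  assumes "linear f" shows "line_degree_le 1 f"
  unfolding line_degree_le_def
proof (intro allI)
  fix x y
  show "\<exists>p. degree p \<le> 1 \<and> (\<forall>r. f (x + r *\<^sub>R y) = poly p r)"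
    by (rule exI[of _ "[:f x, f y:]"]) (auto simp: linear_add[OF assms] linear_cmul[OF assms])
qed

lemma real_polynomial_line_degree: "real_polynomial_function v \<Longrightarrow> \<exists>D. line_degree_le D v"
proof (induction rule: real_polynomial_function.induct)
  case (linear f)
  then show ?case using line_degree_le_linear bounded_linear.linear by blast
next
  case (add f g)
  then obtain D E where "line_degree_le D f" "line_degree_le E g" by auto
  then have "line_degree_le (max D E) f" "line_degree_le (max D E) g" by (auto intro: line_degree_le_mono)
  then show ?case by (blast intro: line_degree_le_add)
qed (blast intro: line_degree_le_const line_degree_le_mult)+

text \<open>The set on the left is \<open>E\<close> contracted towards \<open>z\<close> by the
  factor \<open>1 / r\<close>.\<close>

lemma measure_lborel_dilation:
  fixes E :: "'a::euclidean_space set"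
  assumes [measurable]: "E \<in> sets borel" and "r > 0" and "bounded E"
  shows "measure lborel {y. z + r *\<^sub>R (y - z) \<in> E} = measure lborel E / r ^ DIM('a)"
proof -
  define t where "t = z - r *\<^sub>R z"
  have eq: "z + r *\<^sub>R (y - z) = t + r *\<^sub>R y" for y by (simp add: t_def algebra_simps)
  have meas[measurable]: "{y. t + r *\<^sub>R y \<in> E} \<in> sets borel"
  proof -
    have "(\<lambda>y. t + r *\<^sub>R y) -` E \<inter> space borel \<in> sets borel" by (rule measurable_sets) measurable
    then show ?thesis by (simp add: vimage_def)
  qed
  have "emeasure lborel E = emeasure (density (distr lborel borel (\<lambda>x. t + r *\<^sub>R x)) (\<lambda>_. \<bar>r\<bar> ^ DIM('a))) E"
    using lborel_affine[of r t] \<open>r > 0\<close> by simp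
  also have "\<dots> = \<bar>r\<bar> ^ DIM('a) * emeasure (distr lborel borel (\<lambda>x. t + r *\<^sub>R x)) E"
    by (subst emeasure_density) (auto simp: nn_integral_cmult_indicator ennreal_power)
  also have "emeasure (distr lborel borel (\<lambda>x. t + r *\<^sub>R x)) E = emeasure lborel {y. t + r *\<^sub>R y \<in> E}"
    by (subst emeasure_distr) (auto simp: vimage_def)
  finally have *: "emeasure lborel E = ennreal (r ^ DIM('a)) * emeasure lborel {y. t + r *\<^sub>R y \<in> E}"
    using \<open>r > 0\<close> by (simp add: ennreal_power)
  then have "measure lborel E = r ^ DIM('a) * measure lborel {y. t + r *\<^sub>R y \<in> E}"
    using \<open>r > 0\<close> by (simp add: measure_def enn2real_mult)
  then show ?thesis using \<open>r > 0\<close> unfolding eq by (simp add: field_simps)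
qed

text \<open>Contract \<open>E\<close> towards \<open>z\<close> by \<open>N\<close> different factors in \<open>[1/2, 1]\<close>. All copies lie in the convex set \<open>A\<close> and
  have measure at least \<open>\<theta> / 2 ^ d\<close> times that of \<open>A\<close>, so for large \<open>N\<close> some point lies in \<open>D + 1\<close> of them. This gives
  \<open>D + 1\<close> points of \<open>E\<close> on one ray from \<open>z\<close>, at distance ratios from a fixed finite set, and
  interpolation bounds \<open>v z\<close>.\<close>

lemma remez:
  fixes D :: nat and \<theta> :: real
  assumes "\<theta> > 0"
  obtains C where "C > 0"
    "\<And>(A::'a::euclidean_space set) E v z b. \<lbrakk>convex A; A \<in> sets borel; bounded A; E \<in> sets borel; E \<subseteq> A;
       measure lborel E \<ge> \<theta> * measure lborel A; measure lborel A > 0; line_degree_le D v; z \<in> A;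
       \<And>x. x \<in> E \<Longrightarrow> \<bar>v x\<bar> \<le> b\<rbrakk> \<Longrightarrow> \<bar>v z\<bar> \<le> C * b"
proof -
  define d where "d = DIM('a)"
  \<comment> \<open>Each of the \<open>N\<close> copies will occupy at least the fraction
    \<open>\<theta> / 2 ^ d\<close> of \<open>A\<close>, so this makes their average overlap exceed
    \<open>D\<close>.\<close>
  obtain N :: nat where N: "real N * (\<theta> / 2 ^ d) > D"
    using reals_Archimedean3[of "\<theta> / 2 ^ d"] assms by (metis zero_less_divide_iff zero_less_numeral zero_less_power)
  then have "N > 0" by (intro gr0I) auto
  define rr where "rr i = 1 + real i / real N" for i :: nat
  have rr: "1 \<le> rr i" "rr i \<le> 2" if "i < N" for i using that by (auto simp: rr_def divide_simps)
  have inj: "inj_on rr J" for J using \<open>N > 0\<close> by (auto simp: inj_on_def rr_def)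
  \<comment> \<open>The interpolation weights are fixed by the node set alone, so that the constant
    below does not depend on the polynomial.\<close>
  define L where "L I = (SOME L. \<forall>p. degree p < card I \<longrightarrow> poly p 0 = (\<Sum>r\<in>I. L r * poly p r))" for I :: "real set"
  have L: "poly p 0 = (\<Sum>r\<in>I. L I r * poly p r)" if "finite I" "degree p < card I" for I p
    using someI_ex[OF lagrange_evaluation[OF that(1), of 0]] that(2) unfolding L_def by blast
  \<comment> \<open>Which ratios are hit is unknown beforehand; summing over all sets of ratios
    covers every case, and the leading 1 gives positivity.\<close>
  define C where "C = 1 + (\<Sum>I\<in>Pow (rr ` {..<N}). \<Sum>r\<in>I. \<bar>L I r\<bar>)"
  have "C > 0" unfolding C_def by (intro add_pos_nonneg sum_nonneg) auto
  moreover have "\<bar>v z\<bar> \<le> C * b"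
    if A: "convex A" "A \<in> sets borel" "bounded A" and E: "E \<in> sets borel" "E \<subseteq> A"
       "measure lborel E \<ge> \<theta> * measure lborel A" and A0: "measure lborel A > 0" and v: "line_degree_le D v" and z: "z \<in> A"
       and b: "\<And>x. x \<in> E \<Longrightarrow> \<bar>v x\<bar> \<le> b" for A :: "'a set" and E v z b
  proof -
    define T where "T i = {y. z + rr i *\<^sub>R (y - z) \<in> E}" for i
    have boundE: "bounded E" using A E bounded_subset by blast
    have TA: "T i \<subseteq> A" if "i < N" for i
    proof
      fix y assume "y \<in> T i"
      then have x: "z + rr i *\<^sub>R (y - z) \<in> A" using E by (auto simp: T_def)
      have pos: "rr i > 0" using rr(1)[OF that] by simp
      have "y = (1 - 1 / rr i) *\<^sub>R z + (1 / rr i) *\<^sub>R (z + rr i *\<^sub>R (y - z))"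
        using pos by (simp add: algebra_simps)
      also have "\<dots> \<in> A" using x z A(1) rr(1)[OF that] by (intro convexD_alt) auto
      finally show "y \<in> A" .
    qed
    have Tm[measurable]: "T i \<in> sets lborel" for i
    proof -
      have "(\<lambda>y. z + rr i *\<^sub>R (y - z)) -` E \<inter> space borel \<in> sets borel"
        by (rule measurable_sets[OF _ E(1)]) measurable
      then show ?thesis by (simp add: vimage_def T_def)
    qed
    have fin: "emeasure lborel A < \<infinity>" using A(3) by (rule emeasure_bounded_finite)
    have Tfin: "emeasure lborel (T i) < \<infinity>" if "i < N" for i
      using emeasure_mono[OF TA[OF that], of lborel] fin A(2) by auto
    have lower: "measure lborel (T i) \<ge> \<theta> / 2 ^ d * measure lborel A" if "i < N" for i
    proof -
      have "rr i ^ d \<le> 2 ^ d" using rr[OF that] by (intro power_mono) auto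
      moreover have "0 < rr i ^ d" using rr(1)[OF that] by auto
      ultimately have "measure lborel E / rr i ^ d \<ge> measure lborel E / 2 ^ d"
        by (intro divide_left_mono) auto
      moreover have "measure lborel (T i) = measure lborel E / rr i ^ d"
        unfolding T_def d_def using rr(1)[OF that] by (intro measure_lborel_dilation E boundE) auto
      moreover have "measure lborel E / 2 ^ d \<ge> \<theta> * measure lborel A / 2 ^ d"
        using E(3) by (intro divide_right_mono) auto
      ultimately show ?thesis by simp
    qed
    have int: "integrable lborel (\<lambda>y. indicator (T i) y :: real)" if "i < N" for i
      using Tfin[OF that] by (intro integrable_real_indicator Tm)
    \<comment> \<open>Pigeonhole by integration of the number of copies containing \<open>y\<close>,
      a function that vanishes off \<open>A\<close>.\<close>
    have "\<exists>y\<in>A. card {i. i < N \<and> y \<in> T i} \<ge> D + 1"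
    proof (rule ccontr)
      assume "\<not> ?thesis"
      then have le: "card {i. i < N \<and> y \<in> T i} \<le> D" if "y \<in> A" for y using that by force
      have "real D * measure lborel A < real N * (\<theta> / 2 ^ d) * measure lborel A"
        using N A0 by (intro mult_strict_right_mono) auto
      also have "\<dots> \<le> (\<Sum>i<N. measure lborel (T i))"
      proof -
        have "(\<Sum>i<N. \<theta> / 2 ^ d * measure lborel A) \<le> (\<Sum>i<N. measure lborel (T i))"
          by (intro sum_mono lower) auto
        then show ?thesis by simp
      qed
      also have "\<dots> = (\<Sum>i<N. \<integral>y. indicator (T i) y \<partial>lborel)" by simp
      also have "\<dots> = (\<integral>y. (\<Sum>i<N. indicator (T i) y) \<partial>lborel)"
        by (rule Bochner_Integration.integral_sum[symmetric]) (use int in auto)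
      also have "\<dots> \<le> (\<integral>y. real D * indicator A y \<partial>lborel)"
      proof (rule integral_mono)
        show "integrable lborel (\<lambda>y. \<Sum>i<N. indicator (T i) y :: real)"
          using int by (intro Bochner_Integration.integrable_sum) auto
        show "integrable lborel (\<lambda>y. real D * indicator A y)"
          using A(2) fin by (intro integrable_mult_right) simp
        fix y
        have "(\<Sum>i<N. indicator (T i) y :: real) = real (card {i. i < N \<and> y \<in> T i})"
          by (simp add: indicator_def sum.If_cases Int_def)
        also have "\<dots> \<le> real D * indicator A y"
        proof (cases "y \<in> A")
          case False
          then have "{i. i < N \<and> y \<in> T i} = {}" using TA by auto
          then show ?thesis by (metis card.empty mult_nonneg_nonneg of_nat_0 of_nat_0_le_iff indicator_pos_le)
        qed (use le in auto)
        finally show "(\<Sum>i<N. indicator (T i) y :: real) \<le> real D * indicator A y" .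
      qed
      also have "\<dots> = real D * measure lborel A" by simp
      finally show False by simp
    qed
    then obtain y where y: "y \<in> A" "card {i. i < N \<and> y \<in> T i} \<ge> D + 1" by auto
    define I where "I = rr ` {i. i < N \<and> y \<in> T i}"
    have finI: "finite I" unfolding I_def by simp
    have "card I = card {i. i < N \<and> y \<in> T i}" unfolding I_def by (intro card_image inj)
    with y have cardI: "card I \<ge> D + 1" by simp
    \<comment> \<open>On the line through \<open>z\<close> and \<open>y\<close>, the parameter 0 is
      the point \<open>z\<close>, and the parameters in \<open>I\<close> are points of
      \<open>E\<close>.\<close>
    obtain p where p: "degree p \<le> D" "\<And>r. v (z + r *\<^sub>R (y - z)) = poly p r"
      using v unfolding line_degree_le_def by metis
    have b': "\<bar>poly p r\<bar> \<le> b" if "r \<in> I" for r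
      using that b unfolding I_def T_def by (auto simp: p(2)[symmetric])
    have "b \<ge> 0"
    proof -
      have "I \<noteq> {}" using cardI by auto
      then show ?thesis using b' by fastforce
    qed
    have "v z = poly p 0" using p(2)[of 0] by simp
    also have "\<dots> = (\<Sum>r\<in>I. L I r * poly p r)" using p(1) cardI by (intro L finI) auto
    finally have "\<bar>v z\<bar> \<le> (\<Sum>r\<in>I. \<bar>L I r\<bar> * \<bar>poly p r\<bar>)" by (simp add: abs_mult[symmetric])
    also have "\<dots> \<le> (\<Sum>r\<in>I. \<bar>L I r\<bar> * b)" using b' by (intro sum_mono mult_left_mono) auto
    also have "\<dots> = (\<Sum>r\<in>I. \<bar>L I r\<bar>) * b" by (simp add: sum_distrib_right)
    also have "\<dots> \<le> C * b"
    proof (rule mult_right_mono[OF _ \<open>b \<ge> 0\<close>])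
      have "(\<Sum>r\<in>I. \<bar>L I r\<bar>) \<le> (\<Sum>I\<in>Pow (rr ` {..<N}). \<Sum>r\<in>I. \<bar>L I r\<bar>)"
        by (rule member_le_sum[where f = "\<lambda>I. \<Sum>r\<in>I. \<bar>L I r\<bar>"]) (auto simp: I_def sum_nonneg)
      then show "(\<Sum>r\<in>I. \<bar>L I r\<bar>) \<le> C" by (simp add: C_def)
    qed
    finally show ?thesis .
  qed
  ultimately show thesis using that by blast
qed

section \<open>A finite Hahn--Banach theorem and the inradius of convex sets\<close>

text \<open>Coordinates are eliminated one at a time: as in the Hahn--Banach theorem, the admissible values of
  \<open>\<phi> i\<close> form a nonempty interval.\<close>

lemma finite_hahn_banach:
  fixes V :: "'v::real_vector set" and e :: "'i \<Rightarrow> 'v \<Rightarrow> real"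
  assumes "finite I" and V: "subspace V" and "K \<ge> 0"
    and "\<And>x y a. x \<in> V \<Longrightarrow> y \<in> V \<Longrightarrow> L (x + a *\<^sub>R y) = L x + a * L y"
    and "\<And>i x y a. i \<in> I \<Longrightarrow> x \<in> V \<Longrightarrow> y \<in> V \<Longrightarrow> e i (x + a *\<^sub>R y) = e i x + a * e i y"
    and "\<And>x. x \<in> V \<Longrightarrow> \<bar>L x\<bar> \<le> K * (\<Sum>i\<in>I. \<bar>e i x\<bar>)"
  shows "\<exists>\<phi>. (\<forall>i. \<bar>\<phi> i\<bar> \<le> K) \<and> (\<forall>x\<in>V. L x = (\<Sum>i\<in>I. \<phi> i * e i x))"
  using assms(1,4-)
proof (induction I arbitrary: L rule: finite_induct)
  case empty
  then show ?case using \<open>K \<ge> 0\<close> by (intro exI[of _ "\<lambda>_. 0"]) force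
next
  case (insert i I)
  note linL = insert.prems(1) and line = insert.prems(2) and bound = insert.prems(3)
  have V0: "0 \<in> V" using V by (rule subspace_0)
  have L0: "L 0 = 0" using linL[of 0 0 1] V0 by simp
  have e0: "e j 0 = 0" if "j \<in> insert i I" for j using line[OF that V0 V0, of 1] by simp
  have Lscale: "L (a *\<^sub>R x) = a * L x" if "x \<in> V" for a x using linL[OF V0 that, of a] L0 by simp
  have escale: "e j (a *\<^sub>R x) = a * e j x" if "j \<in> insert i I" "x \<in> V" for a x j
    using line[OF that(1) V0 that(2), of a] e0 that(1) by simp
  define N where "N x = K * (\<Sum>j\<in>I. \<bar>e j x\<bar>)" for x
  have bound': "\<bar>L x\<bar> \<le> K * \<bar>e i x\<bar> + N x" if "x \<in> V" for x
    using bound[OF that] insert.hyps by (simp add: N_def distrib_left)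
  have Nscale: "N (a *\<^sub>R x) = \<bar>a\<bar> * N x" if "x \<in> V" for a x
    using that by (simp add: N_def escale abs_mult sum_distrib_left algebra_simps)
  \<comment> \<open>By homogeneity it is enough to bound \<open>L x - c * e i x\<close> by
    \<open>N x\<close> on the slice \<open>e i x = 1\<close>; where \<open>e i x = 0\<close> the
    bound is the hypothesis itself.\<close>
  define V1 where "V1 = {x\<in>V. e i x = 1}"
  \<comment> \<open>Inserting \<open>- K\<close> forces \<open>c \<ge> - K\<close> and keeps the set
    nonempty even if \<open>e i\<close> vanishes on \<open>V\<close>.\<close>
  define c where "c = Sup (insert (- K) ((\<lambda>x. L x - N x) ` V1))"
  have ub: "z \<le> K \<and> (\<forall>y\<in>V1. z \<le> L y + N y)" if "z \<in> insert (- K) ((\<lambda>x. L x - N x) ` V1)" for z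
  proof -
    have 1: "- K \<le> L y + N y" "L y - N y \<le> K" if "y \<in> V1" for y
      using bound'[of y] that by (auto simp: V1_def)
    have 2: "L x - N x \<le> L y + N y" if "x \<in> V1" "y \<in> V1" for x y
    proof -
      have xy: "x \<in> V" "y \<in> V" "e i x = 1" "e i y = 1" using that by (auto simp: V1_def)
      have "x + (-1) *\<^sub>R y \<in> V" using xy V by (simp add: subspace_diff)
      from bound'[OF this] have "\<bar>L x - L y\<bar> \<le> N (x + (-1) *\<^sub>R y)"
        using linL[OF xy(1,2), of "-1"] line[of i, OF _ xy(1,2), of "-1"] xy by simp
      also have "\<dots> \<le> N x + N y" unfolding N_def distrib_left[symmetric] sum.distrib[symmetric]
        using \<open>K \<ge> 0\<close> line[OF _ xy(1,2), of _ "-1"] by (intro mult_left_mono sum_mono) auto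
      finally show ?thesis by linarith
    qed
    show ?thesis using that 1 2 \<open>K \<ge> 0\<close> by auto
  qed
  have bdd: "bdd_above (insert (- K) ((\<lambda>x. L x - N x) ` V1))" using ub by (meson bdd_aboveI)
  have c1: "c \<le> K" unfolding c_def using ub by (intro cSup_least) blast+
  have c2: "- K \<le> c" unfolding c_def by (intro cSup_upper bdd) auto
  have c3: "L x - N x \<le> c" if "x \<in> V1" for x unfolding c_def by (intro cSup_upper bdd) (use that in auto)
  have c4: "c \<le> L x + N x" if "x \<in> V1" for x unfolding c_def using ub that by (intro cSup_least) blast+
  have "\<bar>L x - c * e i x\<bar> \<le> K * (\<Sum>j\<in>I. \<bar>e j x\<bar>)" if "x \<in> V" for x
  proof (cases "e i x = 0")
    case True
    then show ?thesis using bound'[OF that] by (simp add: N_def)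
  next
    case False
    define y where "y = (1 / e i x) *\<^sub>R x"
    have yV: "y \<in> V" using V that by (simp add: y_def subspace_scale)
    then have "y \<in> V1" using False that by (simp add: V1_def y_def escale)
    then have "\<bar>L y - c\<bar> \<le> N y" using c3 c4 by fastforce
    then have "\<bar>e i x\<bar> * \<bar>L y - c\<bar> \<le> \<bar>e i x\<bar> * N y" by (intro mult_left_mono) auto
    moreover have "\<bar>e i x\<bar> * N y = N x" using that False by (simp add: y_def Nscale)
    moreover have "\<bar>e i x\<bar> * \<bar>L y - c\<bar> = \<bar>L x - c * e i x\<bar>"
      using that False by (simp add: y_def Lscale abs_mult[symmetric] algebra_simps)
    ultimately show ?thesis by (metis N_def)
  qed
  moreover have "L (x + a *\<^sub>R y) - c * e i (x + a *\<^sub>R y) = (L x - c * e i x) + a * (L y - c * e i y)"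
    if "x \<in> V" "y \<in> V" for x y a using linL[OF that] line[OF _ that, of i] by (simp add: algebra_simps)
  ultimately obtain \<phi> where \<phi>: "\<forall>j. \<bar>\<phi> j\<bar> \<le> K" "\<forall>x\<in>V. L x - c * e i x = (\<Sum>j\<in>I. \<phi> j * e j x)"
    using insert.IH[of "\<lambda>x. L x - c * e i x"] line by auto
  show ?case
  proof (intro exI[of _ "\<phi>(i := c)"] conjI allI ballI)
    fix x assume "x \<in> V"
    have "(\<Sum>j\<in>insert i I. (\<phi>(i := c)) j * e j x) = c * e i x + (\<Sum>j\<in>I. \<phi> j * e j x)"
      using insert.hyps by (auto intro!: sum.cong)
    then show "L x = (\<Sum>j\<in>insert i I. (\<phi>(i := c)) j * e j x)" using \<phi>(2) \<open>x \<in> V\<close> by force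
  qed (use \<phi> c1 c2 in \<open>auto simp: abs_le_iff\<close>)
qed

text \<open>Steinhagen-type bound: by Helly's theorem and compactness, the sets obtained from \<open>closure A\<close>
  by cutting off a slab of thickness \<open>w / (DIM('a) + 1)\<close> in each direction have a common point.\<close>

lemma cball_in_closure_of_width:
  fixes A :: "'a::euclidean_space set"
  assumes A: "convex A" "bounded A" "interior A \<noteq> {}" and w: "0 < w" "w \<le> width A"
  obtains x where "cball x (w / (DIM('a) + 1)) \<subseteq> closure A"
proof -
  define K where "K = closure A"
  have K: "compact K" "convex K" "K \<noteq> {}"
    using A interior_empty by (auto simp: K_def compact_closure convex_closure)
  define d where "d = real DIM('a) + 1"
  have d: "d \<ge> 1" by (simp add: d_def)
  have "\<exists>x\<in>K. \<forall>y\<in>K. u \<bullet> x \<ge> u \<bullet> y" for u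
    by (rule continuous_attains_sup[OF K(1,3)]) (intro continuous_intros)
  then obtain xmax where xmax: "\<And>u. xmax u \<in> K" "\<And>u y. y \<in> K \<Longrightarrow> u \<bullet> y \<le> u \<bullet> xmax u" by metis
  have "\<exists>x\<in>K. \<forall>y\<in>K. u \<bullet> x \<le> u \<bullet> y" for u
    by (rule continuous_attains_inf[OF K(1,3)]) (intro continuous_intros)
  then obtain xmin where xmin: "\<And>u. xmin u \<in> K" "\<And>u y. y \<in> K \<Longrightarrow> u \<bullet> xmin u \<le> u \<bullet> y" by metis
  \<comment> \<open>The nonempty interior makes the two supporting hyperplanes distinct, so that
    they compete in the infimum defining \<open>width\<close>.\<close>
  have diff: "u \<bullet> xmin u \<le> u \<bullet> xmax u - w" if "norm u = 1" for u
  proof -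
    let ?a = "u \<bullet> xmin u" and ?b = "u \<bullet> xmax u"
    have ab: "?a \<le> ?b" using xmax xmin by blast
    have "?a \<noteq> ?b"
    proof
      assume "?a = ?b"
      then have "A \<subseteq> {x. u \<bullet> x = ?a}" using xmax(2)[of _ u] xmin(2)[of _ u] closure_subset[of A] K_def by force
      then have "interior A \<subseteq> interior {x. u \<bullet> x = ?a}" by (rule interior_mono)
      moreover have "u \<noteq> 0" using that by auto
      ultimately show False using A(3) by (simp add: interior_hyperplane)
    qed
    have un: "u \<noteq> 0" using that by auto
    have "supporting_hyperplane A u ?a" "supporting_hyperplane A u ?b"
      unfolding supporting_hyperplane_def using un xmax xmin closure_subset[of A]
      by (fastforce simp: K_def)+
    then have "width A \<le> setdist {x. u \<bullet> x = ?a} {x. u \<bullet> x = ?b}"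
      unfolding width_def using \<open>?a \<noteq> ?b\<close>
      by (intro cInf_lower bdd_belowI[of _ 0]) (auto simp: setdist_pos_le)
    also have "\<dots> \<le> dist (?a *\<^sub>R u) (?b *\<^sub>R u)"
      using that by (intro setdist_le_dist) (auto simp: dot_square_norm)
    also have "\<dots> = \<bar>?a - ?b\<bar>" using that by (simp add: dist_norm flip: scaleR_left_diff_distrib)
    finally show ?thesis using w ab by linarith
  qed
  define S where "S u = {x\<in>K. u \<bullet> x \<le> u \<bullet> xmax u - w / d}" for u
  have S: "convex (S u)" "closed (S u)" for u
  proof -
    have *: "S u = K \<inter> {x. u \<bullet> x \<le> u \<bullet> xmax u - w / d}" by (auto simp: S_def)
    show "convex (S u)" "closed (S u)" unfolding * using K
      by (auto intro!: convex_Int closed_Int convex_halfspace_le closed_halfspace_le compact_imp_closed)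
  qed
  have small: "\<Inter>(S ` U) \<inter> K \<noteq> {}" if "finite U" "card U \<le> DIM('a) + 1" "U \<subseteq> {u. norm u = 1}" for U
  proof (cases "U = {}")
    case False
    define n where "n = real (card U)"
    have n: "n > 0" "n \<le> d" using that False by (auto simp: n_def d_def card_gt_0_iff)
    \<comment> \<open>The barycentre of the minimizers meets every constraint: in direction
      \<open>v\<close> the minimizer for \<open>v\<close> itself gains \<open>w\<close>, the others
      lose nothing, so the average gains \<open>w / n\<close>.\<close>
    define x where "x = (\<Sum>u\<in>U. (1 / n) *\<^sub>R xmin u)"
    have xK: "x \<in> K" unfolding x_def using that(1) K(2) xmin n
      by (intro convex_sum) (auto simp: n_def)
    have "x \<in> S v" if "v \<in> U" for v
    proof -
      have "v \<bullet> x = (\<Sum>u\<in>U. (1 / n) * (v \<bullet> xmin u))" by (simp add: x_def inner_sum_right)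
      also have "\<dots> \<le> (\<Sum>u\<in>U. (1 / n) * (v \<bullet> xmax v - (if u = v then w else 0)))"
        using n diff[of v] that \<open>U \<subseteq> _\<close> xmax(2)[OF xmin(1)] by (intro sum_mono mult_left_mono) auto
      also have "\<dots> = v \<bullet> xmax v - w / n"
        using that \<open>finite U\<close> n by (auto simp: n_def sum_subtractf right_diff_distrib simp flip: sum_distrib_left sum_divide_distrib)
      also have "\<dots> \<le> v \<bullet> xmax v - w / d" using n w by (simp add: frac_le)
      finally show ?thesis using xK by (simp add: S_def)
    qed
    then show ?thesis using xK by auto
  qed (use K in auto)
  have "K \<inter> \<Inter>(S ` {u. norm u = 1}) \<noteq> {}"
  proof (rule compact_imp_fip[OF K(1)])
    fix G assume G: "finite G" "G \<subseteq> S ` {u. norm u = 1}"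
    \<comment> \<open>Different directions may cut out the same set, so each subfamily is re-indexed
      by equally many directions before its size is used.\<close>
    have repr: "\<exists>U. finite U \<and> card U = card T \<and> U \<subseteq> {u. norm u = 1} \<and> T = S ` U" if T: "T \<subseteq> G" for T
    proof -
      have "T \<subseteq> S ` {u. norm u = 1}" using T G by blast
      then obtain U where U: "U \<subseteq> {u. norm u = 1}" "inj_on S U" "T = S ` U" by (meson subset_image_inj)
      moreover have "finite T" using T G finite_subset by blast
      ultimately show ?thesis using finite_imageD card_image by metis
    qed
    show "K \<inter> \<Inter>G \<noteq> {}"
    proof (cases "card G \<le> DIM('a) + 1")
      case True
      then show ?thesis using repr[OF order_refl] small by (metis Int_commute)
    next
      case False
      have "\<Inter>G \<noteq> {}"
      proof (rule Helly)
        fix T assume "T \<subseteq> G" "card T = DIM('a) + 1"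
        then show "\<Inter>T \<noteq> {}" using repr[of T] small by (metis Int_empty_left order_refl)
      qed (use False G S in auto)
      moreover have "G \<noteq> {}" using False by auto
      ultimately show ?thesis using G by (fastforce simp: S_def)
    qed
  qed (use S in auto)
  then obtain x where x: "x \<in> K" "\<And>u. norm u = 1 \<Longrightarrow> u \<bullet> x \<le> u \<bullet> xmax u - w / d" by (auto simp: S_def)
  have "cball x (w / d) \<subseteq> K"
  proof
    fix y assume y: "y \<in> cball x (w / d)"
    show "y \<in> K"
    proof (rule ccontr)
      assume "y \<notin> K"
      then obtain a b where ab: "a \<bullet> y < b" "\<And>x. x \<in> K \<Longrightarrow> b < a \<bullet> x"
        using separating_hyperplane_closed_point[OF K(2) compact_imp_closed[OF K(1)]] by metis
      have a: "a \<noteq> 0" using ab x(1) by force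
      \<comment> \<open>The unit normal points from \<open>K\<close> towards \<open>y\<close>. In
        this direction \<open>x\<close> lies at depth at least \<open>w / d\<close> below the
        boundary of \<open>K\<close>, so \<open>y\<close> beyond it is too far from
        \<open>x\<close>.\<close>
      define u where "u = (- 1 / norm a) *\<^sub>R a"
      have u: "norm u = 1" using a by (simp add: u_def)
      have "u \<bullet> xmax u < u \<bullet> y" using ab(1) ab(2)[OF xmax(1)[of u]] a by (simp add: u_def divide_simps)
      moreover have "u \<bullet> (y - x) \<le> w / d"
        using norm_cauchy_schwarz[of u "y - x"] u y by (simp add: dist_norm norm_minus_commute)
      ultimately show False using x(2)[OF u] by (simp add: inner_diff_right)
    qed
  qed
  then show thesis using that unfolding K_def d_def by (simp add: add.commute)
qed

section \<open>Measures from weights on nested partitions\<close>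

text \<open>Only the tree structure of the atoms, free of volume and convexity; this is what turns
  weights on a tree into a measure.\<close>

locale binary_partitions =
  fixes \<Omega> :: "'a set" and At :: "nat \<Rightarrow> 'a set set"
  assumes At_0: "At 0 = {\<Omega>}"
    and At_subset: "A \<in> At n \<Longrightarrow> A \<subseteq> \<Omega>"
    and At_nonempty: "A \<in> At n \<Longrightarrow> A \<noteq> {}"
    and At_disjoint: "A \<in> At n \<Longrightarrow> B \<in> At n \<Longrightarrow> A \<inter> B \<noteq> {} \<Longrightarrow> A = B"
    and At_split: "A \<in> At n \<Longrightarrow> \<exists>A' A''. A' \<in> At (Suc n) \<and> A'' \<in> At (Suc n) \<and> A' \<union> A'' = A \<and> A' \<inter> A'' = {}"
begin

definition sub :: "nat \<Rightarrow> 'a set \<Rightarrow> 'a set set" where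
  "sub m A = {B \<in> At m. B \<subseteq> A}"

lemma At_cover: "\<Union>(At n) = \<Omega>"
proof (induction n)
  case (Suc n)
  have "x \<in> \<Union>(At (Suc n))" if x: "x \<in> \<Omega>" for x
  proof -
    obtain A where "x \<in> A" "A \<in> At n" using Suc x by auto
    then show ?thesis using At_split[of A n] by blast
  qed
  then show ?case using At_subset by blast
qed (simp add: At_0)

lemma sub_Suc:
  assumes "A \<in> At n" "A' \<in> At (Suc n)" "A'' \<in> At (Suc n)" "A' \<union> A'' = A"
  shows "sub (Suc n) A = {A', A''}"
proof -
  have "B = A' \<or> B = A''" if "B \<in> At (Suc n)" "B \<subseteq> A" for B
    using that assms At_nonempty[OF that(1)] At_disjoint[OF that(1) assms(2)] At_disjoint[OF that(1) assms(3)] by blast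
  then show ?thesis using assms by (auto simp: sub_def)
qed

lemma At_parent:
  assumes "B \<in> At (Suc n)" obtains A where "A \<in> At n" "B \<subseteq> A"
proof -
  obtain x where x: "x \<in> B" using At_nonempty[OF assms] by auto
  then obtain A where A: "A \<in> At n" "x \<in> A" using At_cover[of n] At_subset[OF assms] by blast
  obtain A' A'' where s: "A' \<in> At (Suc n)" "A'' \<in> At (Suc n)" "A' \<union> A'' = A" using At_split[OF A(1)] by blast
  then have "B = A' \<or> B = A''" using A x At_disjoint[OF assms s(1)] At_disjoint[OF assms s(2)] by blast
  then show thesis using that A s by blast
qed

lemma At_nested:
  assumes "n \<le> m" "A \<in> At n" "B \<in> At m" "A \<inter> B \<noteq> {}" shows "B \<subseteq> A"
  using assms
proof (induction m arbitrary: B rule: dec_induct)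
  case base
  then show ?case using At_disjoint by blast
next
  case (step m)
  obtain C where C: "C \<in> At m" "B \<subseteq> C" using At_parent[OF step.prems(2)] .
  then have "C \<subseteq> A" using step.IH[OF step.prems(1) C(1)] step.prems(3) by blast
  then show ?case using C by blast
qed

lemma sub_Union:
  assumes "n \<le> m" "A \<in> At n" shows "\<Union>(sub m A) = A"
proof -
  have "x \<in> \<Union>(sub m A)" if x: "x \<in> A" for x
  proof -
    obtain B where "B \<in> At m" "x \<in> B" using At_cover[of m] At_subset[OF assms(2)] x by blast
    then show ?thesis using At_nested[OF assms, of B] x by (auto simp: sub_def)
  qed
  then show ?thesis by (auto simp: sub_def)
qed

lemma finite_At: "finite (At n)"
proof (induction n)
  case (Suc n)
  have "finite (sub (Suc n) A)" if A: "A \<in> At n" for A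
  proof -
    obtain A' A'' where s: "A' \<in> At (Suc n)" "A'' \<in> At (Suc n)" "A' \<union> A'' = A" using At_split[OF A] by blast
    show ?thesis using sub_Suc[OF A s] by simp
  qed
  moreover have "At (Suc n) \<subseteq> (\<Union>A\<in>At n. sub (Suc n) A)"
    using At_parent unfolding sub_def by blast
  ultimately show ?case using Suc by (meson finite_UN_I finite_subset)
qed (simp add: At_0)

lemma finite_sub: "finite (sub m A)"
  using finite_At by (simp add: sub_def)

lemma sub_self: "A \<in> At n \<Longrightarrow> sub n A = {A}"
proof -
  assume A: "A \<in> At n"
  have "B = A" if "B \<in> At n" "B \<subseteq> A" for B
    using At_disjoint[OF that(1) A] At_nonempty[OF that(1)] that(2) by blast
  then show ?thesis using A by (auto simp: sub_def)
qed

lemma sub_disjoint: "disjoint_family_on (\<lambda>B. B) (sub m A)"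
  unfolding disjoint_family_on_def sub_def using At_disjoint by blast

lemma sub_sub:
  assumes "n \<le> m" "m \<le> l" "A \<in> At n"
  shows "sub l A = (\<Union>C\<in>sub m A. sub l C)"
proof -
  have "\<exists>C\<in>sub m A. B \<subseteq> C" if B: "B \<in> At l" "B \<subseteq> A" for B
  proof -
    obtain x where "x \<in> B" using At_nonempty[OF B(1)] by blast
    then obtain C where C: "C \<in> sub m A" "x \<in> C" using sub_Union[OF assms(1,3)] B by blast
    then show ?thesis using At_nested[OF assms(2), of C B] B \<open>x \<in> B\<close> by (auto simp: sub_def)
  qed
  then show ?thesis by (auto simp: sub_def)
qed

lemma sum_sub:
  assumes "n \<le> m" "m \<le> l" "A \<in> At n"
  shows "(\<Sum>B\<in>sub l A. g B) = (\<Sum>C\<in>sub m A. \<Sum>B\<in>sub l C. g B)"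
proof (subst sub_sub[OF assms], rule sum.UNION_disjoint)
  show "\<forall>C\<in>sub m A. \<forall>D\<in>sub m A. C \<noteq> D \<longrightarrow> sub l C \<inter> sub l D = {}"
  proof (intro ballI impI equals0I)
    fix C D B assume "C \<in> sub m A" "D \<in> sub m A" "C \<noteq> D" and B: "B \<in> sub l C \<inter> sub l D"
    moreover have "B \<noteq> {}" using B At_nonempty by (auto simp: sub_def)
    then have "C \<inter> D \<noteq> {}" using B by (auto simp: sub_def)
    ultimately show False using At_disjoint[of C m D] by (simp add: sub_def)
  qed
qed (use finite_sub in auto)

end

text \<open>The measure is the law of a random point: cut \<open>[0, 1)\<close> into nested intervals of lengths \<open>Q n A\<close> and
  send \<open>t\<close> to the limit point of the sets whose intervals contain \<open>t\<close>. The limit lies in the closures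
  of these sets; that it almost surely avoids their boundaries is what \<open>inner\<close> is for.\<close>

lemma measure_of_weights:
  fixes \<Omega> :: "'a::euclidean_space set" and Q :: "nat \<Rightarrow> 'a set \<Rightarrow> real"
  assumes "binary_partitions \<Omega> At" and "compact \<Omega>"
    and At_borel: "\<And>n A. A \<in> At n \<Longrightarrow> A \<in> sets borel"
    and mesh: "\<And>e. e > 0 \<Longrightarrow> \<exists>n. \<forall>A\<in>At n. diameter A < e"
    and Q_0: "Q 0 \<Omega> = 1"
    and Q_pos: "\<And>n A. A \<in> At n \<Longrightarrow> Q n A > 0"
    and Q_add: "\<And>n A. A \<in> At n \<Longrightarrow> Q n A = (\<Sum>B\<in>binary_partitions.sub At (Suc n) A. Q (Suc n) B)"
    and "\<eta> > 0"
    and inner: "\<And>n A. A \<in> At n \<Longrightarrow> \<exists>B\<in>At (n + k). closure B \<subseteq> A \<and> Q (n + k) B \<ge> \<eta> * Q n A"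
  shows "\<exists>\<mu>. prob_space \<mu> \<and> sets \<mu> = sets (restrict_space borel \<Omega>) \<and> (\<forall>n. \<forall>A\<in>At n. measure \<mu> A = Q n A)"
proof -
  interpret binary_partitions \<Omega> At by fact
  have "\<forall>n A. A \<in> At n \<longrightarrow> (\<exists>A' A''. A' \<in> At (Suc n) \<and> A'' \<in> At (Suc n) \<and> A' \<union> A'' = A \<and> A' \<inter> A'' = {})"
    using At_split by blast
  then obtain c1 c2 where c: "\<And>n A. A \<in> At n \<Longrightarrow> c1 n A \<in> At (Suc n) \<and> c2 n A \<in> At (Suc n) \<and> c1 n A \<union> c2 n A = A \<and> c1 n A \<inter> c2 n A = {}"
    by metis
  have c_neq: "c1 n A \<noteq> c2 n A" if "A \<in> At n" for n A
    using c[OF that] At_nonempty by blast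
  have sub_c: "sub (Suc n) A = {c1 n A, c2 n A}" if "A \<in> At n" for n A
    using sub_Suc that c[OF that] by metis
  have Q_split: "Q n A = Q (Suc n) (c1 n A) + Q (Suc n) (c2 n A)" if "A \<in> At n" for n A
    using Q_add[OF that] c_neq[OF that] by (simp add: sub_c[OF that])
  \<comment> \<open>The state consists of the current cell and the left endpoint of its interval;
    \<open>t\<close> is compared with the right endpoint of the first child's interval.\<close>
  define st where "st t = rec_nat (\<Omega>, 0::real) (\<lambda>n As. if t < snd As + Q (Suc n) (c1 n (fst As)) then (c1 n (fst As), snd As)
      else (c2 n (fst As), snd As + Q (Suc n) (c1 n (fst As))))" for t :: real
  define a where "a t n = fst (st t n)" for t n
  have a0: "a t 0 = \<Omega>" "snd (st t 0) = 0" for t by (simp_all add: a_def st_def)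
  have aSuc: "a t (Suc n) = (if t < snd (st t n) + Q (Suc n) (c1 n (a t n)) then c1 n (a t n) else c2 n (a t n))"
    and sSuc: "snd (st t (Suc n)) = (if t < snd (st t n) + Q (Suc n) (c1 n (a t n)) then snd (st t n) else snd (st t n) + Q (Suc n) (c1 n (a t n)))"
    for t n by (simp_all add: a_def st_def)
  have a_At: "a t n \<in> At n" for t n
    by (induction n) (use c in \<open>auto simp: a0 At_0 aSuc\<close>)
  have a_Suc_sub: "a t (Suc n) \<subseteq> a t n" for t n
    using c[OF a_At[of t n]] by (auto simp: aSuc)
  have a_mono: "a t m \<subseteq> a t n" if "n \<le> m" for t n m
    using that a_Suc_sub lift_Suc_antimono_le[of "a t"] by blast
  \<comment> \<open>The stored left endpoint belongs to the induction claim because the next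
    comparison uses it. Half-open intervals let the children partition the parent exactly.\<close>
  have cell: "\<exists>s\<ge>0. s + Q n A \<le> 1 \<and> (\<forall>t\<in>{0..<1}. (a t n = A \<longleftrightarrow> s \<le> t \<and> t < s + Q n A) \<and> (a t n = A \<longrightarrow> snd (st t n) = s))"
    if "A \<in> At n" for n A using that
  proof (induction n arbitrary: A)
    case 0
    then show ?case by (intro exI[of _ 0]) (auto simp: At_0 a0 Q_0)
  next
    case (Suc n)
    obtain P where P: "P \<in> At n" "A \<subseteq> P" using At_parent[OF Suc.prems] .
    from Suc.IH[OF P(1)] obtain s where s: "s \<ge> 0" "s + Q n P \<le> 1"
      "\<And>t. t \<in> {0..<1} \<Longrightarrow> a t n = P \<longleftrightarrow> s \<le> t \<and> t < s + Q n P"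
      "\<And>t. t \<in> {0..<1} \<Longrightarrow> a t n = P \<Longrightarrow> snd (st t n) = s" by blast
    have parent: "a t n = P" if "a t (Suc n) = A" for t
      using At_disjoint[OF a_At[of t n] P(1)] a_Suc_sub[of t n] P At_nonempty[OF Suc.prems] that by blast
    have pos: "Q (Suc n) (c1 n P) > 0" "Q (Suc n) (c2 n P) > 0" using Q_pos c[OF P(1)] by auto
    have "A = c1 n P \<or> A = c2 n P" using sub_c[OF P(1)] Suc.prems P by (auto simp: sub_def)
    then show ?case
    proof
      assume A: "A = c1 n P"
      show ?case
      proof (intro exI[of _ s] conjI ballI)
        fix t :: real assume t: "t \<in> {0..<1}"
        show "a t (Suc n) = A \<longleftrightarrow> s \<le> t \<and> t < s + Q (Suc n) A"
        proof (cases "a t n = P")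
          case True
          then show ?thesis using s(3,4)[OF t] c_neq[OF P(1)] pos unfolding aSuc Q_split[OF P(1)] A True by simp
        next
          case False
          then have "a t (Suc n) \<noteq> A" "\<not> (s \<le> t \<and> t < s + Q n P)" using parent s(3)[OF t] by blast+
          then show ?thesis using pos Q_split[OF P(1)] A by auto
        qed
        show "a t (Suc n) = A \<longrightarrow> snd (st t (Suc n)) = s"
        proof
          assume "a t (Suc n) = A"
          moreover from parent[OF this] have "a t n = P" .
          ultimately show "snd (st t (Suc n)) = s"
            using s(4)[OF t] c_neq[OF P(1)] unfolding aSuc sSuc A by (simp split: if_splits)
        qed
      qed (use s(1,2) pos in \<open>auto simp: A Q_split[OF P(1)]\<close>)
    next
      assume A: "A = c2 n P"
      show ?case
      proof (intro exI[of _ "s + Q (Suc n) (c1 n P)"] conjI ballI)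
        fix t :: real assume t: "t \<in> {0..<1}"
        show "a t (Suc n) = A \<longleftrightarrow> s + Q (Suc n) (c1 n P) \<le> t \<and> t < s + Q (Suc n) (c1 n P) + Q (Suc n) A"
        proof (cases "a t n = P")
          case True
          then show ?thesis using s(3,4)[OF t] c_neq[OF P(1)] pos unfolding aSuc Q_split[OF P(1)] A True by simp
        next
          case False
          then have "a t (Suc n) \<noteq> A" "\<not> (s \<le> t \<and> t < s + Q n P)" using parent s(3)[OF t] by blast+
          then show ?thesis using pos Q_split[OF P(1)] A by auto
        qed
        show "a t (Suc n) = A \<longrightarrow> snd (st t (Suc n)) = s + Q (Suc n) (c1 n P)"
        proof
          assume "a t (Suc n) = A"
          moreover from parent[OF this] have "a t n = P" .
          ultimately show "snd (st t (Suc n)) = s + Q (Suc n) (c1 n P)"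
            using s(4)[OF t] c_neq[OF P(1)] unfolding aSuc sSuc A by (simp split: if_splits)
        qed
      qed (use s(1,2) pos in \<open>auto simp: A Q_split[OF P(1)]\<close>)
    qed
  qed
  have Q_nonneg: "Q m B \<ge> 0" if "B \<in> sub m A" for m A B
    using that Q_pos[of B m] by (simp add: sub_def)
  define M where "M = restrict_space lborel {0..<1::real}"
  have space_M: "space M = {0..<1}" by (simp add: M_def space_restrict_space)
  have sets_M: "E \<in> sets M" if "E \<in> sets borel" "E \<subseteq> {0..<1}" for E
    using that by (auto simp: M_def sets_restrict_space)
  have meas_M: "measure M E = measure lborel E" if "E \<subseteq> {0..<1}" for E
    using that by (simp add: M_def measure_restrict_space)
  interpret M: prob_space M
  proof (rule prob_spaceI)
    show "emeasure M (space M) = 1"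
      unfolding space_M by (simp add: M_def emeasure_restrict_space)
  qed
  define I where "I n A = {t\<in>{0..<1}. a t n = A}" for n A
  have I: "I n A \<in> sets M" "measure M (I n A) = Q n A" if A: "A \<in> At n" for n A
  proof -
    obtain s where s: "s \<ge> 0" "s + Q n A \<le> 1" "\<And>t. t \<in> {0..<1} \<Longrightarrow> a t n = A \<longleftrightarrow> s \<le> t \<and> t < s + Q n A"
      using cell[OF A] by blast
    have "I n A = {t\<in>{0..<1}. s \<le> t \<and> t < s + Q n A}" unfolding I_def using s(3) by blast
    also have "\<dots> = {s..<s + Q n A}" using s(1,2) by auto
    finally have eq: "I n A = {s..<s + Q n A}" .
    have "I n A \<subseteq> {0..<1}" by (auto simp: I_def)
    then show "I n A \<in> sets M" "measure M (I n A) = Q n A"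
      using Q_pos[OF A] sets_M[of "I n A"] meas_M[of "I n A"] by (auto simp: eq)
  qed
  define pt where "pt A = (SOME x. x \<in> A)" for A :: "'a set"
  have pt: "pt A \<in> A" if "A \<in> At n" for A n
    using At_nonempty[OF that] unfolding pt_def by (simp add: some_in_eq)
  define X where "X n t = pt (a t n)" for n t
  have X_in: "X m t \<in> a t n" if "n \<le> m" for n m t
    using pt[OF a_At] a_mono[OF that] by (auto simp: X_def)
  have X_meas: "X n \<in> borel_measurable M" for n
  proof -
    have "(\<lambda>t. \<Sum>A\<in>At n. indicator (I n A) t *\<^sub>R pt A) \<in> borel_measurable M"
      using I by (intro borel_measurable_sum borel_measurable_scaleR borel_measurable_indicator borel_measurable_const) auto
    moreover have "X n t = (\<Sum>A\<in>At n. indicator (I n A) t *\<^sub>R pt A)" if "t \<in> space M" for t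
    proof -
      have "(\<Sum>A\<in>At n. indicator (I n A) t *\<^sub>R pt A) = (\<Sum>A\<in>At n. if A = a t n then pt A else 0)"
        using that by (intro sum.cong) (auto simp: I_def space_M indicator_def)
      also have "\<dots> = pt (a t n)" using a_At finite_At by (simp add: sum.delta)
      finally show ?thesis by (simp add: X_def)
    qed
    ultimately show ?thesis by (subst measurable_cong) auto
  qed
  have bounded: "bounded A" if "A \<in> At n" for A n
    using At_subset[OF that] \<open>compact \<Omega>\<close> by (meson bounded_subset compact_imp_bounded)
  have "Cauchy (\<lambda>n. X n t)" for t
  proof (rule metric_CauchyI)
    fix e :: real assume "e > 0"
    then obtain N where N: "\<forall>A\<in>At N. diameter A < e" using mesh by blast
    have "dist (X m t) (X n t) < e" if "m \<ge> N" "n \<ge> N" for m n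
      using diameter_bounded_bound[OF bounded[OF a_At] X_in[OF that(1)] X_in[OF that(2)]] N a_At
      by (meson le_less_trans)
    then show "\<exists>N. \<forall>m\<ge>N. \<forall>n\<ge>N. dist (X m t) (X n t) < e" by blast
  qed
  then have "\<exists>x. (\<lambda>n. X n t) \<longlonglongrightarrow> x" for t by (simp add: Cauchy_convergent convergentD)
  then obtain T where T: "\<And>t. (\<lambda>n. X n t) \<longlonglongrightarrow> T t" by metis
  have T_closure: "T t \<in> closure (a t n)" for t n
  proof (rule Lim_in_closed_set[OF closed_closure _ _ T])
    show "\<forall>\<^sub>F m in sequentially. X m t \<in> closure (a t n)"
      using eventually_ge_at_top[of n] by eventually_elim (use X_in closure_subset in blast)
  qed simp
  have T_\<Omega>: "T t \<in> \<Omega>" for t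
    using T_closure[of t 0] \<open>compact \<Omega>\<close> by (simp add: a0 compact_imp_closed)
  have "T \<in> borel_measurable M" by (rule borel_measurable_LIMSEQ_metric[OF X_meas T])
  then have T_meas: "T \<in> measurable M (restrict_space borel \<Omega>)"
    using T_\<Omega> by (intro measurable_restrict_space2) auto
  have null: "measure M {t\<in>I n A. T t \<notin> A} = 0" and null_sets: "{t\<in>I n A. T t \<notin> A} \<in> sets M" if A: "A \<in> At n" for n A
  proof -
    have "{t\<in>space M. T t \<in> A} \<in> sets M" using At_borel[OF A] \<open>T \<in> borel_measurable M\<close> by measurable
    moreover have "{t\<in>I n A. T t \<notin> A} = I n A - {t\<in>space M. T t \<in> A}" by (auto simp: I_def space_M)
    ultimately show Zm: "{t\<in>I n A. T t \<notin> A} \<in> sets M" using I[OF A] by auto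
    \<comment> \<open>If the limit point leaves \<open>A\<close>, then at every later level
      \<open>t\<close> sits in a cell whose closure reaches outside \<open>A\<close>. Every
      \<open>k\<close> levels the total weight of such cells shrinks by the factor
      \<open>1 - \<eta>\<close>, because the inner descendant of a bad cell is no longer
      bad.\<close>
    define bad where "bad m = {B\<in>sub m A. \<not> closure B \<subseteq> A}" for m
    define b where "b m = (\<Sum>B\<in>bad m. Q m B)" for m
    have bad_At: "B \<in> At m" if "B \<in> bad m" for B m using that by (simp add: bad_def sub_def)
    have fin_bad: "finite (bad m)" for m by (simp add: bad_def finite_sub)
    have "measure M {t\<in>I n A. T t \<notin> A} \<le> b m" if "n \<le> m" for m
    proof -
      have "{t\<in>I n A. T t \<notin> A} \<subseteq> (\<Union>B\<in>bad m. I m B)"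
        using a_mono[OF that] a_At T_closure by (force simp: bad_def sub_def I_def)
      then have "measure M {t\<in>I n A. T t \<notin> A} \<le> measure M (\<Union>B\<in>bad m. I m B)"
        using I bad_At by (intro M.finite_measure_mono sets.finite_UN fin_bad) auto
      also have "\<dots> \<le> (\<Sum>B\<in>bad m. measure M (I m B))"
        using I bad_At by (intro M.finite_measure_subadditive_finite fin_bad) auto
      also have "\<dots> = b m" unfolding b_def using I bad_At by (intro sum.cong) auto
      finally show ?thesis .
    qed
    note Zle = this
    have Q_sub: "Q m B = (\<Sum>C\<in>sub (m + j) B. Q (m + j) C)" if "B \<in> At m" for B m j
    proof (induction j)
      case 0
      then show ?case using that by (simp add: sub_self)
    next
      case (Suc j)
      have "(\<Sum>C\<in>sub (m + Suc j) B. Q (m + Suc j) C) = (\<Sum>C\<in>sub (m + j) B. \<Sum>D\<in>sub (m + Suc j) C. Q (m + Suc j) D)"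
        using that by (intro sum_sub[of m]) auto
      also have "\<dots> = (\<Sum>C\<in>sub (m + j) B. Q (m + j) C)"
        by (intro sum.cong refl) (simp add: Q_add sub_def)
      finally show ?case using Suc by simp
    qed
    have decay: "b (m + k) \<le> (1 - \<eta>) * b m" if "n \<le> m" for m
    proof -
      have "bad (m + k) \<subseteq> (\<Union>B\<in>bad m. {C\<in>sub (m + k) B. \<not> closure C \<subseteq> A})"
      proof
        fix C assume C: "C \<in> bad (m + k)"
        then have "C \<in> (\<Union>B\<in>sub m A. sub (m + k) B)" using sub_sub[of n m "m + k" A] A that by (simp add: bad_def)
        then obtain B where B: "B \<in> sub m A" "C \<in> sub (m + k) B" by auto
        then have "closure C \<subseteq> closure B" by (intro closure_mono) (simp add: sub_def)
        then show "C \<in> (\<Union>B\<in>bad m. {C\<in>sub (m + k) B. \<not> closure C \<subseteq> A})" using B C by (auto simp: bad_def)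
      qed
      then have "b (m + k) \<le> (\<Sum>C\<in>(\<Union>B\<in>bad m. {C\<in>sub (m + k) B. \<not> closure C \<subseteq> A}). Q (m + k) C)"
        unfolding b_def by (intro sum_mono2) (use Q_nonneg in \<open>auto simp: fin_bad finite_sub\<close>)
      also have "\<dots> \<le> (\<Sum>B\<in>bad m. \<Sum>C\<in>{C\<in>sub (m + k) B. \<not> closure C \<subseteq> A}. Q (m + k) C)"
      proof (subst sum.UNION_disjoint)
        show "\<forall>i\<in>bad m. \<forall>j\<in>bad m. i \<noteq> j \<longrightarrow> {C \<in> sub (m + k) i. \<not> closure C \<subseteq> A} \<inter> {C \<in> sub (m + k) j. \<not> closure C \<subseteq> A} = {}"
        proof (intro ballI impI equals0I)
          fix i j C assume "i \<in> bad m" "j \<in> bad m" "i \<noteq> j"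
            and C: "C \<in> {C \<in> sub (m + k) i. \<not> closure C \<subseteq> A} \<inter> {C \<in> sub (m + k) j. \<not> closure C \<subseteq> A}"
          moreover have "C \<noteq> {}" using C At_nonempty by (auto simp: sub_def)
          then have "i \<inter> j \<noteq> {}" using C by (auto simp: sub_def)
          ultimately show False using At_disjoint bad_At by blast
        qed
      qed (auto simp: fin_bad finite_sub)
      also have "\<dots> \<le> (\<Sum>B\<in>bad m. (1 - \<eta>) * Q m B)"
      proof (rule sum_mono)
        fix B assume B: "B \<in> bad m"
        then obtain G where G: "G \<in> At (m + k)" "closure G \<subseteq> B" "Q (m + k) G \<ge> \<eta> * Q m B"
          using inner bad_At by blast
        have GB: "G \<in> sub (m + k) B" "closure G \<subseteq> A" using G B closure_subset[of G] by (auto simp: sub_def bad_def)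
        have "(\<Sum>C\<in>{C\<in>sub (m + k) B. \<not> closure C \<subseteq> A}. Q (m + k) C) \<le> (\<Sum>C\<in>sub (m + k) B - {G}. Q (m + k) C)"
          using GB Q_nonneg by (intro sum_mono2) (auto simp: finite_sub)
        also have "\<dots> = Q m B - Q (m + k) G"
          using GB Q_sub[OF bad_At[OF B], of k] by (simp add: sum_diff1 finite_sub)
        finally show "(\<Sum>C\<in>{C\<in>sub (m + k) B. \<not> closure C \<subseteq> A}. Q (m + k) C) \<le> (1 - \<eta>) * Q m B"
          using G(3) by (simp add: algebra_simps)
      qed
      also have "\<dots> = (1 - \<eta>) * b m" by (simp add: b_def sum_distrib_left)
      finally show ?thesis .
    qed
    \<comment> \<open>This makes \<open>1 - \<eta>\<close> nonnegative, so the decay can be iterated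
      and its powers tend to 0. A single cell cannot outweigh the total mass.\<close>
    have \<eta>1: "\<eta> \<le> 1"
    proof -
      obtain G where G: "G \<in> At k" "Q k G \<ge> \<eta>" using inner[of \<Omega> 0] At_0 Q_0 by auto
      have "Q 0 \<Omega> = (\<Sum>C\<in>sub k \<Omega>. Q k C)" using Q_sub[of \<Omega> 0 k] by (simp add: At_0)
      moreover have "Q k G \<le> (\<Sum>C\<in>sub k \<Omega>. Q k C)"
        by (rule member_le_sum[OF _ Q_nonneg finite_sub]) (use G(1) At_subset in \<open>auto simp: sub_def\<close>)
      ultimately show ?thesis using G Q_0 by linarith
    qed
    have "b (n + j * k) \<le> (1 - \<eta>) ^ j * b n" for j
    proof (induction j)
      case (Suc j)
      have "b (n + Suc j * k) \<le> (1 - \<eta>) * b (n + j * k)" using decay[of "n + j * k"] by (simp add: algebra_simps)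
      also have "\<dots> \<le> (1 - \<eta>) * ((1 - \<eta>) ^ j * b n)" using Suc \<eta>1 by (intro mult_left_mono) auto
      finally show ?case by (simp add: algebra_simps)
    qed simp
    then have "measure M {t\<in>I n A. T t \<notin> A} \<le> (1 - \<eta>) ^ j * b n" for j using Zle[of "n + j * k"] order_trans by fastforce
    moreover have "(\<lambda>j. (1 - \<eta>) ^ j * b n) \<longlonglongrightarrow> 0 * b n"
      using \<eta>1 \<open>\<eta> > 0\<close> by (intro tendsto_mult LIMSEQ_power_zero tendsto_const) auto
    ultimately have "measure M {t\<in>I n A. T t \<notin> A} \<le> 0"
      by (metis (no_types, lifting) LIMSEQ_le_const mult_zero_left)
    then show "measure M {t\<in>I n A. T t \<notin> A} = 0" by (simp add: measure_le_0_iff)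
  qed
  have "measure (distr M (restrict_space borel \<Omega>) T) A = Q n A" if A: "A \<in> At n" for n A
  proof -
    have Am: "A \<in> sets (restrict_space borel \<Omega>)" using At_borel[OF A] At_subset[OF A]
      by (auto simp: sets_restrict_space)
    \<comment> \<open>All cells of level \<open>n\<close> are treated at once: that the limit point
      stays in \<open>A\<close> when \<open>t\<close> belongs to \<open>A\<close> gives one
      direction, and the same fact for the other cells keeps foreign limit points out of
      \<open>A\<close>.\<close>
    have "AE t in M. \<forall>B\<in>At n. t \<notin> {t\<in>I n B. T t \<notin> B}"
      using null null_sets by (intro AE_finite_allI finite_At AE_not_in)
        (auto simp: null_sets_def M.emeasure_eq_measure)
    then have "AE t in M. t \<in> T -` A \<inter> space M \<longleftrightarrow> t \<in> I n A"
    proof eventually_elim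
      case (elim t)
      show ?case
      proof
        assume "t \<in> T -` A \<inter> space M"
        then have "t \<in> I n (a t n)" "T t \<in> A" by (auto simp: I_def space_M)
        then have "T t \<in> a t n" using elim a_At by blast
        then show "t \<in> I n A" using At_disjoint[OF a_At[of t n] A] \<open>T t \<in> A\<close> \<open>t \<in> I n (a t n)\<close> by auto
      qed (use elim A in \<open>auto simp: I_def space_M\<close>)
    qed
    then have "measure M (T -` A \<inter> space M) = measure M (I n A)"
      using I[OF A] T_meas Am by (intro measure_eq_AE) (auto intro: measurable_sets)
    then show ?thesis using I[OF A] by (simp add: measure_distr T_meas Am)
  qed
  moreover have "prob_space (distr M (restrict_space borel \<Omega>) T)" by (rule M.prob_space_distr[OF T_meas])
  ultimately show ?thesis by (intro exI[of _ "distr M (restrict_space borel \<Omega>) T"]) simp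
qed

section \<open>Fat binary filtrations\<close>

lemma atoms_minimal: "A \<in> atoms M \<Longrightarrow> B \<in> sets M \<Longrightarrow> B \<subseteq> A \<Longrightarrow> B \<noteq> {} \<Longrightarrow> B = A"
  unfolding atoms_def by blast

lemma fun_subspaceD:
  fixes V :: "('b \<Rightarrow> real) set"
  assumes "subspace V"
  shows "(\<lambda>x. 0) \<in> V" "f \<in> V \<Longrightarrow> (\<lambda>x. c * f x) \<in> V"
    "f \<in> V \<Longrightarrow> g \<in> V \<Longrightarrow> (\<lambda>x. f x + g x) \<in> V" "f \<in> V \<Longrightarrow> g \<in> V \<Longrightarrow> (\<lambda>x. f x - g x) \<in> V"
  using subspace_0[OF assms] subspace_scale[OF assms, of f c] subspace_add[OF assms, of f g] subspace_diff[OF assms, of f g]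
  by (simp_all add: zero_fun_def scaleR_fun_def plus_fun_def fun_diff_def)

lemma fun_subspaceI:
  fixes V :: "('b \<Rightarrow> real) set"
  assumes "(\<lambda>x. 0) \<in> V" "\<And>f c. f \<in> V \<Longrightarrow> (\<lambda>x. c * f x) \<in> V"
    "\<And>f g. f \<in> V \<Longrightarrow> g \<in> V \<Longrightarrow> (\<lambda>x. f x + g x) \<in> V"
  shows "subspace V"
  using assms by (intro subspaceI) (simp_all add: zero_fun_def scaleR_fun_def plus_fun_def)

locale fat_filtration =
  fixes \<Omega> :: "'a::euclidean_space set"
    and F :: "nat \<Rightarrow> 'a measure"
    and S :: "('a \<Rightarrow> real) set"
    and c\<^sub>0 c\<^sub>4 :: real
  assumes Omega: "compact \<Omega>" "emeasure lborel \<Omega> > 0"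
    and filtration: "binary_filtration \<Omega> F"
    and convex_atoms: "\<And>n A. A \<in> atoms (F n) \<Longrightarrow> convex A"
    and mesh: "(\<lambda>n. Max (diameter ` atoms (F n))) \<longlonglongrightarrow> 0"
    and width: "c\<^sub>4 > 0" "\<And>n A. A \<in> atoms (F n) \<Longrightarrow> width A \<ge> c\<^sub>4 * diameter A"
    and S_polynomials: "\<And>g. g \<in> S \<Longrightarrow> real_polynomial_function g"
    and S_space: "subspace S" "\<exists>B. finite B \<and> span B = S" "(\<lambda>_. 1) \<in> S"
    and comparable: "c\<^sub>0 > 0" "comparable_siblings \<Omega> F c\<^sub>0"
begin

abbreviation "At n \<equiv> atoms (F n)"
abbreviation "\<P> \<equiv> normalized_lebesgue \<Omega>"
abbreviation "S2 \<equiv> square_space S"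

lemma Omega_borel[measurable]: "\<Omega> \<in> sets borel"
  using Omega by (simp add: borel_compact)

lemma Omega_measure: "measure lborel \<Omega> > 0" "emeasure lborel \<Omega> \<noteq> \<infinity>"
proof -
  show *: "emeasure lborel \<Omega> \<noteq> \<infinity>" using emeasure_compact_finite[OF Omega(1)] by simp
  show "measure lborel \<Omega> > 0" using Omega(2) * by (simp add: measure_def enn2real_positive_iff top.not_eq_extremum)
qed

lemma space_P[simp]: "space \<P> = \<Omega>"
  by (simp add: normalized_lebesgue_def space_restrict_space)

lemma sets_P: "sets \<P> = sets (restrict_space borel \<Omega>)"
  by (simp add: normalized_lebesgue_def sets_restrict_space)

lemma sets_P_iff: "A \<in> sets \<P> \<longleftrightarrow> A \<in> sets borel \<and> A \<subseteq> \<Omega>"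
  using Omega_borel by (auto simp: sets_P sets_restrict_space)

lemma measure_P: "A \<in> sets \<P> \<Longrightarrow> measure \<P> A = measure lborel A / measure lborel \<Omega>"
proof -
  assume A: "A \<in> sets \<P>"
  then have *: "A \<in> sets (restrict_space lborel \<Omega>)" "\<Omega> \<inter> A = A" by (auto simp: sets_P_iff sets_restrict_space)
  have "measure (restrict_space lborel \<Omega>) A = measure lborel A" "measure (restrict_space lborel \<Omega>) \<Omega> = measure lborel \<Omega>"
    using A by (auto simp: measure_restrict_space sets_P_iff)
  moreover have "emeasure (restrict_space lborel \<Omega>) \<Omega> = emeasure lborel \<Omega>" by (simp add: emeasure_restrict_space)
  ultimately show ?thesis unfolding normalized_lebesgue_def using Omega_measure Omega(2) *
    by (subst measure_uniform_measure) auto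
qed

lemma prob_space_P: "prob_space \<P>"
  unfolding normalized_lebesgue_def using Omega_measure Omega(2)
  by (intro prob_space_uniform_measure) (auto simp: emeasure_restrict_space)

sublocale P: prob_space \<P> by (rule prob_space_P)

lemma Omega_nonempty: "\<Omega> \<noteq> {}"
  using Omega(2) by auto

lemma sets_F_P: "sets (F n) \<subseteq> sets \<P>" and subalgebra_F: "subalgebra \<P> (F n)"
  using filtration unfolding binary_filtration_def subalgebra_def by auto

lemma At_sets_F: "A \<in> At n \<Longrightarrow> A \<in> sets (F n)"
  by (simp add: atoms_def)

lemma At_sets[measurable]: "A \<in> At n \<Longrightarrow> A \<in> sets \<P>"
  using At_sets_F sets_F_P by blast

lemma At_borel: "A \<in> At n \<Longrightarrow> A \<in> sets borel"
  using At_sets sets_P_iff by blast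

sublocale binary_partitions \<Omega> At
proof
  have "sets (F 0) = {{}, \<Omega>}" using filtration by (simp add: binary_filtration_def)
  then show "At 0 = {\<Omega>}" using Omega_nonempty by (auto simp: atoms_def)
next
  fix A n assume A: "A \<in> At n"
  then show "A \<subseteq> \<Omega>" "A \<noteq> {}" using At_sets sets_P_iff by (auto simp: atoms_def)
  have "\<exists>A' A''. siblings \<Omega> F n A A' A''" using filtration A unfolding binary_filtration_def by blast
  then show "\<exists>A' A''. A' \<in> At (Suc n) \<and> A'' \<in> At (Suc n) \<and> A' \<union> A'' = A \<and> A' \<inter> A'' = {}"
    by (auto simp: siblings_def)
next
  fix A B n assume "A \<in> At n" "B \<in> At n" "A \<inter> B \<noteq> {}"
  moreover have "A \<inter> B \<in> sets (F n)" using calculation by (auto simp: atoms_def)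
  ultimately have "A \<inter> B = A" "A \<inter> B = B" by (meson atoms_minimal Int_lower1 Int_lower2)+
  then show "A = B" by blast
qed

abbreviation "v A \<equiv> measure \<P> A"

section \<open>Volume and shape of atoms\<close>

lemma obtain_siblings:
  assumes "A \<in> At n"
  obtains A' A'' where "siblings \<Omega> F n A A' A''" "sub (Suc n) A = {A', A''}" "A' \<in> At (Suc n)" "A'' \<in> At (Suc n)"
    "A' \<union> A'' = A" "A' \<inter> A'' = {}" "v A = v A' + v A''" "v A'' \<ge> v A'" "v A' > 0" "v A' \<ge> c\<^sub>0 * v A''"
proof -
  obtain A' A'' where s: "siblings \<Omega> F n A A' A''" using filtration assms unfolding binary_filtration_def by blast
  then have s': "A' \<in> At (Suc n)" "A'' \<in> At (Suc n)" "A' \<union> A'' = A" "A' \<inter> A'' = {}" "v A'' \<ge> v A'" "v A' > 0"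
    by (auto simp: siblings_def vol_def)
  have "v A' \<ge> c\<^sub>0 * v A''" using comparable(2) s by (auto simp: comparable_siblings_def vol_def)
  moreover have "v A = v A' + v A''" using s' P.finite_measure_Union[OF At_sets At_sets, of A' "Suc n" A'' "Suc n"] by simp
  ultimately show thesis using that s s' sub_Suc[OF assms s'(1-3)] by blast
qed

text \<open>Comparability of siblings expressed through the parent: each child has at least this
  fraction of its volume, hence at most the fraction \<open>1 - r\<^sub>0\<close>.\<close>

definition "r\<^sub>0 = c\<^sub>0 / (1 + c\<^sub>0)"

lemma r0: "0 < r\<^sub>0" "r\<^sub>0 < 1"
  using comparable(1) by (auto simp: r\<^sub>0_def field_simps)

lemma v_child:
  assumes "A \<in> At n" "B \<in> At (Suc n)" "B \<subseteq> A"
  shows "r\<^sub>0 * v A \<le> v B" "v B \<le> (1 - r\<^sub>0) * v A"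
proof -
  obtain A' A'' where s: "sub (Suc n) A = {A', A''}" "v A = v A' + v A''" "v A'' \<ge> v A'" "v A' > 0" "v A' \<ge> c\<^sub>0 * v A''"
    using obtain_siblings[OF assms(1)] by metis
  have c: "c\<^sub>0 > 0" by (rule comparable)
  have "B = A' \<or> B = A''" using s(1) assms by (auto simp: sub_def)
  moreover have 1: "r\<^sub>0 * v A \<le> v A'" using s c by (simp add: r\<^sub>0_def field_simps)
  ultimately show "r\<^sub>0 * v A \<le> v B" "v B \<le> (1 - r\<^sub>0) * v A" using s by (auto simp: algebra_simps)
qed

lemma v_pos: "A \<in> At n \<Longrightarrow> v A > 0"
proof (induction n arbitrary: A)
  case 0
  then show ?case using P.prob_space At_0 by simp
next
  case (Suc n)
  obtain B where B: "B \<in> At n" "A \<subseteq> B" using At_parent[OF Suc.prems] .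
  have "0 < r\<^sub>0 * v B" using r0 Suc.IH[OF B(1)] by simp
  then show ?case using v_child(1)[OF B(1) Suc.prems B(2)] by simp
qed

lemma v_descendant:
  assumes "A \<in> At n" "B \<in> At (n + j)" "B \<subseteq> A"
  shows "v B \<le> (1 - r\<^sub>0) ^ j * v A"
  using assms(2,3)
proof (induction j arbitrary: B)
  case 0
  then show ?case using sub_self[OF assms(1)] by (auto simp: sub_def)
next
  case (Suc j)
  then obtain C where C: "C \<in> At (n + j)" "B \<subseteq> C" using At_parent[of B "n + j"] by auto
  have "A \<inter> C \<noteq> {}" using Suc.prems C At_nonempty by blast
  then have "C \<subseteq> A" using At_nested[OF _ assms(1) C(1)] by simp
  have "v B \<le> (1 - r\<^sub>0) * v C" using v_child(2)[OF C(1) _ C(2)] Suc.prems by simp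
  also have "\<dots> \<le> (1 - r\<^sub>0) * ((1 - r\<^sub>0) ^ j * v A)"
    using Suc.IH[OF C(1) \<open>C \<subseteq> A\<close>] r0 by (intro mult_left_mono) auto
  finally show ?case by simp
qed

lemma bounded_At: "A \<in> At n \<Longrightarrow> bounded A"
  using At_subset Omega(1) by (meson bounded_subset compact_imp_bounded)

text \<open>The ratio of inradius to diameter that fatness provides through
  \<open>cball_in_closure_of_width\<close>.\<close>

definition "c\<^sub>5 = c\<^sub>4 / (real DIM('a) + 1)"

lemma c5_pos: "c\<^sub>5 > 0"
  using width(1) by (simp add: c\<^sub>5_def add_pos_nonneg)

text \<open>Positive volume gives a convex set an interior point. The inscribed ball is found in the
  closure only, but a convex set with nonempty interior has the same interior as its closure, so the
  open ball lies in \<open>A\<close>.\<close>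

lemma At_fat:
  assumes A: "A \<in> At n"
  shows "diameter A > 0" "\<exists>x. ball x (c\<^sub>5 * diameter A) \<subseteq> A"
proof -
  have "measure lborel A > 0" using v_pos[OF A] measure_P[OF At_sets[OF A]] Omega_measure by (simp add: zero_less_divide_iff)
  moreover have "measure lebesgue A = measure lborel A" using At_borel[OF A] by (intro measure_completion) simp
  ultimately have "\<not> negligible A" using negligible_imp_measure0[of A] by auto
  then have int: "interior A \<noteq> {}" using negligible_convex_interior[OF convex_atoms[OF A]] by simp
  have "diameter A \<noteq> 0"
  proof
    assume "diameter A = 0"
    then have "x = y" if "x \<in> A" "y \<in> A" for x y
      using diameter_bounded_bound[OF bounded_At[OF A] that] by simp
    then obtain x where "A = {x}" using At_nonempty[OF A] by blast
    then show False using int by simp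
  qed
  then show diam: "diameter A > 0" using diameter_ge_0[OF bounded_At[OF A]] by simp
  obtain x where "cball x (c\<^sub>4 * diameter A / (DIM('a) + 1)) \<subseteq> closure A"
    using cball_in_closure_of_width[OF convex_atoms[OF A] bounded_At[OF A] int _ width(2)[OF A]] diam width(1) by auto
  then have "ball x (c\<^sub>5 * diameter A) \<subseteq> closure A"
    using ball_subset_cball unfolding c\<^sub>5_def by (fastforce simp: add.commute)
  then have "ball x (c\<^sub>5 * diameter A) \<subseteq> interior (closure A)" by (rule interior_maximal) simp
  then show "\<exists>x. ball x (c\<^sub>5 * diameter A) \<subseteq> A"
    using convex_interior_closure[OF convex_atoms[OF A]] interior_subset by blast
qed

text \<open>Follow the centre of a ball inscribed in \<open>A\<close>. Volumes decay geometrically,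
  and for fat atoms volume controls diameter, so after a number of generations independent of
  \<open>A\<close> the atom around the centre fits inside the ball together with its
  closure.\<close>

lemma inner_descendant: "\<exists>k. \<forall>n. \<forall>A\<in>At n. \<exists>B\<in>At (n + k). closure B \<subseteq> A"
proof -
  define d where "d = DIM('a)"
  have "(c\<^sub>5\<^sup>2 / 2) ^ d > 0" using c5_pos by simp
  then obtain k where k: "(1 - r\<^sub>0) ^ k < (c\<^sub>5\<^sup>2 / 2) ^ d"
    using real_arch_pow_inv[of "(c\<^sub>5\<^sup>2 / 2) ^ d" "1 - r\<^sub>0"] r0 by auto
  have "\<exists>B\<in>At (n + k). closure B \<subseteq> A" if A: "A \<in> At n" for n A
  proof -
    have dA: "diameter A > 0" by (rule At_fat[OF A])
    obtain x where x: "ball x (c\<^sub>5 * diameter A) \<subseteq> A" using At_fat[OF A] by blast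
    then have xA: "x \<in> A" using dA c5_pos by auto
    then obtain B where B: "B \<in> At (n + k)" "x \<in> B" using At_cover[of "n + k"] At_subset[OF A] by blast
    have BA: "B \<subseteq> A" by (rule At_nested[OF _ A B(1)]) (use xA B in auto)
    have dB: "diameter B > 0" by (rule At_fat[OF B(1)])
    obtain y where y: "ball y (c\<^sub>5 * diameter B) \<subseteq> B" using At_fat[OF B(1)] by blast
    have "unit_ball_vol d * (c\<^sub>5 * diameter B) ^ d = measure lborel (ball y (c\<^sub>5 * diameter B))"
      using c5_pos dB by (simp add: content_ball d_def)
    also have "\<dots> \<le> measure lborel B"
      using y At_borel[OF B(1)] emeasure_bounded_finite[OF bounded_At[OF B(1)]]
      by (intro measure_mono_fmeasurable) (auto simp: fmeasurable_def)
    also have "\<dots> \<le> (1 - r\<^sub>0) ^ k * measure lborel A"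
      using v_descendant[OF A B(1) BA] Omega_measure(1)
      by (simp add: measure_P[OF At_sets[OF A]] measure_P[OF At_sets[OF B(1)]] divide_simps)
    also have "\<dots> \<le> (1 - r\<^sub>0) ^ k * measure lborel (cball x (diameter A))"
    proof (intro mult_left_mono measure_mono_fmeasurable)
      show "A \<subseteq> cball x (diameter A)" using diameter_bounded_bound[OF bounded_At[OF A] xA] by auto
    qed (use r0 At_borel[OF A] emeasure_bounded_finite[OF bounded_cball] in \<open>auto simp: fmeasurable_def\<close>)
    also have "\<dots> = (1 - r\<^sub>0) ^ k * (unit_ball_vol d * diameter A ^ d)"
      using dA by (simp add: content_cball d_def)
    finally have "(c\<^sub>5 * diameter B) ^ d \<le> (1 - r\<^sub>0) ^ k * diameter A ^ d"
      using unit_ball_vol_pos[of "real d"] by (simp add: algebra_simps)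
    also have "\<dots> < (c\<^sub>5\<^sup>2 / 2) ^ d * diameter A ^ d" using k dA by (intro mult_strict_right_mono) auto
    finally have "(c\<^sub>5 * diameter B) ^ d < (c\<^sub>5\<^sup>2 / 2 * diameter A) ^ d" by (simp only: power_mult_distrib)
    then have "c\<^sub>5 * diameter B < c\<^sub>5\<^sup>2 / 2 * diameter A"
      by (rule power_less_imp_less_base) (use dA in simp)
    then have "c\<^sub>5 * diameter B < c\<^sub>5 * (c\<^sub>5 * diameter A / 2)" by (simp add: power2_eq_square)
    then have "diameter B < c\<^sub>5 * diameter A / 2" using c5_pos mult_less_cancel_left_pos by blast
    then have "diameter B < c\<^sub>5 * diameter A" using mult_pos_pos[OF c5_pos dA] by linarith
    moreover have "closure B \<subseteq> cball x (diameter B)"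
      using diameter_bounded_bound[OF bounded_At[OF B(1)] B(2)] by (intro closure_minimal) auto
    ultimately have "closure B \<subseteq> A" using x by (auto simp: subset_iff)
    then show ?thesis using B by blast
  qed
  then show ?thesis by blast
qed

lemma mesh': "e > 0 \<Longrightarrow> \<exists>N. \<forall>n\<ge>N. \<forall>A\<in>At n. diameter A < e"
proof -
  assume "e > 0"
  then obtain N where N: "\<And>n. n \<ge> N \<Longrightarrow> Max (diameter ` At n) < e"
    using order_tendstoD(2)[OF mesh] unfolding eventually_sequentially by blast
  have "diameter A < e" if "n \<ge> N" "A \<in> At n" for n A
    by (rule le_less_trans[OF Max_ge N[OF that(1)]]) (use that finite_At in auto)
  then show ?thesis by blast
qed

section \<open>The polynomial spaces\<close>

lemma S2_mult: "f \<in> S \<Longrightarrow> g \<in> S \<Longrightarrow> (\<lambda>x. f x * g x) \<in> S2"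
  unfolding square_space_def by (rule span_base) blast

lemma S_subset_S2: "g \<in> S \<Longrightarrow> g \<in> S2"
  using S2_mult[OF _ S_space(3), of g] by simp

lemma subspace_S2: "subspace S2"
  by (simp add: square_space_def)

lemma S2_polynomial: "u \<in> S2 \<Longrightarrow> real_polynomial_function u"
proof -
  have "S2 \<subseteq> Collect real_polynomial_function"
    unfolding square_space_def
    by (intro span_minimal fun_subspaceI) (use S_polynomials in auto)
  then show "u \<in> S2 \<Longrightarrow> real_polynomial_function u" by blast
qed

text \<open>The finite spanning set makes one degree bound serve all of \<open>S2\<close>, so that
  the Remez constants are uniform in the polynomial and the atom.\<close>

lemma S2_line_degree: "\<exists>D. \<forall>u\<in>S2. line_degree_le D u"
proof -
  obtain B where B: "finite B" "span B = S" using S_space(2) by blast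
  have "\<exists>D. line_degree_le D b" if "b \<in> B" for b
    using real_polynomial_line_degree[OF S_polynomials, of b] span_base[OF that] B(2) by simp
  then obtain D where D: "\<And>b. b \<in> B \<Longrightarrow> line_degree_le (D b) b" by metis
  define E where "E = Max (insert 0 (D ` B))"
  have sub: "subspace {v. line_degree_le D v}" for D
    by (intro fun_subspaceI) (auto intro: line_degree_le_const line_degree_le_cmult line_degree_le_add)
  have "B \<subseteq> {v. line_degree_le E v}"
    using D B(1) by (auto intro!: line_degree_le_mono[OF D] simp: E_def)
  then have "S \<subseteq> {v. line_degree_le E v}" using span_minimal[OF _ sub] B(2) by blast
  then have "S2 \<subseteq> {v. line_degree_le (E + E) v}"
    unfolding square_space_def by (intro span_minimal sub) (auto intro!: line_degree_le_mult)
  then show ?thesis by blast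
qed

end

section \<open>Piecewise polynomials and their integrals\<close>

lemma set_integrable_of_integrable:
  fixes f :: "'a \<Rightarrow> real"
  shows "integrable M f \<Longrightarrow> A \<in> sets M \<Longrightarrow> set_integrable M A f"
  unfolding set_integrable_def by (rule integrable_mult_indicator)

lemma (in finite_measure) set_integral_le_const:
  fixes f :: "'a \<Rightarrow> real"
  assumes "integrable M f" "A \<in> sets M" "\<And>x. x \<in> A \<Longrightarrow> f x \<le> b"
  shows "(LINT x:A|M. f x) \<le> b * measure M A"
proof -
  have "(LINT x:A|M. f x) \<le> (LINT x:A|M. b)"
    using assms by (intro set_integral_mono set_integrable_of_integrable) auto
  then show ?thesis using assms by (simp add: set_integral_const mult.commute)
qed

lemma piecewise_space_mono: "S \<subseteq> T \<Longrightarrow> piecewise_space S M \<subseteq> piecewise_space T M"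
  unfolding piecewise_space_def by blast

lemma const_piecewise: "g \<in> S \<Longrightarrow> g \<in> piecewise_space S M"
  unfolding piecewise_space_def by blast

text \<open>Stated for an arbitrary operation so that sums, differences, products and multiplication
  by step functions are all instances.\<close>

lemma piecewise_combine:
  assumes "f \<in> piecewise_space S M" "g \<in> piecewise_space T M"
    and "\<And>a b. a \<in> S \<Longrightarrow> b \<in> T \<Longrightarrow> (\<lambda>x. c (a x) (b x)) \<in> U"
  shows "(\<lambda>x. c (f x) (g x)) \<in> piecewise_space U M"
  unfolding piecewise_space_def mem_Collect_eq
proof
  fix A assume "A \<in> atoms M"
  then obtain a b where "a \<in> S" "\<forall>x\<in>A. f x = a x" "b \<in> T" "\<forall>x\<in>A. g x = b x"
    using assms(1,2) unfolding piecewise_space_def by blast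
  then show "\<exists>h\<in>U. \<forall>x\<in>A. c (f x) (g x) = h x"
    by (intro bexI[OF _ assms(3)[of a b]]) auto
qed

context fat_filtration
begin

lemma piecewise_S_S2: "f \<in> piecewise_space S (F n) \<Longrightarrow> f \<in> piecewise_space S2 (F n)"
  using piecewise_space_mono[of S S2] S_subset_S2 by blast

lemma piecewise_S2_add:
  assumes "f \<in> piecewise_space S2 (F n)" "g \<in> piecewise_space S2 (F n)"
  shows "(\<lambda>x. f x + g x) \<in> piecewise_space S2 (F n)"
  by (rule piecewise_combine[OF assms]) (rule fun_subspaceD(3)[OF subspace_S2])

lemma piecewise_mult:
  assumes "f \<in> piecewise_space S (F n)" "g \<in> piecewise_space S (F n)"
  shows "(\<lambda>x. f x * g x) \<in> piecewise_space S2 (F n)"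
  by (rule piecewise_combine[OF assms]) (rule S2_mult)

lemma S_diff_scaled: "f \<in> S \<Longrightarrow> g \<in> S \<Longrightarrow> (\<lambda>x. f x - c * g x) \<in> S"
  using fun_subspaceD(4)[OF S_space(1) _ fun_subspaceD(2)[OF S_space(1)]] by blast

lemma piecewise_S_diff:
  assumes "f \<in> piecewise_space S (F n)" "g \<in> piecewise_space S (F n)"
  shows "(\<lambda>x. f x - c * g x) \<in> piecewise_space S (F n)"
  by (rule piecewise_combine[OF assms]) (rule S_diff_scaled)

lemma piecewise_refine:
  assumes "f \<in> piecewise_space V (F n)" "n \<le> m"
  shows "f \<in> piecewise_space V (F m)"
  unfolding piecewise_space_def mem_Collect_eq
proof
  fix B assume B: "B \<in> At m"
  obtain x where x: "x \<in> B" using At_nonempty[OF B] by blast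
  then obtain A where A: "A \<in> At n" "x \<in> A" using At_cover[of n] At_subset[OF B] by blast
  have "B \<subseteq> A" by (rule At_nested[OF assms(2) A(1) B]) (use A x in auto)
  then show "\<exists>g\<in>V. \<forall>x\<in>B. f x = g x" using assms(1) A(1) unfolding piecewise_space_def by blast
qed

lemma Int_Omega: "A \<in> sets \<P> \<Longrightarrow> A \<inter> \<Omega> = A"
  using sets_P_iff by blast

text \<open>The measure is left general because the same functions are later integrated against the
  limit measure as well.\<close>

lemma integrable_S2:
  assumes "finite_measure M" "sets M = sets \<P>" "u \<in> S2"
  shows "integrable M u"
proof -
  have cont: "continuous_on UNIV u"
    using continuous_on_polymonial_function real_polynomial_function_eq S2_polynomial[OF assms(3)] by blast
  then have "u \<in> borel_measurable (restrict_space borel \<Omega>)"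
    by (intro measurable_restrict_space1 borel_measurable_continuous_onI)
  then have meas: "u \<in> borel_measurable M" using assms(2) sets_P measurable_cong_sets by metis
  have "compact (u ` \<Omega>)" using Omega(1) cont by (intro compact_continuous_image) (auto intro: continuous_on_subset)
  then have "bounded (u ` \<Omega>)" by (rule compact_imp_bounded)
  then obtain b where "\<And>x. x \<in> \<Omega> \<Longrightarrow> \<bar>u x\<bar> \<le> b" by (auto simp: bounded_iff)
  moreover have "space M = \<Omega>" using sets_eq_imp_space_eq[OF assms(2)] by simp
  ultimately show ?thesis using finite_measure.integrable_const_bound[OF assms(1) AE_I2 meas, of b] by simp
qed

lemma integrable_piecewise:
  assumes "finite_measure M" "sets M = sets \<P>" "f \<in> piecewise_space S2 (F n)"
  shows "integrable M f"
proof -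
  obtain g where g: "\<And>A. A \<in> At n \<Longrightarrow> g A \<in> S2 \<and> (\<forall>x\<in>A. f x = g A x)"
    using assms(3) unfolding piecewise_space_def mem_Collect_eq by metis
  have sp: "space M = \<Omega>" using sets_eq_imp_space_eq[OF assms(2)] by simp
  have "f x = (\<Sum>A\<in>At n. indicator A x * g A x)" if x: "x \<in> space M" for x
  proof -
    obtain A where A: "A \<in> At n" "x \<in> A" using At_cover[of n] x sp by blast
    have "(\<Sum>B\<in>At n. indicator B x * g B x) = (\<Sum>B\<in>At n. if B = A then g A x else 0)"
    proof (intro sum.cong refl)
      fix B assume B: "B \<in> At n"
      have "B = A" if "x \<in> B" using At_disjoint[OF B A(1)] A(2) that by blast
      then show "indicator B x * g B x = (if B = A then g A x else 0)" using A(2) by (cases "x \<in> B") auto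
    qed
    then show ?thesis using A g finite_At by (simp add: sum.delta)
  qed
  moreover have "integrable M (\<lambda>x. indicator A x * g A x)" if "A \<in> At n" for A
    using integrable_mult_indicator[of A M "g A"] g[OF that] integrable_S2[OF assms(1,2)] At_sets[OF that] assms(2) by simp
  then have "integrable M (\<lambda>x. \<Sum>A\<in>At n. indicator A x * g A x)"
    by (rule Bochner_Integration.integrable_sum)
  ultimately show ?thesis by (simp cong: Bochner_Integration.integrable_cong)
qed

lemmas integrable_P = integrable_piecewise[OF P.finite_measure_axioms refl]
lemmas integrable_P_S2 = integrable_S2[OF P.finite_measure_axioms refl]

lemma set_integrable_P: "integrable \<P> f \<Longrightarrow> A \<in> At n \<Longrightarrow> set_integrable \<P> A (f :: 'a \<Rightarrow> real)"
  by (rule set_integrable_of_integrable[OF _ At_sets])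

section \<open>Inequalities for polynomials on atoms\<close>

lemma remez_atoms:
  assumes "\<theta> > 0"
  obtains C where "C > 0"
    "\<And>n A E u x b. \<lbrakk>A \<in> At n; E \<in> sets \<P>; E \<subseteq> A; v E \<ge> \<theta> * v A; u \<in> S2; x \<in> A; \<And>y. y \<in> E \<Longrightarrow> \<bar>u y\<bar> \<le> b\<rbrakk>
       \<Longrightarrow> \<bar>u x\<bar> \<le> C * b"
proof -
  obtain D where D: "\<forall>u\<in>S2. line_degree_le D u" using S2_line_degree by blast
  obtain C where C: "C > 0" "\<And>(A::'a set) E v z b. \<lbrakk>convex A; A \<in> sets borel; bounded A; E \<in> sets borel; E \<subseteq> A;
       measure lborel E \<ge> \<theta> * measure lborel A; measure lborel A > 0; line_degree_le D v; z \<in> A;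
       \<And>x. x \<in> E \<Longrightarrow> \<bar>v x\<bar> \<le> b\<rbrakk> \<Longrightarrow> \<bar>v z\<bar> \<le> C * b"
    using remez[OF assms, where D = D] by blast
  show thesis
  proof (rule that[OF C(1)])
    fix n A E u x b assume *: "A \<in> At n" "E \<in> sets \<P>" "E \<subseteq> A" "v E \<ge> \<theta> * v A" "u \<in> S2" "x \<in> A" "\<And>y. y \<in> E \<Longrightarrow> \<bar>u y\<bar> \<le> b"
    show "\<bar>u x\<bar> \<le> C * b"
    proof (rule C(2)[OF convex_atoms[OF *(1)] At_borel[OF *(1)] bounded_At[OF *(1)] _ *(3) _ _ _ *(6,7)])
      show "E \<in> sets borel" using * sets_P_iff by blast
      show "\<theta> * measure lborel A \<le> measure lborel E" "0 < measure lborel A"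
        using *(4) v_pos[OF *(1)] Omega_measure(1) measure_P[OF *(2)] measure_P[OF At_sets[OF *(1)]]
        by (simp_all add: divide_simps split: if_splits)
    qed (use * D in auto)
  qed
qed

text \<open>By Chebyshev's inequality \<open>\<bar>u\<bar>\<close> is at most about twice its mean
  on half of \<open>E\<close>, and this half is still a fixed fraction of \<open>A\<close>, so the
  Remez inequality applies to it.\<close>

lemma sup_bound:
  assumes "\<theta> > 0"
  obtains C where "C > 0"
    "\<And>n A E u x. \<lbrakk>A \<in> At n; E \<in> sets \<P>; E \<subseteq> A; v E \<ge> \<theta> * v A; u \<in> S2; x \<in> A\<rbrakk>
       \<Longrightarrow> \<bar>u x\<bar> * v A \<le> C * (LINT y:E|\<P>. \<bar>u y\<bar>)"
proof -
  obtain C where C: "C > 0" "\<And>n A E u x b. \<lbrakk>A \<in> At n; E \<in> sets \<P>; E \<subseteq> A; v E \<ge> \<theta> / 2 * v A; u \<in> S2; x \<in> A; \<And>y. y \<in> E \<Longrightarrow> \<bar>u y\<bar> \<le> b\<rbrakk>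
       \<Longrightarrow> \<bar>u x\<bar> \<le> C * b" using remez_atoms[of "\<theta> / 2"] assms by auto
  show thesis
  proof (rule that[of "2 * C / \<theta>"])
    fix n A E u x assume *: "A \<in> At n" "E \<in> sets \<P>" "E \<subseteq> A" "v E \<ge> \<theta> * v A" "u \<in> S2" "x \<in> A"
    have vE: "v E > 0" using *(4) assms v_pos[OF *(1)] by (meson less_le_trans mult_pos_pos)
    define m where "m = (LINT y:E|\<P>. \<bar>u y\<bar>)"
    have iu: "integrable \<P> u" by (rule integrable_P_S2[OF *(5)])
    have m0: "m \<ge> 0" unfolding m_def set_lebesgue_integral_def by (intro Bochner_Integration.integral_nonneg) auto
    \<comment> \<open>The threshold stays strictly above the mean so that it is positive even when
      the mean is 0; the limit is taken afterwards.\<close>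
    have dense: "\<bar>u x\<bar> \<le> 2 * C * b" if b: "b > m / v E" for b
    proof -
      have "b > 0" using b m0 vE by (meson divide_nonneg_nonneg le_less_trans less_imp_le)
      define E0 where "E0 = {y\<in>E. \<bar>u y\<bar> \<le> 2 * b}"
      have "E0 = E \<inter> {y\<in>space \<P>. \<bar>u y\<bar> \<le> 2 * b}" using *(2) sets_P_iff by (auto simp: E0_def)
      moreover have "{y\<in>space \<P>. \<bar>u y\<bar> \<le> 2 * b} \<in> sets \<P>" using iu by measurable
      ultimately have E0: "E0 \<in> sets \<P>" using *(2) by auto
      have "v (E - E0) * (2 * b) = (LINT y|\<P>. 2 * b * indicator (E - E0) y)"
        using Int_Omega[of "E - E0"] *(2) E0 by (simp add: sets.Diff)
      also have "\<dots> \<le> m" unfolding m_def set_lebesgue_integral_def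
        using *(2) E0 \<open>b > 0\<close> iu
        by (intro integral_mono integrable_mult_indicator integrable_mult_right integrable_abs integrable_real_indicator)
          (auto simp: E0_def indicator_def P.emeasure_eq_measure)
      also have "\<dots> \<le> b * v E" using b vE by (simp add: field_simps)
      finally have "v (E - E0) \<le> v E / 2" using \<open>b > 0\<close> by (simp add: field_simps)
      moreover have "v (E - E0) = v E - v E0" using *(2) E0 by (intro P.finite_measure_Diff) (auto simp: E0_def)
      ultimately have "v E0 \<ge> \<theta> / 2 * v A" using *(4) by simp
      then have "\<bar>u x\<bar> \<le> C * (2 * b)"
        by (intro C(2)[OF *(1) E0 _ _ *(5,6)]) (use *(3) in \<open>auto simp: E0_def\<close>)
      then show ?thesis by simp
    qed
    have "\<bar>u x\<bar> \<le> 2 * C * (m / v E)"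
    proof (rule field_le_epsilon)
      fix e :: real assume "e > 0"
      then have "m / v E < m / v E + e / (2 * C)" using C(1) by simp
      from dense[OF this] have "\<bar>u x\<bar> \<le> 2 * C * (m / v E + e / (2 * C))" .
      then show "\<bar>u x\<bar> \<le> 2 * C * (m / v E) + e" using C(1) by (simp add: distrib_left)
    qed
    also have "\<dots> \<le> 2 * C * (m / (\<theta> * v A))"
      using *(4) C(1) m0 assms v_pos[OF *(1)] by (intro mult_left_mono divide_left_mono) (auto simp: vE)
    finally show "\<bar>u x\<bar> * v A \<le> 2 * C / \<theta> * (LINT y:E|\<P>. \<bar>u y\<bar>)"
      using v_pos[OF *(1)] assms by (simp add: m_def field_simps)
  qed (use C assms in auto)
qed

text \<open>A reverse inequality: two polynomials cannot be large on complementary parts of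
  \<open>A\<close> only. The sets where \<open>\<bar>f\<bar>\<close> is far below
  \<open>\<bar>f x\<bar>\<close> or \<open>\<bar>g\<bar>\<close> far below
  \<open>\<bar>g y\<bar>\<close> each fill less than a quarter of \<open>A\<close>, so both factors
  are large together on at least half of it. The constant is
  \<open>2 * (2 * C)\<^sup>2\<close>.\<close>

lemma product_bound:
  obtains C where "C > 0"
    "\<And>n A f g. \<lbrakk>A \<in> At n; f \<in> S; g \<in> S\<rbrakk>
       \<Longrightarrow> (LINT y:A|\<P>. \<bar>f y\<bar>) * (LINT y:A|\<P>. \<bar>g y\<bar>) \<le> C * v A * (LINT y:A|\<P>. \<bar>f y * g y\<bar>)"
proof -
  obtain C where C: "C > 0" "\<And>n A E u x b. \<lbrakk>A \<in> At n; E \<in> sets \<P>; E \<subseteq> A; v E \<ge> 1 / 4 * v A; u \<in> S2; x \<in> A; \<And>y. y \<in> E \<Longrightarrow> \<bar>u y\<bar> \<le> b\<rbrakk>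
       \<Longrightarrow> \<bar>u x\<bar> \<le> C * b" using remez_atoms[of "1 / 4"] by auto
  have pointwise: "\<bar>f x\<bar> * \<bar>g y\<bar> * v A \<le> 8 * C\<^sup>2 * (LINT y:A|\<P>. \<bar>f y * g y\<bar>)"
    if *: "A \<in> At n" "f \<in> S" "g \<in> S" "x \<in> A" "y \<in> A" for n A f g x y
  proof (cases "f x = 0 \<or> g y = 0")
    case True
    then show ?thesis by (auto simp: set_lebesgue_integral_def intro!: mult_nonneg_nonneg Bochner_Integration.integral_nonneg)
  next
    case False
    define E where "E u t = {z\<in>A. \<bar>u z\<bar> \<le> \<bar>u t\<bar> / (2 * C)}" for u :: "'a \<Rightarrow> real" and t
    have E: "E u t \<in> sets \<P>" "v (E u t) < v A / 4" if "u \<in> S" "t \<in> A" "u t \<noteq> 0" for u t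
    proof -
      have iu: "integrable \<P> u" by (intro integrable_P_S2 S_subset_S2 that)
      have "E u t = A \<inter> {z\<in>space \<P>. \<bar>u z\<bar> \<le> \<bar>u t\<bar> / (2 * C)}" using At_subset[OF *(1)] by (auto simp: E_def)
      moreover have "{z\<in>space \<P>. \<bar>u z\<bar> \<le> \<bar>u t\<bar> / (2 * C)} \<in> sets \<P>" using iu by measurable
      ultimately show Em: "E u t \<in> sets \<P>" using At_sets[OF *(1)] by auto
      \<comment> \<open>Otherwise the Remez inequality with bound
        \<open>\<bar>u t\<bar> / (2 * C)\<close> would give
        \<open>\<bar>u t\<bar> \<le> \<bar>u t\<bar> / 2\<close>.\<close>
      show "v (E u t) < v A / 4"
      proof (rule ccontr)
        assume "\<not> ?thesis"
        then have "\<bar>u t\<bar> \<le> C * (\<bar>u t\<bar> / (2 * C))"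
          using S_subset_S2[OF that(1)] that(2) by (intro C(2)[OF *(1) Em]) (auto simp: E_def)
        then show False using that(3) C(1) by simp
      qed
    qed
    define G where "G = A - (E f x \<union> E g y)"
    have Gm: "G \<in> sets \<P>" using E[OF *(2,4)] E[OF *(3,5)] False At_sets[OF *(1)] by (auto simp: G_def)
    have "v G = v A - v (E f x \<union> E g y)" unfolding G_def
      using E[OF *(2,4)] E[OF *(3,5)] False At_sets[OF *(1)] by (intro P.finite_measure_Diff) (auto simp: E_def)
    moreover have "v (E f x \<union> E g y) \<le> v (E f x) + v (E g y)"
      using E[OF *(2,4)] E[OF *(3,5)] False by (intro measure_Un_le) auto
    ultimately have vG: "v G \<ge> v A / 2" using E[OF *(2,4)] E[OF *(3,5)] False by auto
    define t where "t = \<bar>f x\<bar> / (2 * C) * (\<bar>g y\<bar> / (2 * C))"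
    have ifg: "integrable \<P> (\<lambda>z. f z * g z)" by (intro integrable_P_S2 S2_mult *)
    have t0: "t \<ge> 0" using C(1) by (simp add: t_def)
    have "t * (v A / 2) \<le> t * v G" using vG t0 by (intro mult_left_mono)
    also have "\<dots> = (LINT z|\<P>. t * indicator G z)" using Int_Omega[OF Gm] Gm by simp
    also have "\<dots> \<le> (LINT z:A|\<P>. \<bar>f z * g z\<bar>)" unfolding set_lebesgue_integral_def
    proof (intro integral_mono integrable_mult_indicator integrable_mult_right integrable_abs integrable_real_indicator)
      fix z
      have "t \<le> \<bar>f z\<bar> * \<bar>g z\<bar>" if "z \<in> G"
        unfolding t_def using that C(1) by (intro mult_mono) (auto simp: G_def E_def)
      then show "t * indicator G z \<le> indicator A z *\<^sub>R \<bar>f z * g z\<bar>"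
        by (auto simp: indicator_def G_def abs_mult)
    qed (use Gm ifg At_sets[OF *(1)] in \<open>auto simp: P.emeasure_eq_measure\<close>)
    finally show ?thesis using C(1) by (simp add: t_def field_simps power2_eq_square)
  qed
  show thesis
  proof (rule that[of "8 * C\<^sup>2"])
    fix n A f g assume *: "A \<in> At n" "f \<in> S" "g \<in> S"
    define I where "I = 8 * C\<^sup>2 * (LINT y:A|\<P>. \<bar>f y * g y\<bar>)"
    have vA: "v A > 0" by (rule v_pos[OF *(1)])
    have int: "integrable \<P> (\<lambda>x. \<bar>f x\<bar>)" "integrable \<P> (\<lambda>x. \<bar>g x\<bar>)"
      by (rule integrable_abs[OF integrable_P_S2[OF S_subset_S2]], rule *)+
    \<comment> \<open>The pointwise bound is averaged over \<open>x\<close> with \<open>y\<close>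
      fixed, and then over \<open>y\<close>.\<close>
    have 1: "(LINT x:A|\<P>. \<bar>f x\<bar>) * \<bar>g y\<bar> \<le> I" if "y \<in> A" for y
    proof -
      have "(LINT x:A|\<P>. \<bar>f x\<bar> * \<bar>g y\<bar>) \<le> I / v A * v A"
        using pointwise[OF * _ that] vA int(1) At_sets[OF *(1)]
        by (intro P.set_integral_le_const) (auto simp: I_def field_simps)
      then show ?thesis using vA by simp
    qed
    have "(LINT y:A|\<P>. (LINT x:A|\<P>. \<bar>f x\<bar>) * \<bar>g y\<bar>) \<le> I * v A"
      using 1 int(2) At_sets[OF *(1)] by (intro P.set_integral_le_const) auto
    then show "(LINT y:A|\<P>. \<bar>f y\<bar>) * (LINT y:A|\<P>. \<bar>g y\<bar>) \<le> 8 * C\<^sup>2 * v A * (LINT y:A|\<P>. \<bar>f y * g y\<bar>)"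
      by (simp add: I_def mult_ac)
  qed (use C in auto)
qed


section \<open>The correction for one step on one atom\<close>

lemma set_integral_sub:
  fixes f :: "'a \<Rightarrow> real"
  assumes "sets M = sets \<P>" "integrable M f" "A \<in> At n" "n \<le> m"
  shows "(LINT x:A|M. f x) = (\<Sum>B\<in>sub m A. LINT x:B|M. f x)"
proof -
  have "B \<in> sets M" if "B \<in> sub m A" for B using that At_sets assms(1) by (auto simp: sub_def)
  then have "(LINT x:(\<Union>B\<in>sub m A. B)|M. f x) = (\<Sum>B\<in>sub m A. LINT x:B|M. f x)"
    by (intro set_integral_finite_Union finite_sub sub_disjoint set_integrable_of_integrable assms(2)) auto
  then show ?thesis using sub_Union[OF assms(4,3)] by simp
qed

lemma set_integral_mono_atom:
  fixes f g :: "'a \<Rightarrow> real"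
  assumes "A \<in> At n" "integrable \<P> f" "integrable \<P> g" "\<And>x. x \<in> A \<Longrightarrow> f x \<le> g x"
  shows "(LINT x:A|\<P>. f x) \<le> (LINT x:A|\<P>. g x)"
  using assms by (intro set_integral_mono set_integrable_P)

text \<open>On the two children of \<open>A\<close> the polynomials \<open>h\<^sub>1\<close>, \<open>h\<^sub>2\<close> differ by at least the mean of \<open>\<bar>h\<bar>\<close>,
  because \<open>h\<close> is orthogonal to \<open>S\<close>; this forces \<open>u + h q\<close> to be large on one of the children.\<close>

lemma orthogonal_jump:
  obtains G where "G > 0"
    "\<And>n A h u q. \<lbrakk>A \<in> At n; h \<in> piecewise_space S (F (Suc n)); \<And>g. g \<in> S \<Longrightarrow> (LINT x:A|\<P>. h x * g x) = 0;
        u \<in> S2; q \<in> S\<rbrakk> \<Longrightarrow>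
      (LINT x:A|\<P>. \<bar>h x\<bar>) * (LINT x:A|\<P>. \<bar>q x\<bar>) \<le> G * v A * (LINT x:A|\<P>. \<bar>u x + h x * q x\<bar>)"
proof -
  obtain C1 where C1: "C1 > 0" "\<And>n A E u x. \<lbrakk>A \<in> At n; E \<in> sets \<P>; E \<subseteq> A; v E \<ge> r\<^sub>0 * v A; u \<in> S2; x \<in> A\<rbrakk>
       \<Longrightarrow> \<bar>u x\<bar> * v A \<le> C1 * (LINT y:E|\<P>. \<bar>u y\<bar>)" using sup_bound[OF r0(1)] by blast
  obtain C2 where C2: "C2 > 0" "\<And>n A f g. \<lbrakk>A \<in> At n; f \<in> S; g \<in> S\<rbrakk>
       \<Longrightarrow> (LINT y:A|\<P>. \<bar>f y\<bar>) * (LINT y:A|\<P>. \<bar>g y\<bar>) \<le> C2 * v A * (LINT y:A|\<P>. \<bar>f y * g y\<bar>)"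
    using product_bound by blast
  show thesis
  proof (rule that[of "C1 * C2 * C1"])
    fix n A h u q
    assume A: "A \<in> At n" and h: "h \<in> piecewise_space S (F (Suc n))"
      and orth: "\<And>g. g \<in> S \<Longrightarrow> (LINT x:A|\<P>. h x * g x) = 0" and u: "u \<in> S2" and q: "q \<in> S"
    define I where "I f = (LINT x:A|\<P>. f x)" for f :: "'a \<Rightarrow> real"
    have vA: "v A > 0" by (rule v_pos[OF A])
    have I_mono: "I f \<le> I g" if "integrable \<P> f" "integrable \<P> g" "\<And>x. x \<in> A \<Longrightarrow> f x \<le> g x" for f g
      unfolding I_def by (rule set_integral_mono_atom[OF A that])
    have I_const: "I (\<lambda>x. c) = c * v A" for c
      unfolding I_def using A by (simp add: set_integral_const At_sets P.emeasure_eq_measure)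
    have I_cmult: "I (\<lambda>x. c * f x) = c * I f" for c f by (simp add: I_def)
    have I_nonneg: "I (\<lambda>x. \<bar>f x\<bar>) \<ge> 0" for f
      unfolding I_def set_lebesgue_integral_def by (intro Bochner_Integration.integral_nonneg) auto
    obtain A1 A2 where c: "sub (Suc n) A = {A1, A2}" "A1 \<in> At (Suc n)" "A2 \<in> At (Suc n)" "A1 \<union> A2 = A" "A1 \<inter> A2 = {}"
      using obtain_siblings[OF A] by metis
    have large: "r\<^sub>0 * v A \<le> v A1" "r\<^sub>0 * v A \<le> v A2" using v_child(1)[OF A] c by auto
    obtain h1 where h1: "h1 \<in> S" "\<And>x. x \<in> A1 \<Longrightarrow> h x = h1 x"
      using h c(2) unfolding piecewise_space_def by blast
    obtain h2 where h2: "h2 \<in> S" "\<And>x. x \<in> A2 \<Longrightarrow> h x = h2 x"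
      using h c(3) unfolding piecewise_space_def by blast
    define d where "d x = h2 x - h1 x" for x
    have d: "d \<in> S" unfolding d_def using fun_subspaceD(4)[OF S_space(1) h2(1) h1(1)] .
    have qp: "q \<in> piecewise_space S (F (Suc n))" by (rule const_piecewise[OF q])
    have int: "integrable \<P> h" "integrable \<P> (\<lambda>x. h x * h x)" "integrable \<P> (\<lambda>x. h x * h1 x)" "integrable \<P> d"
      "integrable \<P> (\<lambda>x. d x * q x)" "integrable \<P> (\<lambda>x. u x + h x * q x)"
      using integrable_P[OF piecewise_S_S2[OF h]] integrable_P[OF piecewise_mult[OF h h]]
        integrable_P[OF piecewise_mult[OF h const_piecewise[OF h1(1)]]] integrable_P_S2[OF S_subset_S2[OF d]]
        integrable_P_S2[OF S2_mult[OF d q]] integrable_P[OF piecewise_S2_add[OF const_piecewise[OF u] piecewise_mult[OF h qp]]]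
      by auto
    define X where "X = I (\<lambda>x. \<bar>h x\<bar>)"
    define M where "M = C1 * I (\<lambda>x. \<bar>d x\<bar>) / v A"
    have dM: "\<bar>d x\<bar> \<le> M" if "x \<in> A" for x
      using C1(2)[OF A At_sets[OF A] order_refl _ S_subset_S2[OF d] that] r0 vA by (simp add: M_def I_def field_simps)
    have M0: "M \<ge> 0" using C1(1) I_nonneg vA by (simp add: M_def)
    \<comment> \<open>Orthogonality allows \<open>h1\<close> to be subtracted: the integral of
      \<open>h * h\<close> equals that of \<open>h * (h - h1)\<close>, where \<open>h - h1\<close>
      vanishes on \<open>A1\<close> and is \<open>d\<close> on \<open>A2\<close>. The square of the
      mean of \<open>\<bar>h\<bar>\<close> is brought in by expanding
      \<open>(\<bar>h\<bar> - t)\<^sup>2 \<ge> 0\<close> with \<open>t\<close> that mean.\<close>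
    have X_le: "X \<le> M * v A"
    proof -
      define t where "t = X / v A"
      have t0: "t \<ge> 0" using I_nonneg vA by (simp add: t_def X_def)
      have "I (\<lambda>x. 2 * t * \<bar>h x\<bar> - t * t) \<le> I (\<lambda>x. h x * h x)"
      proof (rule I_mono)
        fix x
        have "0 \<le> (\<bar>h x\<bar> - t) * (\<bar>h x\<bar> - t)" by simp
        then show "2 * t * \<bar>h x\<bar> - t * t \<le> h x * h x" by (simp add: algebra_simps)
      qed (use int in auto)
      also have "I (\<lambda>x. 2 * t * \<bar>h x\<bar> - t * t) = 2 * t * X - t * t * v A"
        using I_cmult[of "2 * t" "\<lambda>x. \<bar>h x\<bar>"] I_const[of "t * t"] int A
        unfolding X_def I_def by (subst set_integral_diff(2)) (auto intro!: set_integrable_P)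
      also have "I (\<lambda>x. h x * h x) = I (\<lambda>x. h x * h x - h x * h1 x)"
        using orth[OF h1(1)] int A unfolding I_def by (subst set_integral_diff(2)) (auto intro!: set_integrable_P)
      also have "\<dots> \<le> I (\<lambda>x. M * \<bar>h x\<bar>)"
      proof (rule I_mono)
        fix x assume "x \<in> A"
        then consider "x \<in> A1" | "x \<in> A2" using c(4) by blast
        then show "h x * h x - h x * h1 x \<le> M * \<bar>h x\<bar>"
        proof cases
          case 2
          then have "h x * h x - h x * h1 x = h x * d x" using h2(2) by (simp add: d_def algebra_simps)
          also have "\<dots> \<le> \<bar>h x\<bar> * \<bar>d x\<bar>" by (metis abs_ge_self abs_mult)
          also have "\<dots> \<le> \<bar>h x\<bar> * M" using dM[OF \<open>x \<in> A\<close>] by (intro mult_left_mono) auto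
          finally show ?thesis by (simp add: mult.commute)
        qed (use h1(2) M0 in auto)
      qed (use int in auto)
      also have "\<dots> = M * X" by (simp add: I_cmult X_def)
      finally have "X * X \<le> M * v A * X" using vA by (simp add: t_def field_simps)
      moreover have "X \<ge> 0" by (simp add: X_def I_nonneg)
      ultimately show ?thesis using M0 vA by (cases "X = 0") auto
    qed
    define Z where "Z = I (\<lambda>x. \<bar>u x + h x * q x\<bar>)"
    \<comment> \<open>Each of \<open>u + h1 q\<close> and \<open>u + h2 q\<close> lies in
      \<open>S2\<close> and agrees with \<open>u + h q\<close> on one child, which is large enough
      to control it on all of \<open>A\<close>. Their difference is \<open>d q\<close>.\<close>
    have jump: "I (\<lambda>x. \<bar>d x * q x\<bar>) \<le> C1 * Z"
    proof -
      have piece: "\<bar>u x + g x * q x\<bar> * v A \<le> C1 * (LINT y:B|\<P>. \<bar>u y + h y * q y\<bar>)"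
        if x: "x \<in> A" and B: "B \<in> At (Suc n)" "B \<subseteq> A" and g: "g \<in> S" "\<And>y. y \<in> B \<Longrightarrow> h y = g y" for x B g
      proof -
        have "(\<lambda>y. u y + g y * q y) \<in> S2" by (rule fun_subspaceD(3)[OF subspace_S2 u S2_mult[OF g(1) q]])
        then have "\<bar>u x + g x * q x\<bar> * v A \<le> C1 * (LINT y:B|\<P>. \<bar>u y + g y * q y\<bar>)"
          using v_child(1)[OF A B] by (intro C1(2)[OF A At_sets[OF B(1)] B(2) _ _ x])
        also have "(LINT y:B|\<P>. \<bar>u y + g y * q y\<bar>) = (LINT y:B|\<P>. \<bar>u y + h y * q y\<bar>)"
          using g(2) At_sets[OF B(1)] by (intro set_lebesgue_integral_cong) auto
        finally show ?thesis .
      qed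
      have Z: "Z = (LINT y:A1|\<P>. \<bar>u y + h y * q y\<bar>) + (LINT y:A2|\<P>. \<bar>u y + h y * q y\<bar>)"
        unfolding Z_def I_def c(4)[symmetric] using int c by (intro set_integral_Un set_integrable_P integrable_abs) auto
      have "\<bar>d x * q x\<bar> \<le> C1 * Z / v A" if x: "x \<in> A" for x
      proof -
        have "d x * q x = (u x + h2 x * q x) - (u x + h1 x * q x)" by (simp add: d_def algebra_simps)
        then have "\<bar>d x * q x\<bar> \<le> \<bar>u x + h2 x * q x\<bar> + \<bar>u x + h1 x * q x\<bar>" by linarith
        then have "\<bar>d x * q x\<bar> * v A \<le> \<bar>u x + h2 x * q x\<bar> * v A + \<bar>u x + h1 x * q x\<bar> * v A"
          using mult_right_mono[OF _ less_imp_le[OF vA]] by (simp add: distrib_right[symmetric])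
        also have "\<dots> \<le> C1 * Z" using piece[OF x c(2) _ h1] piece[OF x c(3) _ h2] c(4)
          unfolding Z distrib_left by fastforce
        finally show ?thesis using vA by (simp add: field_simps)
      qed
      then have "I (\<lambda>x. \<bar>d x * q x\<bar>) \<le> I (\<lambda>x. C1 * Z / v A)" using int by (intro I_mono) auto
      then show ?thesis using vA by (simp add: I_const)
    qed
    have "X * I (\<lambda>x. \<bar>q x\<bar>) \<le> (M * v A) * I (\<lambda>x. \<bar>q x\<bar>)" using X_le I_nonneg by (intro mult_right_mono)
    also have "\<dots> = C1 * (I (\<lambda>x. \<bar>d x\<bar>) * I (\<lambda>x. \<bar>q x\<bar>))" using vA by (simp add: M_def)
    also have "\<dots> \<le> C1 * (C2 * v A * I (\<lambda>x. \<bar>d x * q x\<bar>))"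
      using C2(2)[OF A d q] C1(1) unfolding I_def by (intro mult_left_mono) auto
    also have "\<dots> \<le> C1 * (C2 * v A * (C1 * Z))"
      using jump C1(1) C2(1) vA by (intro mult_left_mono) auto
    finally show "(LINT x:A|\<P>. \<bar>h x\<bar>) * (LINT x:A|\<P>. \<bar>q x\<bar>) \<le> C1 * C2 * C1 * v A * (LINT x:A|\<P>. \<bar>u x + h x * q x\<bar>)"
      by (simp add: X_def Z_def I_def mult_ac)
  qed (use C1 C2 in auto)
qed

text \<open>The perturbation by \<open>lam * p\<close> is undone in the jump estimate: passing from
  \<open>w\<close> back to \<open>u + h q\<close> costs at most a multiple of
  \<open>lam * Nq * X\<close>, where \<open>Nq\<close> and \<open>X\<close> measure \<open>q\<close>
  and \<open>h\<close>, and the jump estimate bounds this very product.\<close>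

lemma key_estimate:
  assumes nr: "norm_recovery \<Omega> F S L" and \<kappa>: "\<kappa> \<ge> 1"
  obtains K lam\<^sub>0 where "K > 0" "lam\<^sub>0 > 0"
    "\<And>n A h p u q lam. \<lbrakk>A \<in> At n; h \<in> piecewise_space S (F (Suc n)); p \<in> piecewise_space S (F (Suc n));
       \<And>x. x \<in> A \<Longrightarrow> p x \<ge> 0; \<And>g. g \<in> S \<Longrightarrow> (LINT x:A|\<P>. h x * g x) = 0;
       (LINT x:A|\<P>. p x) \<le> \<kappa> * (LINT x:A|\<P>. \<bar>h x\<bar>); u \<in> S2; q \<in> S; 0 < lam; lam \<le> lam\<^sub>0\<rbrakk> \<Longrightarrow>
      \<bar>lam * (LINT x:A|\<P>. p x * q x)\<bar>
        \<le> K * lam * (\<Sum>B\<in>sub (Suc n + L) A. \<bar>LINT x:B|\<P>. u x + (h x - lam * p x) * q x\<bar>)"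
proof -
  obtain C1 where C1: "C1 > 0" "\<And>n A E u x. \<lbrakk>A \<in> At n; E \<in> sets \<P>; E \<subseteq> A; v E \<ge> r\<^sub>0 * v A; u \<in> S2; x \<in> A\<rbrakk>
       \<Longrightarrow> \<bar>u x\<bar> * v A \<le> C1 * (LINT y:E|\<P>. \<bar>u y\<bar>)" using sup_bound[OF r0(1)] by blast
  obtain G where G: "G > 0" "\<And>n A h u q. \<lbrakk>A \<in> At n; h \<in> piecewise_space S (F (Suc n)); \<And>g. g \<in> S \<Longrightarrow> (LINT x:A|\<P>. h x * g x) = 0;
        u \<in> S2; q \<in> S\<rbrakk> \<Longrightarrow>
      (LINT x:A|\<P>. \<bar>h x\<bar>) * (LINT x:A|\<P>. \<bar>q x\<bar>) \<le> G * v A * (LINT x:A|\<P>. \<bar>u x + h x * q x\<bar>)"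
    using orthogonal_jump by blast
  obtain c' where c': "c' > 0" "\<And>j A u. A \<in> At j \<Longrightarrow> u \<in> S2 \<Longrightarrow>
        (\<Sum>B\<in>sub (j + L) A. \<bar>LINT x:B|\<P>. u x\<bar>) \<ge> c' * (LINT x:A|\<P>. \<bar>u x\<bar>)"
    using nr unfolding norm_recovery_def sub_def by blast
  show thesis
  \<comment> \<open>The bound on \<open>lam\<close> makes the cost at most half of
    \<open>Nq * X\<close>, which moves to the left side and leaves the factor 2;
    \<open>1 / c'\<close> comes from replacing the integral of \<open>\<bar>w\<bar>\<close> by the
    sum over small atoms.\<close>
  proof (rule that[of "2 * G * C1 * \<kappa> / c'" "1 / (2 * G * C1 * \<kappa>)"])
    fix n A h p u q lam
    assume A: "A \<in> At n" and h: "h \<in> piecewise_space S (F (Suc n))" and p: "p \<in> piecewise_space S (F (Suc n))"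
      and p0: "\<And>x. x \<in> A \<Longrightarrow> p x \<ge> 0" and orth: "\<And>g. g \<in> S \<Longrightarrow> (LINT x:A|\<P>. h x * g x) = 0"
      and ph: "(LINT x:A|\<P>. p x) \<le> \<kappa> * (LINT x:A|\<P>. \<bar>h x\<bar>)" and u: "u \<in> S2" and q: "q \<in> S"
      and lam: "0 < lam" "lam \<le> 1 / (2 * G * C1 * \<kappa>)"
    define I where "I f = (LINT x:A|\<P>. f x)" for f :: "'a \<Rightarrow> real"
    have vA: "v A > 0" by (rule v_pos[OF A])
    have I_mono: "I f \<le> I g" if "integrable \<P> f" "integrable \<P> g" "\<And>x. x \<in> A \<Longrightarrow> f x \<le> g x" for f g
      unfolding I_def by (rule set_integral_mono_atom[OF A that])
    have I_cmult: "I (\<lambda>x. c * f x) = c * I f" for c f by (simp add: I_def)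
    have I_nonneg: "I (\<lambda>x. \<bar>f x\<bar>) \<ge> 0" for f
      unfolding I_def set_lebesgue_integral_def by (intro Bochner_Integration.integral_nonneg) auto
    have qp: "q \<in> piecewise_space S (F (Suc n))" by (rule const_piecewise[OF q])
    define w where "w x = u x + (h x - lam * p x) * q x" for x
    have hp: "(\<lambda>x. h x - lam * p x) \<in> piecewise_space S (F (Suc n))" by (rule piecewise_S_diff[OF h p])
    have wp: "w \<in> piecewise_space S2 (F (Suc n))"
      unfolding w_def by (intro piecewise_S2_add piecewise_mult hp qp const_piecewise[OF u])
    have int: "integrable \<P> h" "integrable \<P> p" "integrable \<P> (\<lambda>x. p x * q x)" "integrable \<P> w"
      "integrable \<P> (\<lambda>x. u x + h x * q x)"
      using integrable_P[OF piecewise_S_S2[OF h]] integrable_P[OF piecewise_S_S2[OF p]] integrable_P[OF piecewise_mult[OF p qp]]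
        integrable_P[OF wp] integrable_P[OF piecewise_S2_add[OF const_piecewise[OF u] piecewise_mult[OF h qp]]]
      by auto
    define Nq where "Nq = I (\<lambda>x. \<bar>q x\<bar>) / v A"
    define X where "X = I (\<lambda>x. \<bar>h x\<bar>)"
    define W where "W = I (\<lambda>x. \<bar>w x\<bar>)"
    have Nq0: "Nq \<ge> 0" using I_nonneg vA by (simp add: Nq_def)
    have qN: "\<bar>q x\<bar> \<le> C1 * Nq" if "x \<in> A" for x
      using C1(2)[OF A At_sets[OF A] order_refl _ S_subset_S2[OF q] that] r0 vA by (simp add: Nq_def I_def field_simps)
    have pq: "\<bar>p x * q x\<bar> \<le> C1 * Nq * p x" if "x \<in> A" for x
      using mult_left_mono[OF qN[OF that] p0[OF that]] p0[OF that] by (simp add: abs_mult mult_ac)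
    have CNp: "I (\<lambda>x. C1 * Nq * p x) \<le> C1 * \<kappa> * (Nq * X)"
    proof -
      have "I (\<lambda>x. C1 * Nq * p x) = (C1 * Nq) * I p" by (rule I_cmult)
      also have "\<dots> \<le> (C1 * Nq) * (\<kappa> * X)" using ph C1(1) Nq0 unfolding I_def X_def by (intro mult_left_mono) auto
      finally show ?thesis by (simp add: mult_ac)
    qed
    have "I (\<lambda>x. p x * q x) \<le> I (\<lambda>x. C1 * Nq * p x)" "I (\<lambda>x. - 1 * (p x * q x)) \<le> I (\<lambda>x. C1 * Nq * p x)"
      using pq int by (auto intro!: I_mono simp: abs_le_iff)
    then have step1: "\<bar>I (\<lambda>x. p x * q x)\<bar> \<le> C1 * \<kappa> * (Nq * X)"
      using CNp I_cmult[of "- 1" "\<lambda>x. p x * q x"] by (simp add: abs_le_iff)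
    have "I (\<lambda>x. \<bar>u x + h x * q x\<bar>) \<le> I (\<lambda>x. \<bar>w x\<bar> + lam * (C1 * Nq * p x))"
    proof (rule I_mono)
      fix x assume x: "x \<in> A"
      have "u x + h x * q x = w x + lam * (p x * q x)" by (simp add: w_def algebra_simps)
      then have "\<bar>u x + h x * q x\<bar> \<le> \<bar>w x\<bar> + lam * \<bar>p x * q x\<bar>" using lam(1) by (metis abs_mult abs_of_pos abs_triangle_ineq)
      then show "\<bar>u x + h x * q x\<bar> \<le> \<bar>w x\<bar> + lam * (C1 * Nq * p x)"
        using mult_left_mono[OF pq[OF x] less_imp_le[OF lam(1)]] by linarith
    qed (use int in auto)
    also have "\<dots> = W + lam * I (\<lambda>x. C1 * Nq * p x)"
      unfolding W_def I_cmult[symmetric] unfolding I_def using int A by (intro set_integral_add set_integrable_P) auto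
    also have "\<dots> \<le> W + lam * (C1 * \<kappa> * (Nq * X))" using CNp lam(1) by simp
    finally have Z: "I (\<lambda>x. \<bar>u x + h x * q x\<bar>) \<le> W + lam * (C1 * \<kappa> * (Nq * X))" .
    have "X * I (\<lambda>x. \<bar>q x\<bar>) \<le> G * v A * I (\<lambda>x. \<bar>u x + h x * q x\<bar>)"
      unfolding X_def I_def by (rule G(2)[OF A h orth u q])
    then have "Nq * X \<le> G * I (\<lambda>x. \<bar>u x + h x * q x\<bar>)" using vA by (simp add: Nq_def field_simps)
    also have "\<dots> \<le> G * (W + lam * (C1 * \<kappa> * (Nq * X)))" using Z G(1) by simp
    also have "\<dots> = G * W + lam * (2 * G * C1 * \<kappa>) * (Nq * X) / 2" by (simp add: algebra_simps)
    also have "\<dots> \<le> G * W + 1 * (Nq * X) / 2"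
    proof -
      have "lam * (2 * G * C1 * \<kappa>) \<le> 1" using lam(2) G(1) C1(1) \<kappa> by (simp add: field_simps)
      moreover have "Nq * X \<ge> 0" using Nq0 I_nonneg by (simp add: X_def)
      ultimately show ?thesis by (intro add_left_mono divide_right_mono mult_right_mono) auto
    qed
    finally have NX: "Nq * X \<le> 2 * G * W" by simp
    \<comment> \<open>On \<open>A\<close> itself \<open>w\<close> consists of two pieces; it belongs
      to \<open>S2\<close> only on each child. So \<open>norm_recovery\<close> starts at level
      \<open>Suc n\<close>, and the correction must live on level \<open>Suc n + L\<close>.\<close>
    have recover: "c' * W \<le> (\<Sum>B\<in>sub (Suc n + L) A. \<bar>LINT x:B|\<P>. w x\<bar>)"
    proof -
      have "W = (\<Sum>C\<in>sub (Suc n) A. LINT x:C|\<P>. \<bar>w x\<bar>)"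
        unfolding W_def I_def using int A by (intro set_integral_sub) auto
      then have "c' * W = (\<Sum>C\<in>sub (Suc n) A. c' * (LINT x:C|\<P>. \<bar>w x\<bar>))" by (simp add: sum_distrib_left)
      also have "\<dots> \<le> (\<Sum>C\<in>sub (Suc n) A. \<Sum>B\<in>sub (Suc n + L) C. \<bar>LINT x:B|\<P>. w x\<bar>)"
      proof (rule sum_mono)
        fix C assume "C \<in> sub (Suc n) A"
        then have C: "C \<in> At (Suc n)" by (simp add: sub_def)
        then obtain g where g: "g \<in> S2" "\<And>x. x \<in> C \<Longrightarrow> w x = g x" using wp unfolding piecewise_space_def by blast
        have "c' * (LINT x:C|\<P>. \<bar>w x\<bar>) = c' * (LINT x:C|\<P>. \<bar>g x\<bar>)"
          using g(2) At_sets[OF C] by (intro arg_cong[of _ _ "\<lambda>t. c' * t"] set_lebesgue_integral_cong) auto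
        also have "\<dots> \<le> (\<Sum>B\<in>sub (Suc n + L) C. \<bar>LINT x:B|\<P>. g x\<bar>)" by (rule c'(2)[OF C g(1)])
        also have "\<dots> = (\<Sum>B\<in>sub (Suc n + L) C. \<bar>LINT x:B|\<P>. w x\<bar>)"
        proof (intro sum.cong refl arg_cong[of _ _ abs] set_lebesgue_integral_cong allI impI)
          fix B x assume B: "B \<in> sub (Suc n + L) C"
          then show "B \<in> sets \<P>" using At_sets by (auto simp: sub_def)
          assume "x \<in> B" then show "g x = w x" using g(2)[of x] B by (auto simp: sub_def)
        qed
        finally show "c' * (LINT x:C|\<P>. \<bar>w x\<bar>) \<le> (\<Sum>B\<in>sub (Suc n + L) C. \<bar>LINT x:B|\<P>. w x\<bar>)" .
      qed
      also have "\<dots> = (\<Sum>B\<in>sub (Suc n + L) A. \<bar>LINT x:B|\<P>. w x\<bar>)"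
        using A by (intro sum_sub[symmetric, of n]) auto
      finally show ?thesis .
    qed
    have "\<bar>lam * I (\<lambda>x. p x * q x)\<bar> = lam * \<bar>I (\<lambda>x. p x * q x)\<bar>" using lam(1) by (simp add: abs_mult)
    also have "\<dots> \<le> lam * (C1 * \<kappa> * (2 * G * W))"
      using order_trans[OF step1 mult_left_mono[OF NX]] C1(1) \<kappa> lam(1) by (intro mult_left_mono) auto
    also have "\<dots> = (2 * G * C1 * \<kappa> / c') * lam * (c' * W)" using c'(1) by simp
    also have "\<dots> \<le> (2 * G * C1 * \<kappa> / c') * lam * (\<Sum>B\<in>sub (Suc n + L) A. \<bar>LINT x:B|\<P>. w x\<bar>)"
      using recover G(1) C1(1) \<kappa> c'(1) lam(1) by (intro mult_left_mono) auto
    finally show "\<bar>lam * (LINT x:A|\<P>. p x * q x)\<bar>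
        \<le> 2 * G * C1 * \<kappa> / c' * lam * (\<Sum>B\<in>sub (Suc n + L) A. \<bar>LINT x:B|\<P>. u x + (h x - lam * p x) * q x\<bar>)"
      unfolding I_def w_def .
  qed (use G C1 c' \<kappa> in auto)
qed

text \<open>Both demands on the coefficients are one functional on the pairs \<open>(u, q)\<close>
  in \<open>S2 \<times> S\<close>, which ignores \<open>u\<close>. The estimate says that it is
  bounded by the integrals over the small atoms, in particular that it depends on these
  alone.\<close>

lemma correction_on_atom:
  assumes A: "A \<in> At n" and h: "h \<in> piecewise_space S (F (Suc n))" and p: "p \<in> piecewise_space S (F (Suc n))"
    and "K \<ge> 0"
    and est: "\<And>u q. u \<in> S2 \<Longrightarrow> q \<in> S \<Longrightarrow> \<bar>lam * (LINT x:A|\<P>. p x * q x)\<bar>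
        \<le> K * (\<Sum>B\<in>sub m A. \<bar>LINT x:B|\<P>. u x + (h x - lam * p x) * q x\<bar>)"
  shows "\<exists>\<phi>. (\<forall>B. \<bar>\<phi> B\<bar> \<le> K) \<and> (\<forall>u\<in>S2. (\<Sum>B\<in>sub m A. \<phi> B * (LINT x:B|\<P>. u x)) = 0) \<and>
    (\<forall>q\<in>S. (\<Sum>B\<in>sub m A. \<phi> B * (LINT x:B|\<P>. (h x - lam * p x) * q x)) = lam * (LINT x:A|\<P>. p x * q x))"
proof -
  define w where "w y x = fst y x + (h x - lam * p x) * snd y x" for y :: "('a \<Rightarrow> real) \<times> ('a \<Rightarrow> real)" and x
  define e where "e B y = (LINT x:B|\<P>. w y x)" for B y
  define l where "l y = lam * (LINT x:A|\<P>. p x * snd y x)" for y :: "('a \<Rightarrow> real) \<times> ('a \<Rightarrow> real)"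
  have hp: "(\<lambda>x. h x - lam * p x) \<in> piecewise_space S (F (Suc n))" by (rule piecewise_S_diff[OF h p])
  have iw: "integrable \<P> (w y)" if "y \<in> S2 \<times> S" for y
    unfolding w_def using that
    by (intro integrable_P[OF piecewise_S2_add[OF const_piecewise piecewise_mult[OF hp const_piecewise]]]) auto
  have ip: "integrable \<P> (\<lambda>x. p x * snd y x)" if "y \<in> S2 \<times> S" for y :: "('a \<Rightarrow> real) \<times> ('a \<Rightarrow> real)"
    using that by (intro integrable_P[OF piecewise_mult[OF p const_piecewise]]) auto
  have "\<exists>\<phi>. (\<forall>B. \<bar>\<phi> B\<bar> \<le> K) \<and> (\<forall>y\<in>S2 \<times> S. l y = (\<Sum>B\<in>sub m A. \<phi> B * e B y))"
  proof (rule finite_hahn_banach)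
    show "subspace (S2 \<times> S)" by (intro subspace_Times subspace_S2 S_space(1))
  next
    fix x y a assume xy: "x \<in> S2 \<times> S" "y \<in> S2 \<times> S"
    have "p t * snd (x + a *\<^sub>R y) t = p t * snd x t + a * (p t * snd y t)" for t
      by (simp add: plus_fun_def scaleR_fun_def algebra_simps)
    then have "l (x + a *\<^sub>R y) = lam * (LINT t:A|\<P>. p t * snd x t + a * (p t * snd y t))" by (simp add: l_def)
    also have "(LINT t:A|\<P>. p t * snd x t + a * (p t * snd y t)) = (LINT t:A|\<P>. p t * snd x t) + (LINT t:A|\<P>. a * (p t * snd y t))"
      using ip xy A by (intro set_integral_add set_integrable_P integrable_mult_right) auto
    finally show "l (x + a *\<^sub>R y) = l x + a * l y" by (simp add: l_def algebra_simps)
  next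
    fix B x y a assume B: "B \<in> sub m A" and xy: "x \<in> S2 \<times> S" "y \<in> S2 \<times> S"
    have "w (x + a *\<^sub>R y) t = w x t + a * w y t" for t
      by (simp add: w_def plus_fun_def scaleR_fun_def algebra_simps)
    then have "e B (x + a *\<^sub>R y) = (LINT t:B|\<P>. w x t + a * w y t)" by (simp add: e_def)
    also have "\<dots> = (LINT t:B|\<P>. w x t) + (LINT t:B|\<P>. a * w y t)"
      using iw xy B by (intro set_integral_add set_integrable_P[where n = m] integrable_mult_right) (auto simp: sub_def)
    finally show "e B (x + a *\<^sub>R y) = e B x + a * e B y" by (simp add: e_def)
  next
    fix y assume "y \<in> S2 \<times> S"
    then show "\<bar>l y\<bar> \<le> K * (\<Sum>B\<in>sub m A. \<bar>e B y\<bar>)" unfolding l_def e_def w_def using est by auto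
  qed (use finite_sub \<open>K \<ge> 0\<close> in auto)
  then obtain \<phi> where \<phi>: "\<forall>B. \<bar>\<phi> B\<bar> \<le> K" "\<And>y. y \<in> S2 \<times> S \<Longrightarrow> l y = (\<Sum>B\<in>sub m A. \<phi> B * e B y)" by blast
  \<comment> \<open>The pairs \<open>(u, 0)\<close> give preservation of \<open>S2\<close>, the
    pairs \<open>(0, q)\<close> the prescribed shift.\<close>
  have "(\<Sum>B\<in>sub m A. \<phi> B * (LINT x:B|\<P>. u x)) = 0" if "u \<in> S2" for u
    using \<phi>(2)[of "(u, \<lambda>x. 0)"] that fun_subspaceD(1)[OF S_space(1)] by (simp add: l_def e_def w_def)
  moreover have "(\<Sum>B\<in>sub m A. \<phi> B * (LINT x:B|\<P>. (h x - lam * p x) * q x)) = lam * (LINT x:A|\<P>. p x * q x)" if "q \<in> S" for q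
    using \<phi>(2)[of "(\<lambda>x. 0, q)"] that fun_subspaceD(1)[OF subspace_S2] by (simp add: l_def e_def w_def)
  ultimately show ?thesis using \<phi>(1) by blast
qed

end

section \<open>Sparse products of densities\<close>

text \<open>How the corrections were found is forgotten here; \<open>act\<close> is the set of steps
  with a nonzero increment. Step \<open>Suc n\<close> is orthogonal on atoms of level
  \<open>n\<close> but varies down to level \<open>Suc n + L\<close>, and the next active step
  starts no earlier than there.\<close>

locale sparse_densities = fat_filtration \<Omega> F S c\<^sub>0 c\<^sub>4
  for \<Omega> :: "'a::euclidean_space set" and F S c\<^sub>0 c\<^sub>4 +
  fixes L :: nat and act :: "nat set" and \<phi> h :: "nat \<Rightarrow> 'a \<Rightarrow> real" and \<delta> :: real
  assumes \<delta>: "0 \<le> \<delta>" "\<delta> \<le> 1 / 2"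
    and \<phi>_const: "\<And>n B. B \<in> At (n + L) \<Longrightarrow> \<exists>c. \<forall>x\<in>B. \<phi> n x = c"
    and \<phi>_le: "\<And>n x. \<bar>\<phi> n x\<bar> \<le> \<delta>"
    and \<phi>_inactive: "\<And>n x. n \<notin> act \<Longrightarrow> \<phi> n x = 0"
    and h_piecewise: "\<And>n. h (Suc n) \<in> piecewise_space S (F (Suc n))"
    and h_inactive: "\<And>n x. Suc n \<notin> act \<Longrightarrow> x \<in> \<Omega> \<Longrightarrow> h (Suc n) x = 0"
    and sparse: "\<And>n m. n \<in> act \<Longrightarrow> m \<in> act \<Longrightarrow> n < m \<Longrightarrow> n + L < m"
    and \<phi>_orth: "\<And>n A u. Suc n \<in> act \<Longrightarrow> A \<in> At n \<Longrightarrow> u \<in> S2 \<Longrightarrow> (LINT x:A|\<P>. u x * \<phi> (Suc n) x) = 0"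
    and h_orth: "\<And>n A q. Suc n \<in> act \<Longrightarrow> A \<in> At n \<Longrightarrow> q \<in> S \<Longrightarrow>
      (LINT x:A|\<P>. h (Suc n) x * q x * (1 + \<phi> (Suc n) x)) = 0"
begin

definition D :: "nat \<Rightarrow> 'a \<Rightarrow> real" where
  "D n x = (\<Prod>k\<in>{1..n}. 1 + \<phi> k x)"

text \<open>By \<open>Q_stable\<close> all later densities give \<open>A\<close> the same mass,
  which the limit measure therefore has to reproduce.\<close>

definition Q :: "nat \<Rightarrow> 'a set \<Rightarrow> real" where
  "Q n A = (LINT x:A|\<P>. D n x)"

abbreviation "consts_fun \<equiv> range (\<lambda>(c::real) (x::'a). c)"

lemma D_0: "D 0 x = 1" and D_Suc: "D (Suc n) x = D n x * (1 + \<phi> (Suc n) x)"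
  by (simp_all add: D_def)

lemma factor_bounds: "1 - \<delta> \<le> 1 + \<phi> n x" "1 + \<phi> n x \<le> 1 + \<delta>" "0 < 1 + \<phi> n x"
  using \<phi>_le[of n x] \<delta> by (auto simp: abs_le_iff)

lemma \<phi>_piecewise: "\<phi> n \<in> piecewise_space consts_fun (F (n + L))"
  using \<phi>_const[of _ n] unfolding piecewise_space_def by fast

lemma D_piecewise: "D n \<in> piecewise_space consts_fun (F (n + L))"
proof (induction n)
  case 0
  then show ?case by (auto simp: piecewise_space_def D_0)
next
  case (Suc n)
  have "D n \<in> piecewise_space consts_fun (F (Suc n + L))" by (rule piecewise_refine[OF Suc]) simp
  then have "(\<lambda>x. D n x * (1 + \<phi> (Suc n) x)) \<in> piecewise_space consts_fun (F (Suc n + L))"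
    by (rule piecewise_combine[OF _ \<phi>_piecewise]) auto
  then show ?case by (simp add: D_Suc[abs_def])
qed

lemma integrable_mult_D:
  assumes "u \<in> piecewise_space S2 (F n)"
  shows "integrable \<P> (\<lambda>x. u x * D m x)"
proof -
  let ?N = "max n (m + L)"
  have "(\<lambda>x. u x * D m x) \<in> piecewise_space S2 (F ?N)"
  proof (rule piecewise_combine[OF piecewise_refine[OF assms] piecewise_refine[OF D_piecewise]])
    fix a b assume "a \<in> S2" "b \<in> consts_fun"
    then show "(\<lambda>x. a x * b x) \<in> S2" using fun_subspaceD(2)[OF subspace_S2, of a] by (auto simp: mult.commute)
  qed auto
  then show ?thesis by (rule integrable_P)
qed

lemma one_S2: "(\<lambda>_. 1) \<in> S2"
  by (rule S_subset_S2[OF S_space(3)])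

lemma integrable_D: "integrable \<P> (D m)"
  using integrable_mult_D[OF const_piecewise[OF one_S2]] by simp

text \<open>Inactive factors are 1, so only the active ones have to be old enough to be constant on
  \<open>A\<close>.\<close>

lemma prod_const_on_atom:
  assumes A: "A \<in> At n" and J: "\<And>k. k \<in> J \<Longrightarrow> k \<in> act \<Longrightarrow> k + L \<le> n"
  obtains d where "d > 0" "\<And>x. x \<in> A \<Longrightarrow> (\<Prod>k\<in>J. 1 + \<phi> k x) = d"
proof -
  obtain a where a: "a \<in> A" using At_nonempty[OF A] by blast
  have const: "\<phi> k x = \<phi> k a" if k: "k \<in> J" and x: "x \<in> A" for k x
  proof (cases "k \<in> act")
    case True
    have "\<phi> k \<in> piecewise_space consts_fun (F n)" by (rule piecewise_refine[OF \<phi>_piecewise J[OF k True]])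
    then show ?thesis using A a x by (auto simp: piecewise_space_def)
  qed (simp add: \<phi>_inactive)
  show thesis
  proof (rule that)
    show "(\<Prod>k\<in>J. 1 + \<phi> k a) > 0" by (intro prod_pos ballI factor_bounds)
    show "(\<Prod>k\<in>J. 1 + \<phi> k x) = (\<Prod>k\<in>J. 1 + \<phi> k a)" if "x \<in> A" for x
      using const[OF _ that] by simp
  qed
qed

lemma D_const_before_active:
  assumes "A \<in> At n" "Suc n \<in> act"
  obtains d where "d > 0" "\<And>x. x \<in> A \<Longrightarrow> D n x = d"
proof (rule prod_const_on_atom[OF assms(1)])
  show "k + L \<le> n" if "k \<in> {1..n}" "k \<in> act" for k
    using sparse[OF that(2) assms(2)] that(1) by simp
qed (use that in \<open>auto simp: D_def\<close>)

text \<open>At an active step the earlier density is a constant on \<open>A\<close> and factors out,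
  which leaves the orthogonality of the new factor to \<open>S2\<close>.\<close>

lemma D_step:
  assumes A: "A \<in> At n" and u: "u \<in> S2"
  shows "(LINT x:A|\<P>. u x * D (Suc n) x) = (LINT x:A|\<P>. u x * D n x)"
proof (cases "Suc n \<in> act")
  case True
  obtain d where d: "\<And>x. x \<in> A \<Longrightarrow> D n x = d" using D_const_before_active[OF A True] by blast
  have i: "integrable \<P> (\<lambda>x. u x * D n x)" "integrable \<P> (\<lambda>x. u x * D (Suc n) x)"
    by (rule integrable_mult_D[OF const_piecewise[OF u]])+
  have "(LINT x:A|\<P>. u x * D (Suc n) x) - (LINT x:A|\<P>. u x * D n x) = (LINT x:A|\<P>. u x * D (Suc n) x - u x * D n x)"
    using i A by (subst set_integral_diff(2)) (auto intro!: set_integrable_P)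
  also have "\<dots> = (LINT x:A|\<P>. d * (u x * \<phi> (Suc n) x))"
    using At_sets[OF A] d by (intro set_lebesgue_integral_cong) (auto simp: D_Suc algebra_simps)
  also have "\<dots> = 0" using \<phi>_orth[OF True A u] by simp
  finally show ?thesis by simp
qed (simp add: D_Suc \<phi>_inactive)

lemma D_stable:
  assumes "A \<in> At n" "u \<in> S2" "n \<le> m"
  shows "(LINT x:A|\<P>. u x * D m x) = (LINT x:A|\<P>. u x * D n x)"
  using assms(3)
proof (induction m rule: dec_induct)
  case (step m)
  have i: "integrable \<P> (\<lambda>x. u x * D m x)" for m
    by (rule integrable_mult_D[OF const_piecewise[OF assms(2)]])
  have "(LINT x:A|\<P>. u x * D (Suc m) x) = (\<Sum>B\<in>sub m A. LINT x:B|\<P>. u x * D (Suc m) x)"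
    by (rule set_integral_sub[OF refl i assms(1) step(1)])
  also have "\<dots> = (\<Sum>B\<in>sub m A. LINT x:B|\<P>. u x * D m x)"
    by (intro sum.cong refl D_step assms) (simp add: sub_def)
  also have "\<dots> = (LINT x:A|\<P>. u x * D m x)"
    by (rule set_integral_sub[symmetric, OF refl i assms(1) step(1)])
  finally show ?case using step by simp
qed simp

text \<open>Active steps are more than \<open>L\<close> apart, so at most one factor, the one of
  step \<open>Suc n\<close> or a recent one, varies on \<open>A\<close>; \<open>d\<close> is the
  product of all others. The same \<open>d\<close> has to serve levels \<open>n\<close> and
  \<open>Suc n\<close>, because it must cancel in the ratio of masses.\<close>

lemma D_sandwich:
  assumes A: "A \<in> At n"
  obtains d where "d > 0"
    "\<And>x. x \<in> A \<Longrightarrow> d * (1 - \<delta>) \<le> D n x \<and> D n x \<le> d * (1 + \<delta>)"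
    "\<And>x. x \<in> A \<Longrightarrow> d * (1 - \<delta>) \<le> D (Suc n) x \<and> D (Suc n) x \<le> d * (1 + \<delta>)"
proof -
  have bounds: "d * (1 - \<delta>) \<le> d * (1 + \<phi> k x) \<and> d * (1 + \<phi> k x) \<le> d * (1 + \<delta>)"
    "d * (1 - \<delta>) \<le> d \<and> d \<le> d * (1 + \<delta>)" if "d > 0" for d k x
    using mult_left_mono[OF factor_bounds(1)[of k x] less_imp_le[OF that]] mult_left_mono[OF factor_bounds(2)[of k x] less_imp_le[OF that]]
      mult_nonneg_nonneg[OF less_imp_le[OF that] \<delta>(1)] by (auto simp: algebra_simps)
  consider (active) "Suc n \<in> act" | (recent) k where "Suc n \<notin> act" "k \<in> {1..n}" "k \<in> act" "n < k + L"
    | (old) "Suc n \<notin> act" "\<And>k. k \<in> {1..n} \<Longrightarrow> k \<in> act \<Longrightarrow> k + L \<le> n"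
    by (meson not_le)
  then show thesis
  proof cases
    case active
    obtain d where d: "d > 0" "\<And>x. x \<in> A \<Longrightarrow> D n x = d" using D_const_before_active[OF A active] by blast
    show thesis using bounds[OF d(1)] d(2) by (intro that[OF d(1)]) (auto simp: D_Suc)
  next
    case recent
    obtain d where d: "d > 0" "\<And>x. x \<in> A \<Longrightarrow> (\<Prod>j\<in>{1..n} - {k}. 1 + \<phi> j x) = d"
    proof (rule prod_const_on_atom[OF A])
      show "j + L \<le> n" if "j \<in> {1..n} - {k}" "j \<in> act" for j
        using sparse[OF that(2) recent(3)] sparse[OF recent(3) that(2)] that(1) recent(2,4)
        by (cases "j < k") auto
    qed auto
    have "D n x = d * (1 + \<phi> k x)" if "x \<in> A" for x
      using d(2)[OF that] recent(2) by (simp add: D_def prod.remove[of _ k] mult.commute)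
    then show thesis using bounds[OF d(1)] recent(1) by (intro that[OF d(1)]) (auto simp: D_Suc \<phi>_inactive)
  next
    case old
    obtain d where d: "d > 0" "\<And>x. x \<in> A \<Longrightarrow> D n x = d"
      using prod_const_on_atom[OF A old(2)] unfolding D_def by blast
    show thesis using bounds[OF d(1)] d(2) old(1) by (intro that[OF d(1)]) (auto simp: D_Suc \<phi>_inactive)
  qed
qed

section \<open>Masses of atoms under the product densities\<close>

lemma Q_stable: "A \<in> At n \<Longrightarrow> n \<le> m \<Longrightarrow> (LINT x:A|\<P>. D m x) = Q n A"
  using D_stable[OF _ one_S2, of A n m] by (simp add: Q_def)

lemma Q_0: "Q 0 \<Omega> = 1"
proof -
  have "\<Omega> \<in> sets \<P>" using At_sets[of \<Omega> 0] At_0 by simp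
  then show ?thesis using P.prob_space by (simp add: Q_def D_0 set_integral_const P.emeasure_eq_measure)
qed

lemma Q_add: "A \<in> At n \<Longrightarrow> Q n A = (\<Sum>B\<in>sub (Suc n) A. Q (Suc n) B)"
  using set_integral_sub[OF refl integrable_D[of "Suc n"], of A n "Suc n"] Q_stable[of A n "Suc n"] by (simp add: Q_def)

lemma Q_sandwich:
  assumes A: "A \<in> At n"
  obtains d where "d > 0" "d * (1 - \<delta>) * v A \<le> Q n A" "Q n A \<le> d * (1 + \<delta>) * v A"
    "\<And>B. B \<in> sub (Suc n) A \<Longrightarrow> d * (1 - \<delta>) * v B \<le> Q (Suc n) B \<and> Q (Suc n) B \<le> d * (1 + \<delta>) * v B"
proof -
  obtain d where d: "d > 0"
    "\<And>x. x \<in> A \<Longrightarrow> d * (1 - \<delta>) \<le> D n x \<and> D n x \<le> d * (1 + \<delta>)"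
    "\<And>x. x \<in> A \<Longrightarrow> d * (1 - \<delta>) \<le> D (Suc n) x \<and> D (Suc n) x \<le> d * (1 + \<delta>)"
    using D_sandwich[OF A] by blast
  have gen: "a * v B \<le> (LINT x:B|\<P>. D k x) \<and> (LINT x:B|\<P>. D k x) \<le> b * v B"
    if B: "B \<in> sets \<P>" and ab: "\<And>x. x \<in> B \<Longrightarrow> a \<le> D k x \<and> D k x \<le> b" for a b B k
  proof
    show "(LINT x:B|\<P>. D k x) \<le> b * v B" using ab by (intro P.set_integral_le_const integrable_D B) blast
    have "(LINT x:B|\<P>. - D k x) \<le> - a * v B"
      using ab by (intro P.set_integral_le_const B) (auto simp: integrable_D)
    then show "a * v B \<le> (LINT x:B|\<P>. D k x)" by (simp add: set_lebesgue_integral_def)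
  qed
  show thesis
  proof (rule that[OF d(1)])
    show "d * (1 - \<delta>) * v A \<le> Q n A" "Q n A \<le> d * (1 + \<delta>) * v A"
      using gen[OF At_sets[OF A] d(2)] by (auto simp: Q_def)
    fix B assume B: "B \<in> sub (Suc n) A"
    then have "B \<in> sets \<P>" "B \<subseteq> A" using At_sets by (auto simp: sub_def)
    then show "d * (1 - \<delta>) * v B \<le> Q (Suc n) B \<and> Q (Suc n) B \<le> d * (1 + \<delta>) * v B"
      unfolding Q_def using d(3) by (intro gen) blast+
  qed
qed

text \<open>Bound for the distortion of mass ratios in one generation: the common constant
  \<open>d\<close> of \<open>Q_sandwich\<close> cancels, and only the extreme values of one factor
  remain.\<close>

definition "\<rho> = (1 - \<delta>) / (1 + \<delta>)"

lemma \<rho>: "0 < \<rho>" "exp (- (4 * \<delta>)) \<le> \<rho>"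
proof -
  show "0 < \<rho>" using \<delta> by (simp add: \<rho>_def)
  \<comment> \<open>Here \<open>\<delta> \<le> 1 / 2\<close> enters; it makes
    \<open>1 / \<rho>\<close> at most \<open>1 + 4 * \<delta>\<close>.\<close>
  have "1 + \<delta> \<le> (1 + 4 * \<delta>) * (1 - \<delta>)"
  proof -
    have "0 \<le> \<delta> * (2 - 4 * \<delta>)" using \<delta> by (intro mult_nonneg_nonneg) auto
    then show ?thesis by (simp add: algebra_simps)
  qed
  then have "1 / \<rho> \<le> 1 + 4 * \<delta>" using \<delta> by (simp add: \<rho>_def field_simps)
  also have "\<dots> \<le> exp (4 * \<delta>)" by (rule exp_ge_add_one_self)
  finally show "exp (- (4 * \<delta>)) \<le> \<rho>" using \<open>0 < \<rho>\<close> by (simp add: exp_minus field_simps)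
qed

lemma Q_pos: "A \<in> At n \<Longrightarrow> Q n A > 0"
proof -
  assume A: "A \<in> At n"
  obtain d where d: "d > 0" "d * (1 - \<delta>) * v A \<le> Q n A" using Q_sandwich[OF A] by blast
  have "0 < d * (1 - \<delta>) * v A" using d(1) \<delta> v_pos[OF A] by simp
  then show ?thesis using d(2) by linarith
qed

lemma Q_child_ratio:
  assumes A: "A \<in> At n" and B: "B \<in> At (Suc n)" "B \<subseteq> A"
  shows "\<rho> * (v B / v A) \<le> Q (Suc n) B / Q n A" "Q (Suc n) B / Q n A \<le> (v B / v A) / \<rho>"
proof -
  obtain d where d: "d > 0" "d * (1 - \<delta>) * v A \<le> Q n A" "Q n A \<le> d * (1 + \<delta>) * v A"
    and sub: "\<And>B. B \<in> sub (Suc n) A \<Longrightarrow> d * (1 - \<delta>) * v B \<le> Q (Suc n) B \<and> Q (Suc n) B \<le> d * (1 + \<delta>) * v B"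
    using Q_sandwich[OF A] by blast
  have dB: "d * (1 - \<delta>) * v B \<le> Q (Suc n) B" "Q (Suc n) B \<le> d * (1 + \<delta>) * v B"
    using sub[of B] B by (auto simp: sub_def)
  have pos: "v A > 0" "v B > 0" "Q n A > 0" "Q (Suc n) B > 0" "1 - \<delta> > 0" "1 + \<delta> > 0"
    using v_pos[OF A] v_pos[OF B(1)] Q_pos[OF A] Q_pos[OF B(1)] \<delta> by auto
  have "\<rho> * (v B / v A) = (d * (1 - \<delta>) * v B) / (d * (1 + \<delta>) * v A)" using d(1) by (simp add: \<rho>_def)
  also have "\<dots> \<le> Q (Suc n) B / Q n A" using d dB pos by (intro frac_le) auto
  finally show "\<rho> * (v B / v A) \<le> Q (Suc n) B / Q n A" .
  have "Q (Suc n) B / Q n A \<le> (d * (1 + \<delta>) * v B) / (d * (1 - \<delta>) * v A)" using d dB pos by (intro frac_le) auto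
  also have "\<dots> = (v B / v A) / \<rho>" using d(1) by (simp add: \<rho>_def mult_ac)
  finally show "Q (Suc n) B / Q n A \<le> (v B / v A) / \<rho>" .
qed

text \<open>The solution of \<open>(1 - r\<^sub>0) powr \<epsilon> = exp (- (4 * \<delta>))\<close>.
  Since a child has volume ratio \<open>r \<le> 1 - r\<^sub>0\<close>, this yields
  \<open>r powr \<epsilon> \<le> \<rho>\<close>, so the distortion of one generation fits into the
  exponent.\<close>

definition "\<epsilon> = 4 * \<delta> / ln (1 / (1 - r\<^sub>0))"

lemma ln_r0_pos: "ln (1 / (1 - r\<^sub>0)) > 0"
  using r0 by (intro ln_gt_zero) (simp add: field_simps)

text \<open>Powers with a fixed exponent are multiplicative along the chain from \<open>A\<close> to
  \<open>B\<close>, so nothing is lost as \<open>j\<close> grows.\<close>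

lemma Q_ratio_powr:
  assumes A: "A \<in> At n" and B: "B \<in> At (n + j)" "B \<subseteq> A"
  shows "(v B / v A) powr (1 + \<epsilon>) \<le> Q (n + j) B / Q n A \<and> Q (n + j) B / Q n A \<le> (v B / v A) powr (1 - \<epsilon>)"
  using B
proof (induction j arbitrary: B)
  case 0
  then have "B = A" using sub_self[OF A] by (auto simp: sub_def)
  then show ?case using v_pos[OF A] Q_pos[OF A] by simp
next
  case (Suc j)
  then obtain C where C: "C \<in> At (n + j)" "B \<subseteq> C" using At_parent[of B "n + j"] by auto
  have B: "B \<in> At (Suc (n + j))" using Suc.prems by simp
  have "A \<inter> C \<noteq> {}" using Suc.prems C At_nonempty[OF B] by blast
  then have "C \<subseteq> A" using At_nested[OF _ A C(1)] by simp
  note IH = Suc.IH[OF C(1) this]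
  have pos: "v A > 0" "v B > 0" "v C > 0" "Q n A > 0" "Q (n + j) C > 0" "Q (Suc (n + j)) B > 0"
    using v_pos Q_pos A B C(1) by auto
  define r where "r = v B / v C"
  have r: "0 < r" "r \<le> 1 - r\<^sub>0" using pos v_child(2)[OF C(1) B C(2)] by (auto simp: r_def field_simps)
  have "\<epsilon> \<ge> 0" using \<delta> ln_r0_pos by (simp add: \<epsilon>_def)
  then have "r powr \<epsilon> \<le> (1 - r\<^sub>0) powr \<epsilon>" using r by (intro powr_mono2) auto
  also have "\<dots> = exp (- (4 * \<delta>))"
    using r0 ln_r0_pos by (simp add: powr_def \<epsilon>_def ln_div)
  also have "\<dots> \<le> \<rho>" by (rule \<rho>)
  finally have r\<epsilon>: "r powr \<epsilon> \<le> \<rho>" .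
  have "r powr (1 + \<epsilon>) = r powr \<epsilon> * r" using r by (simp add: powr_add)
  also have "\<dots> \<le> \<rho> * r" using r\<epsilon> r by (intro mult_right_mono) auto
  finally have lo: "r powr (1 + \<epsilon>) \<le> Q (Suc (n + j)) B / Q (n + j) C"
    using Q_child_ratio(1)[OF C(1) B C(2)] by (simp add: r_def)
  have "r / \<rho> \<le> r / r powr \<epsilon>" using r\<epsilon> r \<rho>(1) by (intro divide_left_mono) auto
  also have "\<dots> = r powr (1 - \<epsilon>)" using r by (simp add: powr_diff)
  finally have up: "Q (Suc (n + j)) B / Q (n + j) C \<le> r powr (1 - \<epsilon>)"
    using Q_child_ratio(2)[OF C(1) B C(2)] by (simp add: r_def)
  have eq: "v B / v A = (v C / v A) * r" "Q (n + Suc j) B / Q n A = (Q (n + j) C / Q n A) * (Q (Suc (n + j)) B / Q (n + j) C)"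
    using pos by (auto simp: r_def)
  have powr: "(v C / v A * r) powr s = (v C / v A) powr s * r powr s" for s
    by (rule powr_mult)
  show ?case unfolding eq powr using IH lo up pos by (intro conjI mult_mono) auto
qed

text \<open>Supplies the weight \<open>\<eta>\<close> of the inner descendant, uniformly in the
  atom, for \<open>measure_of_weights\<close>.\<close>

lemma Q_descendant:
  assumes A: "A \<in> At n" and B: "B \<in> At (n + j)" "B \<subseteq> A"
  shows "Q (n + j) B \<ge> (\<rho> * r\<^sub>0) ^ j * Q n A"
  using B
proof (induction j arbitrary: B)
  case 0
  then have "B = A" using sub_self[OF A] by (auto simp: sub_def)
  then show ?case by simp
next
  case (Suc j)
  then obtain C where C: "C \<in> At (n + j)" "B \<subseteq> C" using At_parent[of B "n + j"] by auto
  have B: "B \<in> At (Suc (n + j))" using Suc.prems by simp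
  have "A \<inter> C \<noteq> {}" using Suc.prems C At_nonempty[OF B] by blast
  then have "C \<subseteq> A" using At_nested[OF _ A C(1)] by simp
  note IH = Suc.IH[OF C(1) this]
  have "r\<^sub>0 \<le> v B / v C" using v_child(1)[OF C(1) B C(2)] v_pos[OF C(1)] by (simp add: field_simps)
  then have "\<rho> * r\<^sub>0 \<le> Q (Suc (n + j)) B / Q (n + j) C"
    using Q_child_ratio(1)[OF C(1) B C(2)] \<rho>(1) by (meson less_imp_le mult_left_mono order_trans)
  then have "(\<rho> * r\<^sub>0) * Q (n + j) C \<le> Q (Suc (n + j)) B" using Q_pos[OF C(1)] by (simp add: field_simps)
  moreover have "(\<rho> * r\<^sub>0) * ((\<rho> * r\<^sub>0) ^ j * Q n A) \<le> (\<rho> * r\<^sub>0) * Q (n + j) C"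
    using IH \<rho>(1) r0 by (intro mult_left_mono) auto
  ultimately show ?case by (simp add: mult_ac)
qed

lemma corrected_measure:
  "\<exists>\<mu>. prob_space \<mu> \<and> sets \<mu> = sets (restrict_space borel \<Omega>) \<and> (\<forall>n. \<forall>A\<in>At n. measure \<mu> A = Q n A) \<and>
     (\<forall>n. \<forall>A\<in>At n. \<forall>q\<in>S. (LINT x:A|\<mu>. h (Suc n) x * q x) = 0)"
proof -
  obtain k where k: "\<And>n A. A \<in> At n \<Longrightarrow> \<exists>B\<in>At (n + k). closure B \<subseteq> A" using inner_descendant by blast
  have "\<exists>\<mu>. prob_space \<mu> \<and> sets \<mu> = sets (restrict_space borel \<Omega>) \<and> (\<forall>n. \<forall>A\<in>At n. measure \<mu> A = Q n A)"
  proof (rule measure_of_weights[where k = k and \<eta> = "(\<rho> * r\<^sub>0) ^ k"])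
    show "binary_partitions \<Omega> At" by unfold_locales
    show "compact \<Omega>" by (rule Omega)
    show "\<exists>n. \<forall>A\<in>At n. diameter A < e" if "e > 0" for e using mesh'[OF that] by blast
    show "0 < (\<rho> * r\<^sub>0) ^ k" using \<rho> r0 by simp
    show "\<exists>B\<in>At (n + k). closure B \<subseteq> A \<and> (\<rho> * r\<^sub>0) ^ k * Q n A \<le> Q (n + k) B" if A: "A \<in> At n" for n A
    proof -
      obtain B where B: "B \<in> At (n + k)" "closure B \<subseteq> A" using k[OF A] by blast
      then show ?thesis using Q_descendant[OF A B(1)] closure_subset[of B] by blast
    qed
  qed (use At_borel Q_0 Q_pos Q_add in auto)
  then obtain \<mu> where \<mu>: "prob_space \<mu>" "sets \<mu> = sets (restrict_space borel \<Omega>)" "\<And>n A. A \<in> At n \<Longrightarrow> measure \<mu> A = Q n A"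
    by blast
  interpret M: prob_space \<mu> by (rule \<mu>(1))
  have sets: "sets \<mu> = sets \<P>" using \<mu>(2) sets_P by simp
  note int_\<mu> = integrable_piecewise[OF M.finite_measure_axioms sets]
  \<comment> \<open>Weak convergence by hand: on an atom \<open>B\<close> of small diameter both
    integrals differ from \<open>u y * Q N B\<close> by at most \<open>e / 2 * Q N B\<close>, since
    \<open>u\<close> is uniformly continuous and \<open>\<mu>\<close> and the density
    \<open>D N\<close> give \<open>B\<close> the same mass. Then \<open>D_stable\<close> returns
    from level \<open>N\<close> to level \<open>n\<close>.\<close>
  have main: "(LINT x:A|\<mu>. u x) = (LINT x:A|\<P>. u x * D n x)" if A: "A \<in> At n" and u: "u \<in> S2" for n A u
  proof -
    have iu: "integrable \<mu> u" by (rule integrable_S2[OF M.finite_measure_axioms sets u])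
    have iD: "integrable \<P> (\<lambda>x. u x * D N x)" for N by (rule integrable_mult_D[OF const_piecewise[OF u]])
    have le: "\<bar>(LINT x:A|\<mu>. u x) - (LINT x:A|\<P>. u x * D n x)\<bar> \<le> e" if "e > 0" for e
    proof -
      have cont: "continuous_on UNIV u"
        using continuous_on_polymonial_function real_polynomial_function_eq S2_polynomial[OF u] by blast
      then have "uniformly_continuous_on \<Omega> u"
        using compact_uniformly_continuous[OF _ Omega(1)] continuous_on_subset by blast
      then obtain s where s: "s > 0" "\<And>x y. x \<in> \<Omega> \<Longrightarrow> y \<in> \<Omega> \<Longrightarrow> dist x y < s \<Longrightarrow> dist (u x) (u y) < e / 2"
        unfolding uniformly_continuous_on_def using \<open>e > 0\<close> by (metis half_gt_zero)
      obtain N' where N': "\<And>N A. N \<ge> N' \<Longrightarrow> A \<in> At N \<Longrightarrow> diameter A < s" using mesh'[OF s(1)] by blast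
      define N where "N = max n N'"
      have close: "\<bar>(LINT x:B|\<mu>. u x) - (LINT x:B|\<P>. u x * D N x)\<bar> \<le> e * Q N B" if "B \<in> sub N A" for B
      proof -
        have B: "B \<in> At N" "diameter B < s" using that N'[of N B] by (auto simp: sub_def N_def)
        obtain y where y: "y \<in> B" using At_nonempty[OF B(1)] by blast
        have osc: "u x \<le> u y + e / 2" "u y - e / 2 \<le> u x" if "x \<in> B" for x
        proof -
          have "dist x y < s" using diameter_bounded_bound[OF bounded_At[OF B(1)] that y] B(2) by simp
          then have "dist (u x) (u y) < e / 2" using s(2) At_subset[OF B(1)] that y by blast
          then show "u x \<le> u y + e / 2" "u y - e / 2 \<le> u x" unfolding dist_real_def by linarith+
        qed
        have Bm: "B \<in> sets \<mu>" using At_sets[OF B(1)] sets by simp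
        have D0: "D N x \<ge> 0" for x unfolding D_def by (intro prod_nonneg ballI less_imp_le factor_bounds)
        have "(LINT x:B|\<mu>. u x) \<le> (u y + e / 2) * Q N B"
          using M.set_integral_le_const[OF iu Bm, of "u y + e / 2"] osc \<mu>(3)[OF B(1)] by simp
        moreover have "(LINT x:B|\<mu>. - u x) \<le> (- u y + e / 2) * Q N B"
          using M.set_integral_le_const[of "\<lambda>x. - u x", OF _ Bm, of "- u y + e / 2"] iu osc \<mu>(3)[OF B(1)] by fastforce
        then have "(u y - e / 2) * Q N B \<le> (LINT x:B|\<mu>. u x)"
          by (simp add: set_lebesgue_integral_def algebra_simps)
        moreover have intc: "(LINT x:B|\<P>. c * D N x) = c * Q N B" for c by (simp add: Q_def)
        have "(LINT x:B|\<P>. u x * D N x) \<le> (LINT x:B|\<P>. (u y + e / 2) * D N x)"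
          using osc D0 by (intro set_integral_mono_atom[OF B(1)] iD integrable_mult_right integrable_D mult_right_mono)
        moreover have "(LINT x:B|\<P>. (u y - e / 2) * D N x) \<le> (LINT x:B|\<P>. u x * D N x)"
          using osc D0 by (intro set_integral_mono_atom[OF B(1)] iD integrable_mult_right integrable_D mult_right_mono)
        ultimately show ?thesis unfolding intc abs_le_iff by (simp add: algebra_simps)
      qed
      have "(LINT x:A|\<mu>. u x) = (\<Sum>B\<in>sub N A. LINT x:B|\<mu>. u x)"
        by (rule set_integral_sub[OF sets iu A]) (simp add: N_def)
      moreover have "(LINT x:A|\<P>. u x * D N x) = (\<Sum>B\<in>sub N A. LINT x:B|\<P>. u x * D N x)"
        by (rule set_integral_sub[OF refl iD A]) (simp add: N_def)
      moreover have "(LINT x:A|\<P>. u x * D N x) = (LINT x:A|\<P>. u x * D n x)"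
        by (rule D_stable[OF A u]) (simp add: N_def)
      ultimately have "\<bar>(LINT x:A|\<mu>. u x) - (LINT x:A|\<P>. u x * D n x)\<bar>
          = \<bar>\<Sum>B\<in>sub N A. (LINT x:B|\<mu>. u x) - (LINT x:B|\<P>. u x * D N x)\<bar>" by (simp add: sum_subtractf)
      also have "\<dots> \<le> (\<Sum>B\<in>sub N A. \<bar>(LINT x:B|\<mu>. u x) - (LINT x:B|\<P>. u x * D N x)\<bar>)" by (rule sum_abs)
      also have "\<dots> \<le> (\<Sum>B\<in>sub N A. e * Q N B)" by (intro sum_mono close)
      also have "\<dots> = e * measure \<mu> A"
      proof -
        have "(\<Sum>B\<in>sub N A. Q N B) = (LINT x:A|\<P>. D N x)"
          unfolding Q_def by (rule set_integral_sub[symmetric, OF refl integrable_D A]) (simp add: N_def)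
        also have "\<dots> = measure \<mu> A" using Q_stable[OF A] \<mu>(3)[OF A] by (simp add: N_def)
        finally show ?thesis by (simp add: sum_distrib_left[symmetric])
      qed
      also have "\<dots> \<le> e" using M.prob_le_1[of A] \<open>e > 0\<close> by (simp add: mult_left_le)
      finally show ?thesis .
    qed
    have "\<bar>(LINT x:A|\<mu>. u x) - (LINT x:A|\<P>. u x * D n x)\<bar> \<le> 0"
      by (rule field_le_epsilon) (use le in simp)
    then show ?thesis by simp
  qed
  have "(LINT x:A|\<mu>. h (Suc n) x * q x) = 0" if A: "A \<in> At n" and q: "q \<in> S" for n A q
  proof (cases "Suc n \<in> act")
    case False
    have "(LINT x:A|\<mu>. h (Suc n) x * q x) = (LINT x:A|\<mu>. 0)"
      using h_inactive[OF False] At_subset[OF A] At_sets[OF A] sets by (intro set_lebesgue_integral_cong) auto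
    then show ?thesis by simp
  next
    case True
    \<comment> \<open>The product is in \<open>S2\<close> on the children of \<open>A\<close> only,
      so \<open>main\<close> is used at level \<open>Suc n\<close>, where the density already
      contains the correcting factor.\<close>
    have hq: "(\<lambda>x. h (Suc n) x * q x) \<in> piecewise_space S2 (F (Suc n))"
      by (rule piecewise_mult[OF h_piecewise const_piecewise[OF q]])
    obtain d where d: "\<And>x. x \<in> A \<Longrightarrow> D n x = d" using D_const_before_active[OF A True] by blast
    have "(LINT x:A|\<mu>. h (Suc n) x * q x) = (\<Sum>B\<in>sub (Suc n) A. LINT x:B|\<mu>. h (Suc n) x * q x)"
      by (rule set_integral_sub[OF sets int_\<mu>[OF hq] A]) simp
    also have "\<dots> = (\<Sum>B\<in>sub (Suc n) A. LINT x:B|\<P>. h (Suc n) x * q x * D (Suc n) x)"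
    proof (rule sum.cong[OF refl])
      fix B assume "B \<in> sub (Suc n) A"
      then have B: "B \<in> At (Suc n)" by (simp add: sub_def)
      then obtain u where u: "u \<in> S2" "\<And>x. x \<in> B \<Longrightarrow> h (Suc n) x * q x = u x"
        using hq unfolding piecewise_space_def by blast
      have "(LINT x:B|\<mu>. h (Suc n) x * q x) = (LINT x:B|\<mu>. u x)"
        using u(2) At_sets[OF B] sets by (intro set_lebesgue_integral_cong) auto
      also have "\<dots> = (LINT x:B|\<P>. u x * D (Suc n) x)" by (rule main[OF B u(1)])
      also have "\<dots> = (LINT x:B|\<P>. h (Suc n) x * q x * D (Suc n) x)"
        using u(2) At_sets[OF B] by (intro set_lebesgue_integral_cong) auto
      finally show "(LINT x:B|\<mu>. h (Suc n) x * q x) = (LINT x:B|\<P>. h (Suc n) x * q x * D (Suc n) x)" .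
    qed
    also have "\<dots> = (LINT x:A|\<P>. h (Suc n) x * q x * D (Suc n) x)"
      by (rule set_integral_sub[symmetric, OF refl integrable_mult_D[OF hq] A]) simp
    also have "\<dots> = (LINT x:A|\<P>. d * (h (Suc n) x * q x * (1 + \<phi> (Suc n) x)))"
      using d At_sets[OF A] by (intro set_lebesgue_integral_cong) (auto simp: D_Suc)
    also have "\<dots> = 0" using h_orth[OF True A q] by simp
    finally show ?thesis .
  qed
  then show ?thesis using \<mu> by blast
qed

end

section \<open>Perturbation of smartingales\<close>

context fat_filtration
begin

lemma cond_exp_integral_le:
  assumes "integrable \<P> f" "integrable \<P> g" and A: "A \<in> At n"
    and le: "\<And>x. x \<in> A \<Longrightarrow> real_cond_exp \<P> (F n) f x \<le> \<kappa> * real_cond_exp \<P> (F n) g x"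
  shows "(LINT x:A|\<P>. f x) \<le> \<kappa> * (LINT x:A|\<P>. g x)"
proof -
  interpret finite_measure_subalgebra \<P> "F n"
    by (intro finite_measure_subalgebra.intro finite_measure_subalgebra_axioms.intro P.finite_measure_axioms subalgebra_F)
  have "(LINT x:A|\<P>. f x) = (LINT x:A|\<P>. real_cond_exp \<P> (F n) f x)"
    by (rule real_cond_exp_intA[OF assms(1) At_sets_F[OF A]])
  also have "\<dots> \<le> (LINT x:A|\<P>. \<kappa> * real_cond_exp \<P> (F n) g x)"
    by (intro set_integral_mono_atom[OF A] integrable_mult_right real_cond_exp_int(1) assms le)
  also have "\<dots> = \<kappa> * (LINT x:A|\<P>. g x)"
    using real_cond_exp_intA[OF assms(2) At_sets_F[OF A]] by simp
  finally show ?thesis .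
qed

definition atom_of :: "nat \<Rightarrow> 'a \<Rightarrow> 'a set" where
  "atom_of n x = (SOME A. A \<in> At n \<and> x \<in> A)"

lemma atom_of_eq: "A \<in> At n \<Longrightarrow> x \<in> A \<Longrightarrow> atom_of n x = A"
  unfolding atom_of_def using At_disjoint by (intro some_equality) blast+

lemma atom_of: "x \<in> \<Omega> \<Longrightarrow> atom_of n x \<in> At n \<and> x \<in> atom_of n x"
  using At_cover[of n] atom_of_eq by blast

lemma smartingale_piecewise: "smartingale S F M f \<Longrightarrow> f n \<in> piecewise_space S (F n)"
  unfolding smartingale_def is_projection_def by (metis diff_Suc_1 le_add1 plus_1_eq_Suc)

text \<open>The test function \<open>g\<close>, cut off outside \<open>A\<close>, is again piecewise
  in \<open>S\<close>, so the global projection property localises to each atom.\<close>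

lemma smartingale_orthogonal:
  assumes "smartingale S F \<P> f" "A \<in> At n" "g \<in> S"
  shows "(LINT x:A|\<P>. increment f (Suc n) x * g x) = 0"
proof -
  define u where "u x = (if x \<in> A then g x else 0)" for x
  have "\<exists>q\<in>S. \<forall>x\<in>B. u x = q x" if B: "B \<in> At n" for B
  proof (cases "B = A")
    case False
    then have "\<forall>x\<in>B. u x = 0" using At_disjoint[OF B assms(2)] by (auto simp: u_def)
    then show ?thesis using fun_subspaceD(1)[OF S_space(1)] by (intro bexI[of _ "\<lambda>x. 0"]) auto
  qed (use assms(3) in \<open>auto simp: u_def\<close>)
  then have "u \<in> piecewise_space S (F n)" by (simp add: piecewise_space_def)
  moreover have "is_projection \<P> (piecewise_space S (F (Suc n - 1))) (f (Suc n)) (f (Suc n - 1))"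
    using assms(1) unfolding smartingale_def by (metis le_add1 plus_1_eq_Suc)
  ultimately have "(LINT x|\<P>. (f (Suc n) x - f n x) * u x) = 0" by (simp add: is_projection_def)
  moreover have "(f (Suc n) x - f n x) * u x = indicator A x *\<^sub>R (increment f (Suc n) x * g x)" for x
    by (simp add: u_def increment_def indicator_def)
  ultimately show ?thesis by (simp add: set_lebesgue_integral_def)
qed

lemma piecewise_S_add:
  assumes "f \<in> piecewise_space S (F n)" "g \<in> piecewise_space S (F n)"
  shows "(\<lambda>x. f x + g x) \<in> piecewise_space S (F n)"
  by (rule piecewise_combine[OF assms]) (rule fun_subspaceD(3)[OF S_space(1)])

text \<open>Vanishing almost everywhere for Lebesgue measure would not suffice, since
  \<open>f\<close> is later integrated against another measure. The sup bound for polynomials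
  upgrades it to vanishing at every point of the atom.\<close>

lemma piecewise_integral_zero:
  assumes "f \<in> piecewise_space S (F n)" "A \<in> At n" "\<And>x. x \<in> A \<Longrightarrow> f x \<ge> 0" "(LINT x:A|\<P>. f x) \<le> 0" "x \<in> A"
  shows "f x = 0"
proof -
  obtain g where g: "g \<in> S" "\<And>x. x \<in> A \<Longrightarrow> f x = g x" using assms(1,2) unfolding piecewise_space_def by blast
  obtain C where C: "C > 0" "\<bar>g x\<bar> * v A \<le> C * (LINT y:A|\<P>. \<bar>g y\<bar>)"
    using sup_bound[of 1] assms(2,5) g(1) At_sets S_subset_S2 by (metis mult_1 order_refl zero_less_one)
  have "(LINT y:A|\<P>. \<bar>g y\<bar>) = (LINT y:A|\<P>. f y)"
    using g(2) assms(3) At_sets[OF assms(2)] by (intro set_lebesgue_integral_cong) auto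
  then have "\<bar>g x\<bar> * v A \<le> 0" using C assms(4) by (metis mult_nonneg_nonpos less_imp_le order_trans)
  then show ?thesis using v_pos[OF assms(2)] g(2)[OF assms(5)] by (simp add: mult_le_0_iff)
qed

lemma smartingale_perturbation:
  assumes nr: "norm_recovery \<Omega> F S L" and \<kappa>: "\<kappa> \<ge> 1"
  shows "\<exists>lam\<^sub>0>0. \<exists>c>0. \<forall>(f :: nat \<Rightarrow> 'a \<Rightarrow> real) (p :: nat \<Rightarrow> 'a \<Rightarrow> real) lam.
      smartingale S F \<P> f \<and> nu_sparse \<Omega> L f \<and>
      (\<forall>n\<ge>1. p n \<in> piecewise_space S (F n) \<and>
        (\<forall>x\<in>\<Omega>. p n x \<ge> 0 \<and>
          inverse \<kappa> * real_cond_exp \<P> (F n) (\<lambda>y. \<bar>increment f n y\<bar>) x \<le> real_cond_exp \<P> (F n) (p n) x \<and>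
          real_cond_exp \<P> (F n) (p n) x \<le> \<kappa> * real_cond_exp \<P> (F n) (\<lambda>y. \<bar>increment f n y\<bar>) x)) \<and>
      0 < lam \<and> lam \<le> lam\<^sub>0 \<longrightarrow>
      (\<exists>\<mu> :: 'a measure. prob_space \<mu> \<and> sets \<mu> = sets (restrict_space borel \<Omega>) \<and>
        smartingale S F \<mu> (perturbed f p lam) \<and>
        (\<forall>A\<in>(\<Union>n. At n). \<forall>B\<in>(\<Union>n. At n). B \<subseteq> A \<longrightarrow>
          (vol \<Omega> B / vol \<Omega> A) powr (1 + c * lam) \<le> measure \<mu> B / measure \<mu> A \<and>
          measure \<mu> B / measure \<mu> A \<le> (vol \<Omega> B / vol \<Omega> A) powr (1 - c * lam)))"
proof -
  obtain K lam\<^sub>1 where K: "K > 0" "lam\<^sub>1 > 0"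
    "\<And>n A h p u q lam. \<lbrakk>A \<in> At n; h \<in> piecewise_space S (F (Suc n)); p \<in> piecewise_space S (F (Suc n));
       \<And>x. x \<in> A \<Longrightarrow> p x \<ge> 0; \<And>g. g \<in> S \<Longrightarrow> (LINT x:A|\<P>. h x * g x) = 0;
       (LINT x:A|\<P>. p x) \<le> \<kappa> * (LINT x:A|\<P>. \<bar>h x\<bar>); u \<in> S2; q \<in> S; 0 < lam; lam \<le> lam\<^sub>1\<rbrakk> \<Longrightarrow>
      \<bar>lam * (LINT x:A|\<P>. p x * q x)\<bar>
        \<le> K * lam * (\<Sum>B\<in>sub (Suc n + L) A. \<bar>LINT x:B|\<P>. u x + (h x - lam * p x) * q x\<bar>)"
    using key_estimate[OF nr \<kappa>] by blast
  \<comment> \<open>With \<open>\<delta> = K * lam\<close> the exponent \<open>\<epsilon>\<close> of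
    the product densities becomes \<open>c * lam\<close>.\<close>
  define c where "c = 4 * K / ln (1 / (1 - r\<^sub>0))"
  have ln0: "ln (1 / (1 - r\<^sub>0)) > 0" using r0 by (intro ln_gt_zero) (simp add: field_simps)
  \<comment> \<open>The second term keeps the size \<open>K * lam\<close> of the corrections at most
    \<open>1 / 2\<close>.\<close>
  define lam\<^sub>0 where "lam\<^sub>0 = min lam\<^sub>1 (1 / (2 * K))"
  have pos: "lam\<^sub>0 > 0" "c > 0" using K ln0 by (auto simp: lam\<^sub>0_def c_def)
  have main: "\<exists>\<mu> :: 'a measure. prob_space \<mu> \<and> sets \<mu> = sets (restrict_space borel \<Omega>) \<and>
        smartingale S F \<mu> (perturbed f p lam) \<and>
        (\<forall>A\<in>(\<Union>n. At n). \<forall>B\<in>(\<Union>n. At n). B \<subseteq> A \<longrightarrow>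
          (v B / v A) powr (1 + c * lam) \<le> measure \<mu> B / measure \<mu> A \<and>
          measure \<mu> B / measure \<mu> A \<le> (v B / v A) powr (1 - c * lam))"
    if f: "smartingale S F \<P> f" and sparse: "nu_sparse \<Omega> L f" and
      p: "\<And>n. p (Suc n) \<in> piecewise_space S (F (Suc n))" "\<And>n x. x \<in> \<Omega> \<Longrightarrow> p (Suc n) x \<ge> 0" and
      cond: "\<And>n x. x \<in> \<Omega> \<Longrightarrow> real_cond_exp \<P> (F (Suc n)) (p (Suc n)) x
          \<le> \<kappa> * real_cond_exp \<P> (F (Suc n)) (\<lambda>y. \<bar>increment f (Suc n) y\<bar>) x" and
      lam: "0 < lam" "lam \<le> lam\<^sub>0"
    for f p :: "nat \<Rightarrow> 'a \<Rightarrow> real" and lam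
  proof -
    have fS: "f n \<in> piecewise_space S (F n)" for n by (rule smartingale_piecewise[OF f])
    have inc: "increment f (Suc n) \<in> piecewise_space S (F (Suc n))" for n
      using piecewise_S_diff[OF fS[of "Suc n"] piecewise_refine[OF fS[of n]], of 1] by (simp add: increment_def)
    define h where "h n x = increment f n x - lam * p n x" for n x
    have h: "h (Suc n) \<in> piecewise_space S (F (Suc n))" for n
      using piecewise_S_diff[OF inc p(1)] by (simp add: h_def[abs_def])
    have p_int: "(LINT x:B|\<P>. p (Suc n) x) \<le> \<kappa> * (LINT x:B|\<P>. \<bar>increment f (Suc n) x\<bar>)" if B: "B \<in> At (Suc n)" for B n
      using At_subset[OF B] integrable_P[OF piecewise_S_S2[OF inc[of n]]] integrable_P[OF piecewise_S_S2[OF p(1)[of n]]]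
      by (intro cond_exp_integral_le[OF _ _ B] cond integrable_abs) auto
    \<comment> \<open>The hypothesis compares \<open>p\<close> with the increment on atoms of level
      \<open>Suc n\<close>, whereas the correction is made on their parents; summation over children
      bridges the gap.\<close>
    have p_int': "(LINT x:A|\<P>. p (Suc n) x) \<le> \<kappa> * (LINT x:A|\<P>. \<bar>increment f (Suc n) x\<bar>)" if A: "A \<in> At n" for A n
    proof -
      have "(LINT x:A|\<P>. p (Suc n) x) = (\<Sum>B\<in>sub (Suc n) A. LINT x:B|\<P>. p (Suc n) x)"
        by (rule set_integral_sub[OF refl integrable_P[OF piecewise_S_S2[OF p(1)]] A]) simp
      also have "\<dots> \<le> (\<Sum>B\<in>sub (Suc n) A. \<kappa> * (LINT x:B|\<P>. \<bar>increment f (Suc n) x\<bar>))"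
        by (intro sum_mono p_int) (simp add: sub_def)
      also have "\<dots> = \<kappa> * (LINT x:A|\<P>. \<bar>increment f (Suc n) x\<bar>)"
        unfolding sum_distrib_left[symmetric]
        using set_integral_sub[OF refl integrable_abs[OF integrable_P[OF piecewise_S_S2[OF inc]]] A, of "Suc n" n] by simp
      finally show ?thesis .
    qed
    define good where "good n A \<phi> \<longleftrightarrow> (\<forall>B. \<bar>\<phi> B\<bar> \<le> K * lam) \<and>
        (\<forall>u\<in>S2. (\<Sum>B\<in>sub (Suc n + L) A. \<phi> B * (LINT x:B|\<P>. u x)) = 0) \<and>
        (\<forall>q\<in>S. (\<Sum>B\<in>sub (Suc n + L) A. \<phi> B * (LINT x:B|\<P>. (increment f (Suc n) x - lam * p (Suc n) x) * q x))
          = lam * (LINT x:A|\<P>. p (Suc n) x * q x))" for n A and \<phi> :: "'a set \<Rightarrow> real"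
    have ex_good: "\<exists>\<phi>. good n A \<phi>" if A: "A \<in> At n" for n A
      unfolding good_def
    proof (rule correction_on_atom[OF A inc p(1)])
      fix u q assume "u \<in> S2" "q \<in> S"
      then show "\<bar>lam * (LINT x:A|\<P>. p (Suc n) x * q x)\<bar>
        \<le> K * lam * (\<Sum>B\<in>sub (Suc n + L) A. \<bar>LINT x:B|\<P>. u x + (increment f (Suc n) x - lam * p (Suc n) x) * q x\<bar>)"
        using lam p(2) At_subset[OF A]
        by (intro K(3)[OF A inc p(1)] p_int'[OF A] smartingale_orthogonal[OF f A]) (auto simp: lam\<^sub>0_def)
    qed (use K lam in auto)
    define \<Phi> where "\<Phi> n A = (SOME \<phi>. good n A \<phi>)" for n A
    have good: "good n A (\<Phi> n A)" if "A \<in> At n" for n A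
      unfolding \<Phi>_def by (rule someI_ex[OF ex_good[OF that]])
    have \<Phi>: "\<bar>\<Phi> n A B\<bar> \<le> K * lam"
      "u \<in> S2 \<Longrightarrow> (\<Sum>B\<in>sub (Suc n + L) A. \<Phi> n A B * (LINT x:B|\<P>. u x)) = 0"
      "q \<in> S \<Longrightarrow> (\<Sum>B\<in>sub (Suc n + L) A. \<Phi> n A B * (LINT x:B|\<P>. h (Suc n) x * q x))
          = lam * (LINT x:A|\<P>. p (Suc n) x * q x)" if "A \<in> At n" for n A B u q
      using good[OF that] unfolding good_def h_def by blast+
    define act where "act = {n. n \<ge> 1 \<and> (\<exists>x\<in>\<Omega>. increment f n x \<noteq> 0)}"
    \<comment> \<open>Step \<open>n\<close> uses the atom of level \<open>n - 1\<close> to select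
      the coefficients and the atom of level \<open>n + L\<close> to read off one of them. The value
      0 off \<open>\<Omega>\<close> keeps the size bound valid everywhere.\<close>
    define \<phi> where "\<phi> n x = (if n \<in> act \<and> x \<in> \<Omega> then \<Phi> (n - 1) (atom_of (n - 1) x) (atom_of (n + L) x) else 0)" for n x
    have \<phi>_eq: "\<phi> (Suc n) x = \<Phi> n A B" if "Suc n \<in> act" "A \<in> At n" "B \<in> sub (Suc n + L) A" "x \<in> B" for n A B x
      using that At_subset[OF that(2)] atom_of_eq[OF that(2), of x] atom_of_eq[of B "Suc n + L" x]
      by (auto simp: \<phi>_def sub_def)
    have \<phi>_const: "\<exists>c. \<forall>x\<in>B. \<phi> n x = c" if B: "B \<in> At (n + L)" for n B
    proof (cases "n \<in> act")
      case True
      then have "n \<ge> 1" by (simp add: act_def)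
      obtain y where y: "y \<in> B" using At_nonempty[OF B] by blast
      define A where "A = atom_of (n - 1) y"
      have A: "A \<in> At (n - 1)" "y \<in> A" using atom_of[of y] At_subset[OF B] y by (auto simp: A_def)
      have "B \<subseteq> A" by (rule At_nested[OF _ A(1) B]) (use A y in auto)
      then have "\<phi> n x = \<Phi> (n - 1) A B" if "x \<in> B" for x
        using \<phi>_eq[of "n - 1" A B x] True \<open>n \<ge> 1\<close> A(1) B that by (simp add: sub_def)
      then show ?thesis by blast
    qed (simp add: \<phi>_def)
    have split: "(LINT x:A|\<P>. u x * \<phi> (Suc n) x) = (\<Sum>B\<in>sub (Suc n + L) A. \<Phi> n A B * (LINT x:B|\<P>. u x))"
      and int_u\<phi>: "integrable \<P> (\<lambda>x. u x * \<phi> (Suc n) x)"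
      if act: "Suc n \<in> act" and A: "A \<in> At n" and u: "u \<in> piecewise_space S2 (F (Suc n))" for n A u
    proof -
      have \<phi>_pw: "\<phi> (Suc n) \<in> piecewise_space (range (\<lambda>(c::real) (x::'a). c)) (F (Suc n + L))"
        using \<phi>_const[of _ "Suc n"] unfolding piecewise_space_def by fast
      have "(\<lambda>x. u x * \<phi> (Suc n) x) \<in> piecewise_space S2 (F (Suc n + L))"
      proof (rule piecewise_combine[OF piecewise_refine[OF u] \<phi>_pw])
        fix a b assume "a \<in> S2" "b \<in> range (\<lambda>(c::real) (x::'a). c)"
        then show "(\<lambda>x. a x * b x) \<in> S2" using fun_subspaceD(2)[OF subspace_S2, of a] by (auto simp: mult.commute)
      qed simp
      then show i: "integrable \<P> (\<lambda>x. u x * \<phi> (Suc n) x)" by (rule integrable_P)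
      have "(LINT x:A|\<P>. u x * \<phi> (Suc n) x) = (\<Sum>B\<in>sub (Suc n + L) A. LINT x:B|\<P>. u x * \<phi> (Suc n) x)"
        by (rule set_integral_sub[OF refl i A]) simp
      also have "\<dots> = (\<Sum>B\<in>sub (Suc n + L) A. LINT x:B|\<P>. \<Phi> n A B * u x)"
        using \<phi>_eq[OF act A] At_sets by (intro sum.cong refl set_lebesgue_integral_cong) (auto simp: sub_def)
      finally show "(LINT x:A|\<P>. u x * \<phi> (Suc n) x) = (\<Sum>B\<in>sub (Suc n + L) A. \<Phi> n A B * (LINT x:B|\<P>. u x))" by simp
    qed
    \<comment> \<open>Where the increment vanishes, the upper comparison with
      \<open>\<kappa>\<close> forces \<open>p\<close> to vanish too, so an inactive step needs no
      correction.\<close>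
    have h_inactive: "h (Suc n) x = 0" if "Suc n \<notin> act" "x \<in> \<Omega>" for n x
    proof -
      have inc0: "increment f (Suc n) y = 0" if "y \<in> \<Omega>" for y using \<open>Suc n \<notin> act\<close> that by (auto simp: act_def)
      define B where "B = atom_of (Suc n) x"
      have B: "B \<in> At (Suc n)" "x \<in> B" using atom_of[OF that(2)] by (auto simp: B_def)
      have "(LINT y:B|\<P>. \<bar>increment f (Suc n) y\<bar>) = (LINT y:B|\<P>. 0)"
        using inc0 At_subset[OF B(1)] At_sets[OF B(1)] by (intro set_lebesgue_integral_cong) auto
      then have "(LINT y:B|\<P>. p (Suc n) y) \<le> 0" using p_int[OF B(1)] by simp
      then have "p (Suc n) x = 0"
        using p(2) At_subset[OF B(1)] by (intro piecewise_integral_zero[OF p(1) B(1) _ _ B(2)]) auto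
      then show ?thesis using inc0[OF that(2)] by (simp add: h_def)
    qed
    \<comment> \<open>The increment is orthogonal to \<open>q\<close>, so \<open>h q\<close> alone
      integrates to \<open>- lam\<close> times the integral of \<open>p q\<close>; the factor
      \<open>\<phi>\<close> was made to contribute exactly the opposite.\<close>
    have h_orth: "(LINT x:A|\<P>. h (Suc n) x * q x * (1 + \<phi> (Suc n) x)) = 0"
      if act: "Suc n \<in> act" and A: "A \<in> At n" and q: "q \<in> S" for n A q
    proof -
      have qp: "q \<in> piecewise_space S (F (Suc n))" by (rule const_piecewise[OF q])
      have hq: "(\<lambda>x. h (Suc n) x * q x) \<in> piecewise_space S2 (F (Suc n))" by (rule piecewise_mult[OF h qp])
      have int: "integrable \<P> (\<lambda>x. h (Suc n) x * q x)" "integrable \<P> (\<lambda>x. increment f (Suc n) x * q x)"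
        "integrable \<P> (\<lambda>x. p (Suc n) x * q x)"
        using integrable_P[OF hq] integrable_P[OF piecewise_mult[OF inc qp]] integrable_P[OF piecewise_mult[OF p(1) qp]] by auto
      have "(LINT x:A|\<P>. h (Suc n) x * q x * (1 + \<phi> (Suc n) x))
          = (LINT x:A|\<P>. h (Suc n) x * q x + h (Suc n) x * q x * \<phi> (Suc n) x)" by (simp add: distrib_left)
      also have "\<dots> = (LINT x:A|\<P>. h (Suc n) x * q x) + (LINT x:A|\<P>. h (Suc n) x * q x * \<phi> (Suc n) x)"
        by (intro set_integral_add set_integrable_P[OF _ A] int int_u\<phi>[OF act A hq])
      also have "(LINT x:A|\<P>. h (Suc n) x * q x * \<phi> (Suc n) x) = lam * (LINT x:A|\<P>. p (Suc n) x * q x)"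
        unfolding split[OF act A hq] by (rule \<Phi>(3)[OF A q])
      also have "(LINT x:A|\<P>. h (Suc n) x * q x) = (LINT x:A|\<P>. increment f (Suc n) x * q x - lam * (p (Suc n) x * q x))"
        by (simp add: h_def algebra_simps)
      also have "\<dots> = (LINT x:A|\<P>. increment f (Suc n) x * q x) - (LINT x:A|\<P>. lam * (p (Suc n) x * q x))"
        by (intro set_integral_diff(2) set_integrable_P[OF _ A] int integrable_mult_right)
      also have "(LINT x:A|\<P>. increment f (Suc n) x * q x) = 0" by (rule smartingale_orthogonal[OF f A q])
      finally show ?thesis by simp
    qed
    interpret D: sparse_densities \<Omega> F S c\<^sub>0 c\<^sub>4 L act \<phi> h "K * lam"
    proof
      show "0 \<le> K * lam" "K * lam \<le> 1 / 2" using K lam by (auto simp: lam\<^sub>0_def field_simps)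
      show "\<bar>\<phi> n x\<bar> \<le> K * lam" for n x
        using \<Phi>(1)[OF conjunct1[OF atom_of]] K(1) lam(1) by (auto simp: \<phi>_def)
      show "n + L < m" if "n \<in> act" "m \<in> act" "n < m" for n m
      proof -
        have "\<bar>int n - int m\<bar> \<ge> int L + 1" using sparse that unfolding nu_sparse_def act_def by blast
        then show ?thesis using that(3) by linarith
      qed
      show "(LINT x:A|\<P>. u x * \<phi> (Suc n) x) = 0" if "Suc n \<in> act" "A \<in> At n" "u \<in> S2" for n A u
        using split[OF that(1,2) const_piecewise[OF that(3)]] \<Phi>(2)[OF that(2,3)] by simp
    qed (use \<phi>_const h h_inactive h_orth in \<open>auto simp: \<phi>_def\<close>)
    obtain \<mu> where \<mu>: "prob_space \<mu>" "sets \<mu> = sets (restrict_space borel \<Omega>)" "\<And>n A. A \<in> At n \<Longrightarrow> measure \<mu> A = D.Q n A"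
      "\<And>n A q. A \<in> At n \<Longrightarrow> q \<in> S \<Longrightarrow> (LINT x:A|\<mu>. h (Suc n) x * q x) = 0"
      using D.corrected_measure by blast
    interpret M: prob_space \<mu> by (rule \<mu>(1))
    have sets: "sets \<mu> = sets \<P>" using \<mu>(2) sets_P by simp
    note int_\<mu> = integrable_piecewise[OF M.finite_measure_axioms sets]
    have space: "space \<mu> = \<Omega>" using sets_eq_imp_space_eq[OF sets] by simp
    have pert_Suc: "perturbed f p lam (Suc n) = (\<lambda>x. perturbed f p lam n x + h (Suc n) x)" for n
      by (simp add: h_def)
    have pert: "perturbed f p lam n \<in> piecewise_space S (F n)" for n
    proof (induction n)
      case (Suc n)
      show ?case unfolding pert_Suc by (rule piecewise_S_add[OF piecewise_refine[OF Suc] h]) simp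
    qed (use fS in simp)
    have "is_projection \<mu> (piecewise_space S (F n)) (perturbed f p lam (Suc n)) (perturbed f p lam n)" for n
      unfolding is_projection_def
    proof (intro conjI ballI pert)
      fix w assume w: "w \<in> piecewise_space S (F n)"
      have hw: "(\<lambda>x. h (Suc n) x * w x) \<in> piecewise_space S2 (F (Suc n))"
        by (rule piecewise_mult[OF h piecewise_refine[OF w]]) simp
      have "(\<integral>x. (perturbed f p lam (Suc n) x - perturbed f p lam n x) * w x \<partial>\<mu>) = (LINT x:\<Omega>|\<mu>. h (Suc n) x * w x)"
        unfolding pert_Suc using set_integral_space[OF int_\<mu>[OF hw]] by (simp add: space)
      also have "\<dots> = (\<Sum>A\<in>sub n \<Omega>. LINT x:A|\<mu>. h (Suc n) x * w x)"
        by (rule set_integral_sub[OF sets int_\<mu>[OF hw], of \<Omega> 0 n]) (auto simp: At_0)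
      also have "\<dots> = 0"
      proof (rule sum.neutral, rule ballI)
        fix A assume "A \<in> sub n \<Omega>"
        then have A: "A \<in> At n" by (simp add: sub_def)
        then obtain q where q: "q \<in> S" "\<And>x. x \<in> A \<Longrightarrow> w x = q x" using w unfolding piecewise_space_def by blast
        have "(LINT x:A|\<mu>. h (Suc n) x * w x) = (LINT x:A|\<mu>. h (Suc n) x * q x)"
          using q(2) At_sets[OF A] sets by (intro set_lebesgue_integral_cong) auto
        then show "(LINT x:A|\<mu>. h (Suc n) x * w x) = 0" using \<mu>(4)[OF A q(1)] by simp
      qed
      finally show "(\<integral>x. (perturbed f p lam (Suc n) x - perturbed f p lam n x) * w x \<partial>\<mu>) = 0" .
    qed
    then have "is_projection \<mu> (piecewise_space S (F (n - 1))) (perturbed f p lam n) (perturbed f p lam (n - 1))" if "n \<ge> 1" for n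
      using that by (metis Suc_diff_1 less_eq_Suc_le One_nat_def)
    then have "smartingale S F \<mu> (perturbed f p lam)"
      unfolding smartingale_def using int_\<mu>[OF piecewise_S_S2[OF pert]] by blast
    moreover have "(v B / v A) powr (1 + c * lam) \<le> measure \<mu> B / measure \<mu> A \<and>
          measure \<mu> B / measure \<mu> A \<le> (v B / v A) powr (1 - c * lam)"
      if A: "A \<in> At n" and B: "B \<in> At m" and BA: "B \<subseteq> A" for A B n m
    proof (cases "n \<le> m")
      case True
      then obtain j where j: "m = n + j" by (metis le_iff_add)
      have "D.\<epsilon> = c * lam" by (simp add: D.\<epsilon>_def c_def)
      then show ?thesis using D.Q_ratio_powr[OF A _ BA, of j] B \<mu>(3)[OF A] \<mu>(3)[OF B] unfolding j by simp
    next
      case False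
      \<comment> \<open>An atom of a coarser level that lies inside \<open>A\<close> must equal
        \<open>A\<close>, and then both ratios are 1.\<close>
      have "A \<subseteq> B" by (rule At_nested[OF _ B A]) (use False BA At_nonempty[OF B] in auto)
      then have "B = A" using BA by simp
      then show ?thesis using v_pos[OF A] D.Q_pos[OF A] \<mu>(3)[OF A] by simp
    qed
    ultimately show ?thesis using \<mu>(1,2) by (intro exI[of _ \<mu>]) blast
  qed
  show ?thesis unfolding vol_def
    by (rule exI[of _ lam\<^sub>0], rule conjI[OF pos(1)], rule exI[of _ c], rule conjI[OF pos(2)], intro allI impI, rule main) auto
qed

end

lemma ell_ge: "ell S l\<^sub>0 \<ge> l\<^sub>0"
proof -
  let ?m = "dim S + dim (square_space S)"
  \<comment> \<open>Any admissible exponent will do here: it shows that the set behind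
    \<open>LEAST\<close> is nonempty, so that the minimum inherits the lower bound.\<close>
  have "?m \<le> 2 ^ (l\<^sub>0 + ?m + 1)" using less_exp[of "l\<^sub>0 + ?m + 1"] by linarith
  then have "l\<^sub>0 \<le> l\<^sub>0 + ?m \<and> dim S + dim (square_space S) \<le> 2 ^ (l\<^sub>0 + ?m + 1)" by simp
  then show ?thesis unfolding ell_def by (rule LeastI2) simp
qed

theorem theorem2p9:
  fixes \<Omega> :: "'a::euclidean_space set"
    and F :: "nat \<Rightarrow> 'a measure"
    and S :: "('a \<Rightarrow> real) set"
    and c\<^sub>0 c\<^sub>4 \<kappa> :: real
    and l\<^sub>0 :: nat
  assumes Omega: "convex \<Omega>" "compact \<Omega>" "emeasure lborel \<Omega> > 0"
    and filtration: "binary_filtration \<Omega> F"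
    and convex_atoms: "\<And>n A. A \<in> atoms (F n) \<Longrightarrow> convex A"
    and mesh: "(\<lambda>n. Max (diameter ` atoms (F n))) \<longlonglongrightarrow> 0"
    and width: "c\<^sub>4 > 0" "\<And>n A. A \<in> atoms (F n) \<Longrightarrow> width A \<ge> c\<^sub>4 * diameter A"
    and S_polynomials: "\<And>g. g \<in> S \<Longrightarrow> real_polynomial_function g"
    and S_space: "subspace S" "\<exists>B. finite B \<and> span B = S" "dim S > 1" "(\<lambda>_. 1) \<in> S"
    and comparable: "c\<^sub>0 > 0" "comparable_siblings \<Omega> F c\<^sub>0"
    and ell_0: "\<And>k. k \<ge> l\<^sub>0 \<Longrightarrow> norm_recovery \<Omega> F S k"
    and kappa: "\<kappa> \<ge> 1"
  shows "\<exists>lam\<^sub>0>0. \<exists>c>0. \<forall>(f :: nat \<Rightarrow> 'a \<Rightarrow> real) (p :: nat \<Rightarrow> 'a \<Rightarrow> real) lam.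
      smartingale S F (normalized_lebesgue \<Omega>) f \<and>
      nu_sparse \<Omega> (ell S l\<^sub>0) f \<and>
      (\<forall>n\<ge>1. p n \<in> piecewise_space S (F n) \<and>
        (\<forall>x\<in>\<Omega>. p n x \<ge> 0 \<and>
          inverse \<kappa> * real_cond_exp (normalized_lebesgue \<Omega>) (F n) (\<lambda>y. \<bar>increment f n y\<bar>) x
            \<le> real_cond_exp (normalized_lebesgue \<Omega>) (F n) (p n) x \<and>
          real_cond_exp (normalized_lebesgue \<Omega>) (F n) (p n) x
            \<le> \<kappa> * real_cond_exp (normalized_lebesgue \<Omega>) (F n) (\<lambda>y. \<bar>increment f n y\<bar>) x)) \<and>
      0 < lam \<and> lam \<le> lam\<^sub>0 \<longrightarrow>
      (\<exists>\<mu> :: 'a measure.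
        prob_space \<mu> \<and> sets \<mu> = sets (restrict_space borel \<Omega>) \<and>
        smartingale S F \<mu> (perturbed f p lam) \<and>
        (\<forall>A\<in>(\<Union>n. atoms (F n)). \<forall>B\<in>(\<Union>n. atoms (F n)). B \<subseteq> A \<longrightarrow>
          (vol \<Omega> B / vol \<Omega> A) powr (1 + c * lam) \<le> measure \<mu> B / measure \<mu> A \<and>
          measure \<mu> B / measure \<mu> A \<le> (vol \<Omega> B / vol \<Omega> A) powr (1 - c * lam)))"
proof -
  interpret fat_filtration \<Omega> F S c\<^sub>0 c\<^sub>4
    by (rule fat_filtration.intro)
      (erule convex_atoms width(2) S_polynomials | rule Omega filtration mesh width(1) S_space comparable)+
  show ?thesis by (rule smartingale_perturbation[OF ell_0[OF ell_ge] kappa])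
qed

end
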